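(* Let $(A_n,\rho_{n+1,n})_n$ be a $C^*$-encoding system with limit $L\subset A_\infty$ and $C^*$-limit $C^*_{\bullet}(L)$, and let $\Theta=\mathrm{id}_L\colon C^*_{\bullet}(L)\to A_\infty$. Then for any $C^*$-algebra $A$ and any complete order embedding $\psi\colon A\to A_\infty$ with $\psi(A)=L$, the map $\Theta^{-1}\circ\psi\colon A\to C^*_{\bullet}(L)$ is a $*$-isomorphism.
   Context: A map is c.p.c. if it is completely positive and contractive. For a sequence $(A_n)_{n\ge 0}$ of $C^*$-algebras, $\prod_n A_n$ denotes the $C^*$-algebra of norm bounded sequences, $\bigoplus_n A_n$ its ideal of sequences converging to $0$ in norm, $A_\infty=\prod_n A_n/\bigoplus_n A_n$, and $[(a_n)_n]$ the class of $(a_n)_n$. A c.p.c. system $(A_n,\rho_{n+1,n})_n$ consists of $C^*$-algebras $(A_n)_{n\ge0}$ and c.p.c. maps $\rho_{n+1,n}\colon A_n\to A_{n+1}$. For $m>n$ set $\rho_{m,n}=\rho_{m,m-1}\circ\cdots\circ\rho_{n+1,n}$ and $\rho_{n,n}=\mathrm{id}_{A_n}$. Define $\rho_n\colon A_n\to A_\infty$ by $\rho_n(x)=[(\rho_{m,n}(x))_{m>n}]$. The limit of the system is the closed self-adjoint subspace $L=\overline{\bigcup_n\rho_n(A_n)}\subset A_\infty$. A c.p.c. system is $C^*$-encoding if for any $k\ge0$, $x,y\in A_k$ and $\varepsilon>0$ there is $M>k$ such that for all $m>n,j>M$ (that is, $n,j>M$ and $m>\max\{n,j\}$), $$\|\rho_{m,n}(\rho_{n,k}(x)\rho_{n,k}(y))-\rho_{m,j}(\rho_{j,k}(x)\rho_{j,k}(y))\|<\varepsilon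 .$$ The $C^*$-limit of a $C^*$-encoding system is the $C^*$-algebra $C^*_{\bullet}(L)$ obtained by equipping $L$ with the norm and involution inherited from $A_\infty$ and with the (bounded, associative, bilinear) product $\bullet\colon L\times L\to L$ determined on the dense subspace $\bigcup_n\rho_n(A_n)$ by $\rho_k(x)\bullet\rho_k(y)=\lim_n\rho_n(\rho_{n,k}(x)\rho_{n,k}(y))$ for $k\ge0$, $x,y\in A_k$. $\Theta$ is the identity map of the underlying set $L$, with image $L\subset A_\infty$. For self-adjoint subspaces $X\subset A$, $Y\subset B$ of $C^*$-algebras, a $*$-linear map $\theta\colon X\to Y$ is completely positive (c.p.) if for every $r\ge1$ the amplification $\theta^{(r)}\colon M_r(X)\to M_r(Y)$ sends elements that are positive in $M_r(A)$ to elements positive in $M_r(B)$; it is completely isometric if every $\theta^{(r)}$ is isometric for the norms of $M_r(A)$ and $M_r(B)$. It is a complete order embedding if it is c.p. and completely isometric and $\theta^{-1}\colon\theta(X)\to X$ is c.p. *)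

theory Defs
  imports
    "HOL-Analysis.Abstract_Metric_Spaces"
    "Jordan_Normal_Form.Matrix"
    "HOL-Algebra.Module"
    "HOL-Algebra.QuotRing"
begin

section \<open>C*-algebras\<close>

text \<open>
  C*-algebras are carrier-based, so that the members of a sequence of C*-algebras may differ.
  They need not be unital: as for modules in HOL-Algebra, the record field \<^const>\<open>one\<close> is present
  but carries no meaning.
\<close>

definition complex_ring :: "complex ring" where
  "complex_ring = \<lparr>carrier = UNIV, mult = (*), one = 1, zero = 0, add = (+)\<rparr>"

record 'a cstar = "(complex, 'a) module" +
  star :: "'a \<Rightarrow> 'a"
  nrm :: "'a \<Rightarrow> real"

text \<open>The library's \<^locale>\<open>Metric_space\<close> asks for a symmetric nonnegative distance on the whole
  type; hence the value 0 outside the carrier.\<close>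

definition cdist :: "'a cstar \<Rightarrow> 'a \<Rightarrow> 'a \<Rightarrow> real" where
  "cdist A x y = (if x \<in> carrier A \<and> y \<in> carrier A then nrm A (x \<ominus>\<^bsub>A\<^esub> y) else 0)"

abbreviation ctopology :: "'a cstar \<Rightarrow> 'a topology" where
  "ctopology A \<equiv> Metric_space.mtopology (carrier A) (cdist A)"

locale cstar_algebra = Module.module complex_ring A for A :: "'a cstar" (structure) +
  assumes mult_closed: "\<lbrakk>x \<in> carrier A; y \<in> carrier A\<rbrakk> \<Longrightarrow> x \<otimes> y \<in> carrier A"
    and mult_assoc: "\<lbrakk>x \<in> carrier A; y \<in> carrier A; z \<in> carrier A\<rbrakk> \<Longrightarrow>
      (x \<otimes> y) \<otimes> z = x \<otimes> (y \<otimes> z)"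
    and distrib_right: "\<lbrakk>x \<in> carrier A; y \<in> carrier A; z \<in> carrier A\<rbrakk> \<Longrightarrow>
      (x \<oplus> y) \<otimes> z = x \<otimes> z \<oplus> y \<otimes> z"
    and distrib_left: "\<lbrakk>x \<in> carrier A; y \<in> carrier A; z \<in> carrier A\<rbrakk> \<Longrightarrow>
      z \<otimes> (x \<oplus> y) = z \<otimes> x \<oplus> z \<otimes> y"
    and smult_mult_left: "\<lbrakk>x \<in> carrier A; y \<in> carrier A\<rbrakk> \<Longrightarrow>
      (c \<odot> x) \<otimes> y = c \<odot> (x \<otimes> y)"
    and smult_mult_right: "\<lbrakk>x \<in> carrier A; y \<in> carrier A\<rbrakk> \<Longrightarrow>
      x \<otimes> (c \<odot> y) = c \<odot> (x \<otimes> y)"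
    and star_closed: "x \<in> carrier A \<Longrightarrow> star A x \<in> carrier A"
    and star_add: "\<lbrakk>x \<in> carrier A; y \<in> carrier A\<rbrakk> \<Longrightarrow> star A (x \<oplus> y) = star A x \<oplus> star A y"
    and star_smult: "x \<in> carrier A \<Longrightarrow> star A (c \<odot> x) = cnj c \<odot> star A x"
    and star_mult: "\<lbrakk>x \<in> carrier A; y \<in> carrier A\<rbrakk> \<Longrightarrow> star A (x \<otimes> y) = star A y \<otimes> star A x"
    and star_star: "x \<in> carrier A \<Longrightarrow> star A (star A x) = x"
    and nrm_nonneg: "x \<in> carrier A \<Longrightarrow> 0 \<le> nrm A x"
    and nrm_eq_0_iff: "x \<in> carrier A \<Longrightarrow> nrm A x = 0 \<longleftrightarrow> x = \<zero>"
    and nrm_triangle: "\<lbrakk>x \<in> carrier A; y \<in> carrier A\<rbrakk> \<Longrightarrow> nrm A (x \<oplus> y) \<le> nrm A x + nrm A y"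
    and nrm_smult: "x \<in> carrier A \<Longrightarrow> nrm A (c \<odot> x) = cmod c * nrm A x"
    and nrm_mult: "\<lbrakk>x \<in> carrier A; y \<in> carrier A\<rbrakk> \<Longrightarrow> nrm A (x \<otimes> y) \<le> nrm A x * nrm A y"
    and cstar_identity: "x \<in> carrier A \<Longrightarrow> nrm A (star A x \<otimes> x) = (nrm A x)\<^sup>2"
    and complete: "Metric_space.mcomplete (carrier A) (cdist A)"

definition positive :: "'a cstar \<Rightarrow> 'a \<Rightarrow> bool" where
  "positive A a \<longleftrightarrow> (\<exists>b\<in>carrier A. a = star A b \<otimes>\<^bsub>A\<^esub> b)"

definition star_isomorphism :: "'a cstar \<Rightarrow> 'b cstar \<Rightarrow> ('a \<Rightarrow> 'b) \<Rightarrow> bool" where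
  "star_isomorphism A B f \<longleftrightarrow>
     bij_betw f (carrier A) (carrier B) \<and>
     (\<forall>x\<in>carrier A. \<forall>y\<in>carrier A. f (x \<oplus>\<^bsub>A\<^esub> y) = f x \<oplus>\<^bsub>B\<^esub> f y) \<and>
     (\<forall>c. \<forall>x\<in>carrier A. f (c \<odot>\<^bsub>A\<^esub> x) = c \<odot>\<^bsub>B\<^esub> f x) \<and>
     (\<forall>x\<in>carrier A. \<forall>y\<in>carrier A. f (x \<otimes>\<^bsub>A\<^esub> y) = f x \<otimes>\<^bsub>B\<^esub> f y) \<and>
     (\<forall>x\<in>carrier A. f (star A x) = star B (f x))"


section \<open>Matrix amplifications\<close>

definition matrices_over :: "nat \<Rightarrow> 'a set \<Rightarrow> 'a mat set" where
  "matrices_over r X = {M \<in> carrier_mat r r. elements_mat M \<subseteq> X}"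

definition matrix_star_algebra :: "'a cstar \<Rightarrow> nat \<Rightarrow> ('a mat \<Rightarrow> real) \<Rightarrow> 'a mat cstar" where
  "matrix_star_algebra A r N =
    \<lparr>carrier = matrices_over r (carrier A),
     mult = (\<lambda>M P. mat r r (\<lambda>(i,j). \<Oplus>\<^bsub>A\<^esub>k\<in>{..<r}. M $$ (i,k) \<otimes>\<^bsub>A\<^esub> P $$ (k,j))),
     one = mat r r (\<lambda>(i,j). if i = j then \<one>\<^bsub>A\<^esub> else \<zero>\<^bsub>A\<^esub>),
     zero = mat r r (\<lambda>_. \<zero>\<^bsub>A\<^esub>),
     add = (\<lambda>M P. mat r r (\<lambda>(i,j). M $$ (i,j) \<oplus>\<^bsub>A\<^esub> P $$ (i,j))),
     smult = (\<lambda>c M. mat r r (\<lambda>(i,j). c \<odot>\<^bsub>A\<^esub> M $$ (i,j))),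
     star = (\<lambda>M. mat r r (\<lambda>(i,j). star A (M $$ (j,i)))),
     nrm = N\<rparr>"

text \<open>For a C*-algebra \<open>A\<close>, the *-algebra of \<open>r \<times> r\<close> matrices over \<open>A\<close> has a C*-norm, and its
  values on the carrier are unique.\<close>

definition matrix_algebra :: "'a cstar \<Rightarrow> nat \<Rightarrow> 'a mat cstar" where
  "matrix_algebra A r =
     matrix_star_algebra A r (SOME N. cstar_algebra (matrix_star_algebra A r N))"


section \<open>Complete order embeddings\<close>

text \<open>In the following, \<open>X\<close> and \<open>Y\<close> are self-adjoint subspaces of \<open>A\<close> and \<open>B\<close>; the amplification of
  \<open>\<theta>\<close> is \<^term>\<open>map_mat \<theta>\<close>.\<close>

definition star_linear ::
  "'a cstar \<Rightarrow> 'a set \<Rightarrow> 'b cstar \<Rightarrow> 'b set \<Rightarrow> ('a \<Rightarrow> 'b) \<Rightarrow> bool" where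
  "star_linear A X B Y \<theta> \<longleftrightarrow>
     \<theta> \<in> X \<rightarrow> Y \<and>
     (\<forall>x\<in>X. \<forall>y\<in>X. \<theta> (x \<oplus>\<^bsub>A\<^esub> y) = \<theta> x \<oplus>\<^bsub>B\<^esub> \<theta> y) \<and>
     (\<forall>c. \<forall>x\<in>X. \<theta> (c \<odot>\<^bsub>A\<^esub> x) = c \<odot>\<^bsub>B\<^esub> \<theta> x) \<and>
     (\<forall>x\<in>X. \<theta> (star A x) = star B (\<theta> x))"

definition completely_positive ::
  "'a cstar \<Rightarrow> 'a set \<Rightarrow> 'b cstar \<Rightarrow> 'b set \<Rightarrow> ('a \<Rightarrow> 'b) \<Rightarrow> bool" where
  "completely_positive A X B Y \<theta> \<longleftrightarrow>
     star_linear A X B Y \<theta> \<and>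
     (\<forall>r\<ge>1. \<forall>M\<in>matrices_over r X.
        positive (matrix_algebra A r) M \<longrightarrow> positive (matrix_algebra B r) (map_mat \<theta> M))"

definition completely_isometric ::
  "'a cstar \<Rightarrow> 'a set \<Rightarrow> 'b cstar \<Rightarrow> ('a \<Rightarrow> 'b) \<Rightarrow> bool" where
  "completely_isometric A X B \<theta> \<longleftrightarrow>
     (\<forall>r\<ge>1. \<forall>M\<in>matrices_over r X.
        nrm (matrix_algebra B r) (map_mat \<theta> M) = nrm (matrix_algebra A r) M)"

definition complete_order_embedding ::
  "'a cstar \<Rightarrow> 'a set \<Rightarrow> 'b cstar \<Rightarrow> 'b set \<Rightarrow> ('a \<Rightarrow> 'b) \<Rightarrow> bool" where
  "complete_order_embedding A X B Y \<theta> \<longleftrightarrow>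
     completely_positive A X B Y \<theta> \<and>
     completely_isometric A X B \<theta> \<and>
     completely_positive B (\<theta> ` X) A X (inv_into X \<theta>)"


section \<open>The sequence algebra\<close>

definition product_algebra :: "(nat \<Rightarrow> 'a cstar) \<Rightarrow> (nat \<Rightarrow> 'a) cstar" where
  "product_algebra A =
    \<lparr>carrier = {a. (\<forall>n. a n \<in> carrier (A n)) \<and> bdd_above (range (\<lambda>n. nrm (A n) (a n)))},
     mult = (\<lambda>a b n. a n \<otimes>\<^bsub>A n\<^esub> b n),
     one = (\<lambda>n. \<one>\<^bsub>A n\<^esub>),
     zero = (\<lambda>n. \<zero>\<^bsub>A n\<^esub>),
     add = (\<lambda>a b n. a n \<oplus>\<^bsub>A n\<^esub> b n),
     smult = (\<lambda>c a n. c \<odot>\<^bsub>A n\<^esub> a n),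
     star = (\<lambda>a n. star (A n) (a n)),
     nrm = (\<lambda>a. SUP n. nrm (A n) (a n))\<rparr>"

definition null_sequences :: "(nat \<Rightarrow> 'a cstar) \<Rightarrow> (nat \<Rightarrow> 'a) set" where
  "null_sequences A =
     {a \<in> carrier (product_algebra A). (\<lambda>n. nrm (A n) (a n)) \<longlonglongrightarrow> 0}"

definition quotient_algebra :: "'a cstar \<Rightarrow> 'a set \<Rightarrow> 'a set cstar" where
  "quotient_algebra B J =
    \<lparr>carrier = carrier (B Quot J),
     mult = mult (B Quot J),
     one = one (B Quot J),
     zero = zero (B Quot J),
     add = add (B Quot J),
     smult = (\<lambda>c X. \<Union>x\<in>X. J +>\<^bsub>B\<^esub> (c \<odot>\<^bsub>B\<^esub> x)),
     star = (\<lambda>X. \<Union>x\<in>X. J +>\<^bsub>B\<^esub> star B x),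
     nrm = (\<lambda>X. INF x\<in>X. nrm B x)\<rparr>"

definition sequence_algebra :: "(nat \<Rightarrow> 'a cstar) \<Rightarrow> (nat \<Rightarrow> 'a) set cstar" where
  "sequence_algebra A = quotient_algebra (product_algebra A) (null_sequences A)"

definition sequence_class :: "(nat \<Rightarrow> 'a cstar) \<Rightarrow> (nat \<Rightarrow> 'a) \<Rightarrow> (nat \<Rightarrow> 'a) set" where
  "sequence_class A a = null_sequences A +>\<^bsub>product_algebra A\<^esub> a"


section \<open>C.p.c. systems and their limits\<close>

text \<open>\<open>\<rho> n\<close> is the connecting map from \<open>A n\<close> to \<open>A (Suc n)\<close>.\<close>

definition cpc_system :: "(nat \<Rightarrow> 'a cstar) \<Rightarrow> (nat \<Rightarrow> 'a \<Rightarrow> 'a) \<Rightarrow> bool" where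
  "cpc_system A \<rho> \<longleftrightarrow>
     (\<forall>n. cstar_algebra (A n)) \<and>
     (\<forall>n. completely_positive (A n) (carrier (A n)) (A (Suc n)) (carrier (A (Suc n))) (\<rho> n)) \<and>
     (\<forall>n. \<forall>x\<in>carrier (A n). nrm (A (Suc n)) (\<rho> n x) \<le> nrm (A n) x)"

text \<open>\<open>connecting \<rho> m n\<close> is the composite map from \<open>A n\<close> to \<open>A m\<close>; it is only meaningful for
  \<open>m \<ge> n\<close>.\<close>

primrec connecting :: "(nat \<Rightarrow> 'a \<Rightarrow> 'a) \<Rightarrow> nat \<Rightarrow> nat \<Rightarrow> 'a \<Rightarrow> 'a" where
  "connecting \<rho> 0 n = id"
| "connecting \<rho> (Suc m) n = (if n \<le> m then \<rho> m \<circ> connecting \<rho> m n else id)"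

text \<open>The sequence \<open>(\<rho>\<^bsub>m,n\<^esub>(x))\<^bsub>m>n\<^esub>\<close> is padded with zeros.\<close>

definition limit_map ::
  "(nat \<Rightarrow> 'a cstar) \<Rightarrow> (nat \<Rightarrow> 'a \<Rightarrow> 'a) \<Rightarrow> nat \<Rightarrow> 'a \<Rightarrow> (nat \<Rightarrow> 'a) set" where
  "limit_map A \<rho> n x =
     sequence_class A (\<lambda>m. if m > n then connecting \<rho> m n x else \<zero>\<^bsub>A m\<^esub>)"

definition system_limit ::
  "(nat \<Rightarrow> 'a cstar) \<Rightarrow> (nat \<Rightarrow> 'a \<Rightarrow> 'a) \<Rightarrow> (nat \<Rightarrow> 'a) set set" where
  "system_limit A \<rho> =
     ctopology (sequence_algebra A) closure_of (\<Union>n. limit_map A \<rho> n ` carrier (A n))"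

definition cstar_encoding :: "(nat \<Rightarrow> 'a cstar) \<Rightarrow> (nat \<Rightarrow> 'a \<Rightarrow> 'a) \<Rightarrow> bool" where
  "cstar_encoding A \<rho> \<longleftrightarrow>
     (\<forall>k. \<forall>x\<in>carrier (A k). \<forall>y\<in>carrier (A k). \<forall>\<epsilon>>0. \<exists>M>k. \<forall>m n j.
        n > M \<and> j > M \<and> m > max n j \<longrightarrow>
        nrm (A m)
          (connecting \<rho> m n (connecting \<rho> n k x \<otimes>\<^bsub>A n\<^esub> connecting \<rho> n k y) \<ominus>\<^bsub>A m\<^esub>
           connecting \<rho> m j (connecting \<rho> j k x \<otimes>\<^bsub>A j\<^esub> connecting \<rho> j k y)) < \<epsilon>)"

definition is_limit_product ::
  "(nat \<Rightarrow> 'a cstar) \<Rightarrow> (nat \<Rightarrow> 'a \<Rightarrow> 'a) \<Rightarrow>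
     ((nat \<Rightarrow> 'a) set \<Rightarrow> (nat \<Rightarrow> 'a) set \<Rightarrow> (nat \<Rightarrow> 'a) set) \<Rightarrow> bool" where
  "is_limit_product A \<rho> p \<longleftrightarrow> (let Q = sequence_algebra A; L = system_limit A \<rho> in
     (\<forall>x\<in>L. \<forall>y\<in>L. p x y \<in> L) \<and>
     (\<forall>x\<in>L. \<forall>y\<in>L. \<forall>z\<in>L. p (x \<oplus>\<^bsub>Q\<^esub> y) z = p x z \<oplus>\<^bsub>Q\<^esub> p y z) \<and>
     (\<forall>x\<in>L. \<forall>y\<in>L. \<forall>z\<in>L. p z (x \<oplus>\<^bsub>Q\<^esub> y) = p z x \<oplus>\<^bsub>Q\<^esub> p z y) \<and>
     (\<forall>c. \<forall>x\<in>L. \<forall>y\<in>L. p (c \<odot>\<^bsub>Q\<^esub> x) y = c \<odot>\<^bsub>Q\<^esub> p x y) \<and>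
     (\<forall>c. \<forall>x\<in>L. \<forall>y\<in>L. p x (c \<odot>\<^bsub>Q\<^esub> y) = c \<odot>\<^bsub>Q\<^esub> p x y) \<and>
     (\<forall>x\<in>L. \<forall>y\<in>L. \<forall>z\<in>L. p (p x y) z = p x (p y z)) \<and>
     (\<exists>C. \<forall>x\<in>L. \<forall>y\<in>L. nrm Q (p x y) \<le> C * nrm Q x * nrm Q y) \<and>
     (\<forall>k. \<forall>x\<in>carrier (A k). \<forall>y\<in>carrier (A k).
        limitin (ctopology Q)
          (\<lambda>n. limit_map A \<rho> n (connecting \<rho> n k x \<otimes>\<^bsub>A n\<^esub> connecting \<rho> n k y))
          (p (limit_map A \<rho> k x) (limit_map A \<rho> k y)) sequentially))"

text \<open>For a C*-encoding system, \<^const>\<open>is_limit_product\<close> determines the product on \<open>L \<times> L\<close>.\<close>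

definition limit_product ::
  "(nat \<Rightarrow> 'a cstar) \<Rightarrow> (nat \<Rightarrow> 'a \<Rightarrow> 'a) \<Rightarrow>
     (nat \<Rightarrow> 'a) set \<Rightarrow> (nat \<Rightarrow> 'a) set \<Rightarrow> (nat \<Rightarrow> 'a) set" where
  "limit_product A \<rho> = (SOME p. is_limit_product A \<rho> p)"

definition cstar_limit ::
  "(nat \<Rightarrow> 'a cstar) \<Rightarrow> (nat \<Rightarrow> 'a \<Rightarrow> 'a) \<Rightarrow> (nat \<Rightarrow> 'a) set cstar" where
  "cstar_limit A \<rho> =
     (sequence_algebra A)\<lparr>carrier := system_limit A \<rho>, mult := limit_product A \<rho>\<rparr>"

definition limit_embedding ::
  "(nat \<Rightarrow> 'a cstar) \<Rightarrow> (nat \<Rightarrow> 'a \<Rightarrow> 'a) \<Rightarrow> (nat \<Rightarrow> 'a) set \<Rightarrow> (nat \<Rightarrow> 'a) set" where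
  "limit_embedding A \<rho> = (\<lambda>x\<in>carrier (cstar_limit A \<rho>). x)"

end

theory Submission
  imports Defs "HOL-Analysis.Operator_Norm"
begin

text \<open>
  Put \<open>\<phi>\<^sub>n = \<psi>\<inverse> \<circ> \<rho>\<^sub>n\<close>, a c.p.c. map from \<open>A\<^sub>n\<close> to the C*-algebra \<open>B\<close> on which \<open>\<psi>\<close> is defined, with
  \<open>\<phi>\<^sub>m \<circ> \<rho>\<^sub>m\<^sub>,\<^sub>k = \<phi>\<^sub>k\<close>. Let \<open>x \<in> A\<^sub>k\<close>, \<open>x\<^sub>m = \<rho>\<^sub>m\<^sub>,\<^sub>k(x)\<close> and \<open>b = \<phi>\<^sub>k(x)\<close>. The Schwarz inequality for \<open>\<phi>\<^sub>m\<close> gives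
  \<open>\<phi>\<^sub>m(x\<^sub>m\<^sup>* x\<^sub>m) \<ge> b\<^sup>* b\<close>. The Schwarz inequality for \<open>\<psi>\<close> gives \<open>\<psi>(b\<^sup>* b) \<ge> [(x\<^sub>m\<^sup>* x\<^sub>m)\<^sub>m]\<close>; approximating \<open>\<psi>(b\<^sup>* b)\<close> by some
  \<open>\<rho>\<^sub>n(d)\<close>, lifting the difference, which is a square up to a small error, to \<open>A\<^sub>m\<close> for large \<open>m\<close>, and
  applying \<open>\<phi>\<^sub>m\<close> shows that \<open>b\<^sup>* b \<ge> \<phi>\<^sub>m(x\<^sub>m\<^sup>* x\<^sub>m)\<close> up to a small error. So \<open>\<phi>\<^sub>m(x\<^sub>m\<^sup>* x\<^sub>m)\<close> converges to \<open>b\<^sup>* b\<close>, and by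
  polarization \<open>\<rho>\<^sub>m(x\<^sub>m y\<^sub>m)\<close> converges to \<open>\<psi>(\<phi>\<^sub>k(x) \<phi>\<^sub>k(y))\<close>. Hence the product of \<open>B\<close>, transported to the limit by
  \<open>\<psi>\<close>, has the property that determines the product of the C*-limit.
\<close>

section \<open>Positivity in unital C*-algebras\<close>

text \<open>The upper bound is the delicate half. The class of the sequence of squares of
  \<open>x_m\<close> is the square of \<open>rho_k(x)\<close> in the sequence algebra and lies
  outside \<open>L\<close> in general, so the inverse of \<open>\<psi>\<close> cannot be applied to
  an inequality between classes. Therefore the Schwarz defect of \<open>\<psi>\<close> at
  \<open>b\<close> is written as a square \<open>star V V\<close> and \<open>V\<close> is
  represented by a bounded sequence \<open>v\<close>: for large \<open>m\<close> an identity up to a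
  small error remains in \<open>A m\<close>, where \<open>phi m\<close> is defined on every term and
  sends the square of \<open>v m\<close> to a positive element. Three circumstances shape the
  preliminaries. The algebras may lack a unit, so order and approximate units are obtained in the
  unitization. They sit on carriers that vary with \<open>m\<close>, whereas norms and limits are
  handled best on types; one type of bounded families contains them all. Finally, matrix algebras
  carry a C*-norm picked by \<open>SOME\<close>. Size two enters through positivity, which is
  algebraic; size one enters through the norm, which has to be identified with that of the algebra
  by existence and uniqueness of the C*-norm.\<close>

class cstar_normed_algebra = real_normed_algebra + complete_space +
  fixes scaleC :: "complex \<Rightarrow> 'a \<Rightarrow> 'a" (infixr "*\<^sub>C" 75)
    and adj :: "'a \<Rightarrow> 'a"
  assumes scaleR_scaleC: "r *\<^sub>R x = complex_of_real r *\<^sub>C x"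
    and scaleC_add_right: "c *\<^sub>C (x + y) = c *\<^sub>C x + c *\<^sub>C y"
    and scaleC_add_left: "(c + d) *\<^sub>C x = c *\<^sub>C x + d *\<^sub>C x"
    and scaleC_scaleC: "c *\<^sub>C d *\<^sub>C x = (c * d) *\<^sub>C x"
    and mult_scaleC_left: "(c *\<^sub>C x) * y = c *\<^sub>C (x * y)"
    and mult_scaleC_right: "x * (c *\<^sub>C y) = c *\<^sub>C (x * y)"
    and norm_scaleC: "norm (c *\<^sub>C x) = cmod c * norm x"
    and adj_add: "adj (x + y) = adj x + adj y"
    and adj_scaleC: "adj (c *\<^sub>C x) = cnj c *\<^sub>C adj x"
    and adj_mult: "adj (x * y) = adj y * adj x"
    and adj_adj [simp]: "adj (adj x) = x"
    and norm_adj_mult: "norm (adj x * x) = (norm x)\<^sup>2"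

class cstar_normed_algebra_1 = cstar_normed_algebra + real_normed_algebra_1

subclass (in cstar_normed_algebra) banach ..

section \<open>Elementary consequences of the C*-axioms\<close>

lemma scaleC_one [simp]: "1 *\<^sub>C x = x"
  using scaleR_scaleC[of 1 x] by simp

lemma scaleC_zero_left [simp]: "0 *\<^sub>C x = 0"
  using scaleR_scaleC[of 0 x] by simp

lemma scaleC_minus_left: "(- c) *\<^sub>C x = - (c *\<^sub>C x)"
  using scaleC_add_left[of c "- c" x] by (simp add: eq_neg_iff_add_eq_0 add.commute)

lemma scaleC_zero_right [simp]: "c *\<^sub>C 0 = 0"
  using norm_scaleC[of c 0] by simp

lemma scaleC_minus_right: "c *\<^sub>C (- x) = - (c *\<^sub>C x)"
  using scaleC_add_right[of c x "- x"] by (simp add: eq_neg_iff_add_eq_0 add.commute)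

lemma scaleC_diff_right: "c *\<^sub>C (x - y) = c *\<^sub>C x - c *\<^sub>C y"
  using scaleC_add_right[of c x "- y"] by (simp add: scaleC_minus_right)

lemma adj_zero [simp]: "adj 0 = 0"
  using adj_add[of 0 0] by simp

lemma adj_minus: "adj (- x) = - adj x"
  using adj_add[of x "- x"] by (simp add: eq_neg_iff_add_eq_0 add.commute)

lemma adj_diff: "adj (x - y) = adj x - adj y"
  using adj_add[of x "- y"] by (simp add: adj_minus)

lemma adj_scaleR: "adj (r *\<^sub>R x) = r *\<^sub>R adj x"
  by (simp add: scaleR_scaleC adj_scaleC)

lemma norm_adj [simp]: "norm (adj x) = norm x"
proof -
  have *: "norm y \<le> norm (adj y)" for y
  proof (cases "norm y = 0")
    case False
    have "norm y * norm y \<le> norm (adj y) * norm y"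
      using norm_mult_ineq[of "adj y" y] by (simp add: norm_adj_mult power2_eq_square)
    then show ?thesis using False by simp
  qed auto
  show ?thesis using *[of x] *[of "adj x"] by simp
qed

lemma norm_self_mult: "adj h = h \<Longrightarrow> norm (h * h) = (norm h)\<^sup>2"
  using norm_adj_mult[of h] by simp

lemma norm_mult_adj: "norm (x * adj x) = (norm x)\<^sup>2"
  using norm_adj_mult[of "adj x"] by simp

lemma adj_mult_eq_0: "adj x * x = 0 \<Longrightarrow> x = 0"
  using norm_adj_mult[of x] by simp

lemmas adj_simps = adj_add adj_minus adj_diff adj_scaleC adj_scaleR adj_mult

lemmas scaleC_simps = scaleC_add_right scaleC_diff_right scaleC_minus_right scaleC_minus_left
  scaleC_scaleC mult_scaleC_left mult_scaleC_right

lemma norm_adj_diff_adj: "norm (adj x - adj y) = norm (x - y)"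
  using norm_adj[of "x - y"] by (simp only: adj_diff)

text \<open>For commuting self-adjoint \<open>h\<close>, \<open>k\<close> the element
  \<open>h + i k\<close> is normal, and the C*-identity turns the norm of a sum of two commuting
  squares into the square of its norm. This takes the place of spectral calculus in the norm
  estimates below.\<close>

lemma square_plus_square:
  assumes "adj h = h" "adj k = k" "h * k = k * h"
  shows "adj (h + \<i> *\<^sub>C k) * (h + \<i> *\<^sub>C k) = h * h + k * k"
proof -
  have "adj (h + \<i> *\<^sub>C k) = h + (- \<i>) *\<^sub>C k" using assms by (simp add: adj_simps)
  then have "adj (h + \<i> *\<^sub>C k) * (h + \<i> *\<^sub>C k) = (h + (- \<i>) *\<^sub>C k) * (h + \<i> *\<^sub>C k)" by simp
  also have "\<dots> = h * h + k * k"
    by (simp add: scaleC_simps left_diff_distrib distrib_left assms(3))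
  finally show ?thesis .
qed

text \<open>\<open>h\<close> is the real part of \<open>h + i k\<close>, the mean of that element
  and its adjoint, and the adjoint has the same norm.\<close>

lemma norm_le_norm_add_ii:
  assumes "adj h = h" "adj k = k"
  shows "norm h \<le> norm (h + \<i> *\<^sub>C k)"
proof -
  let ?v = "h + \<i> *\<^sub>C k"
  have "?v + adj ?v = h + h" using assms by (simp add: adj_simps scaleC_simps)
  then have "h = (1/2) *\<^sub>R (?v + adj ?v)" by (simp add: scaleR_2[symmetric])
  then have "norm h = (1/2) * norm (?v + adj ?v)" by (metis norm_scaleR abs_of_nonneg zero_le_divide_1_iff zero_le_numeral)
  also have "\<dots> \<le> (1/2) * (norm ?v + norm (adj ?v))"
    by (intro mult_left_mono norm_triangle_ineq) auto
  finally show ?thesis by simp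
qed

lemma tendsto_adj:
  fixes f :: "'b \<Rightarrow> 'a::cstar_normed_algebra"
  assumes "(f \<longlongrightarrow> l) F"
  shows "((\<lambda>x. adj (f x)) \<longlongrightarrow> adj l) F"
  using assms unfolding tendsto_iff dist_norm by (simp add: norm_adj_diff_adj)

text \<open>\<open>y = 1 - sqrt (1 - x)\<close> is the limit of the iteration \<open>y \<mapsto> (x + y\<^sup>2) / 2\<close>, whose increments are
  dominated by those of the same iteration for the number \<open>1\<close> in place of \<open>x\<close>.\<close>

lemma quadratic_root:
  fixes x :: "'a::cstar_normed_algebra"
  assumes "norm x \<le> 1"
  obtains y where "y + y = x + y * y" "norm y \<le> 1" "\<And>z. z * x = x * z \<Longrightarrow> z * y = y * z"
    "adj x = x \<Longrightarrow> adj y = y"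
proof -
  define Y where "Y = rec_nat 0 (\<lambda>_ y. (1/2) *\<^sub>R (x + y * y))"
  define t :: "nat \<Rightarrow> real" where "t = rec_nat 0 (\<lambda>_ s. (1 + s * s) / 2)"
  have Y0: "Y 0 = 0" and YS: "Y (Suc n) = (1/2) *\<^sub>R (x + Y n * Y n)" for n
    by (simp_all add: Y_def)
  have t0: "t 0 = 0" and tS: "t (Suc n) = (1 + t n * t n) / 2" for n
    by (simp_all add: t_def)
  have tb: "0 \<le> t n \<and> t n \<le> 1" for n
  proof (induction n)
    case (Suc n)
    then have "t n * t n \<le> 1" by (simp add: mult_le_one)
    then show ?case using Suc by (simp add: tS)
  qed (simp add: t0)
  have tm: "t n \<le> t (Suc n)" for n
    using zero_le_square[of "1 - t n"] by (simp add: tS algebra_simps)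
  have Yn: "norm (Y n) \<le> t n" for n
  proof (induction n)
    case (Suc n)
    have "norm (x + Y n * Y n) \<le> norm x + norm (Y n) * norm (Y n)"
      by (meson add_left_mono norm_mult_ineq norm_triangle_ineq order_trans)
    also have "\<dots> \<le> 1 + t n * t n"
      using assms Suc by (intro add_mono mult_mono) (auto simp: tb)
    finally show ?case by (simp add: YS tS)
  qed (simp add: Y0 t0)
  have Yz: "z * Y n = Y n * z" if "z * x = x * z" for z n
  proof (induction n)
    case (Suc n)
    have "z * (Y n * Y n) = (Y n * Y n) * z" by (metis Suc mult.assoc)
    then show ?case using that by (simp add: YS distrib_left distrib_right)
  qed (simp add: Y0)
  have YY: "Y m * Y n = Y n * Y m" for m n
    by (intro Yz) (metis Yz)
  have Yd: "norm (Y (Suc n) - Y n) \<le> t (Suc n) - t n" for n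
  proof (induction n)
    case (Suc n)
    have "Y (Suc (Suc n)) - Y (Suc n) = (1/2) *\<^sub>R (Y (Suc n) * Y (Suc n) - Y n * Y n)"
      by (simp add: YS[of "Suc n"] YS[of n] scaleR_diff_right[symmetric])
    also have "Y (Suc n) * Y (Suc n) - Y n * Y n = (Y (Suc n) - Y n) * (Y (Suc n) + Y n)"
      using YY[of "Suc n" n] by (simp add: algebra_simps)
    finally have "norm (Y (Suc (Suc n)) - Y (Suc n)) = (1/2) * norm ((Y (Suc n) - Y n) * (Y (Suc n) + Y n))"
      by simp
    also have "\<dots> \<le> (1/2) * ((t (Suc n) - t n) * (t (Suc n) + t n))"
    proof (intro mult_left_mono)
      have "norm ((Y (Suc n) - Y n) * (Y (Suc n) + Y n)) \<le> norm (Y (Suc n) - Y n) * norm (Y (Suc n) + Y n)"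
        by (rule norm_mult_ineq)
      also have "\<dots> \<le> (t (Suc n) - t n) * (t (Suc n) + t n)"
        using Suc Yn[of n] Yn[of "Suc n"] norm_triangle_ineq[of "Y (Suc n)" "Y n"] tm[of n]
        by (intro mult_mono) auto
      finally show "norm ((Y (Suc n) - Y n) * (Y (Suc n) + Y n)) \<le> \<dots>" .
    qed simp
    also have "\<dots> = t (Suc (Suc n)) - t (Suc n)"
      by (simp add: tS[of "Suc n"] tS[of n] field_simps)
    finally show ?case .
  qed (use assms in \<open>simp add: YS Y0 tS t0\<close>)
  have Ymn: "norm (Y (m + k) - Y m) \<le> t (m + k) - t m" for m k
  proof (induction k)
    case (Suc k)
    have "norm (Y (m + Suc k) - Y m) \<le> norm (Y (Suc (m + k)) - Y (m + k)) + norm (Y (m + k) - Y m)"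
      using norm_triangle_ineq[of "Y (Suc (m + k)) - Y (m + k)" "Y (m + k) - Y m"] by simp
    then show ?case using Suc Yd[of "m + k"] by simp
  qed simp
  \<comment> \<open>Monotone and bounded by \<open>1\<close>, \<open>t\<close> is Cauchy, and it
    controls the increments of \<open>Y\<close>. No rate of convergence enters, so the boundary case
    \<open>norm x = 1\<close> is covered.\<close>
  have "incseq t" using tm by (simp add: incseq_SucI)
  then have "Cauchy t"
    using incseq_convergent[OF \<open>incseq t\<close>, of 1] tb LIMSEQ_imp_Cauchy by metis
  have "Cauchy Y"
  proof (rule CauchyI)
    fix e :: real assume "e > 0"
    then obtain M where M: "\<forall>m\<ge>M. \<forall>n\<ge>M. norm (t m - t n) < e"
      using \<open>Cauchy t\<close> CauchyD by blast
    have le: "norm (Y m - Y n) < e" if "m \<ge> n" "n \<ge> M" for m n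
    proof -
      have "norm (Y m - Y n) \<le> t m - t n" using Ymn[of n "m - n"] that by simp
      also have "\<dots> < e" using M[rule_format, of m n] that by auto
      finally show ?thesis .
    qed
    show "\<exists>M. \<forall>m\<ge>M. \<forall>n\<ge>M. norm (Y m - Y n) < e"
      by (metis le linorder_linear norm_minus_commute)
  qed
  then obtain y where y: "Y \<longlonglongrightarrow> y" using convergent_eq_Cauchy by blast
  have "(\<lambda>n. Y (Suc n)) \<longlonglongrightarrow> (1/2) *\<^sub>R (x + y * y)"
    unfolding YS by (intro tendsto_intros y)
  then have "y = (1/2) *\<^sub>R (x + y * y)"
    using LIMSEQ_Suc[OF y] LIMSEQ_unique by blast
  then have "y + y = x + y * y"
    by (metis scaleR_2 scaleR_half_double scaleR_add_right)
  moreover have "norm y \<le> 1"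
    using tendsto_norm[OF y] by (rule LIMSEQ_le_const2) (use Yn tb order_trans in blast)
  moreover have "z * y = y * z" if "z * x = x * z" for z
  proof -
    have "(\<lambda>n. z * Y n) \<longlonglongrightarrow> z * y" "(\<lambda>n. Y n * z) \<longlonglongrightarrow> y * z"
      by (intro tendsto_intros y)+
    then show ?thesis using Yz[OF that] LIMSEQ_unique by fastforce
  qed
  moreover have "adj y = y" if "adj x = x"
  proof -
    have "adj (Y n) = Y n" for n
      using that by (induction n) (auto simp: Y0 YS adj_simps)
    then have "Y \<longlonglongrightarrow> adj y" using tendsto_adj[OF y] by simp
    then show ?thesis using y LIMSEQ_unique by blast
  qed
  ultimately show thesis using that by blast
qed

text \<open>Squares of self-adjoint elements rather than elements \<open>adj b * b\<close>: for the
  former the norm criterion below, and with it closure under sums, has a direct proof. That every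
  \<open>adj b * b\<close> has this form is the substantial theorem
  \<open>pos_adj_mult\<close>.\<close>

definition pos :: "'a::cstar_normed_algebra \<Rightarrow> bool" where
  "pos a \<longleftrightarrow> (\<exists>h. adj h = h \<and> a = h * h)"

lemma pos_adj: "pos a \<Longrightarrow> adj a = a"
  by (auto simp: pos_def adj_mult)

lemma pos_square: "adj h = h \<Longrightarrow> pos (h * h)"
  by (auto simp: pos_def)

lemma pos_0 [simp]: "pos 0"
  by (auto simp: pos_def intro!: exI[of _ 0])

section \<open>Positive elements in the unital case, by a norm criterion in place of the
  spectrum\<close>

lemma adj_one [simp]: "adj (1::'a::cstar_normed_algebra_1) = 1"
  using adj_mult[of "1::'a" "adj 1"] by simp

text \<open>The equation for \<open>y\<close> in \<open>quadratic_root\<close> says that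
  \<open>1 - y\<close> squares to \<open>1 - x\<close>. The clause
  \<open>norm (1 - s) \<le> 1\<close> is the bound on \<open>y\<close>; it is what later makes the
  root itself positive.\<close>

lemma sqrt_one_minus:
  fixes x :: "'a::cstar_normed_algebra_1"
  assumes "norm x \<le> 1" "adj x = x"
  obtains s where "adj s = s" "s * s = 1 - x" "\<And>z. z * x = x * z \<Longrightarrow> z * s = s * z" "norm (1 - s) \<le> 1"
proof -
  obtain y where y: "y + y = x + y * y" "norm y \<le> 1" "\<And>z. z * x = x * z \<Longrightarrow> z * y = y * z" "adj y = y"
    using quadratic_root[OF assms(1)] assms(2) by blast
  show thesis
  proof (rule that[of "1 - y"])
    show "(1 - y) * (1 - y) = 1 - x" using y(1) by (simp add: algebra_simps)
    show "z * (1 - y) = (1 - y) * z" if "z * x = x * z" for z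
      using y(3)[OF that] by (simp add: left_diff_distrib right_diff_distrib)
  qed (use y(2,4) in \<open>simp_all add: adj_simps\<close>)
qed

text \<open>With \<open>s = sqrt (1 - h\<^sup>2)\<close> the element \<open>h + i s\<close> is unitary, and \<open>s\<close> is its imaginary part.\<close>

lemma norm_one_minus_square:
  fixes h :: "'a::cstar_normed_algebra_1"
  assumes "adj h = h" "norm h \<le> 1"
  shows "norm (1 - h * h) \<le> 1"
proof -
  have "norm (h * h) \<le> 1" using assms by (simp add: norm_self_mult power_le_one)
  moreover have "adj (h * h) = h * h" by (simp add: adj_mult assms(1))
  ultimately obtain s where s: "adj s = s" "s * s = 1 - h * h"
      and comm: "\<And>z. z * (h * h) = (h * h) * z \<Longrightarrow> z * s = s * z"
    using sqrt_one_minus[of "h * h"] by blast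
  have hs: "h * s = s * h" by (rule comm) (simp add: mult.assoc)
  have "norm s \<le> norm (s + \<i> *\<^sub>C h)"
    using norm_le_norm_add_ii s(1) assms(1) by blast
  moreover have "(norm (s + \<i> *\<^sub>C h))\<^sup>2 = 1"
    using square_plus_square[of s h] s assms(1) hs by (simp flip: norm_adj_mult)
  ultimately have "norm s \<le> 1" by (smt (verit) power2_eq_1_iff)
  then show ?thesis using norm_self_mult[OF s(1)] by (simp add: s(2) power_le_one)
qed

text \<open>One half of the norm criterion; the other is \<open>norm_le_imp_pos\<close>. A
  self-adjoint element is positive once it lies within distance \<open>t\<close> of
  \<open>t 1\<close> for some \<open>t\<close>, and a positive one does so for every
  \<open>t\<close> that bounds its norm. In contrast to the existence of a root, this condition is
  visibly stable under sums and limits.\<close>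

lemma pos_imp_norm_le:
  fixes a :: "'a::cstar_normed_algebra_1"
  assumes "pos a" "norm a \<le> t"
  shows "norm (t *\<^sub>R 1 - a) \<le> t"
proof (cases "t = 0")
  case False
  then have t: "t > 0" using assms(2) norm_ge_zero[of a] by linarith
  obtain h where h: "adj h = h" "a = h * h" using assms(1) by (auto simp: pos_def)
  define k where "k = (1 / sqrt t) *\<^sub>R h"
  have k: "adj k = k" "t *\<^sub>R (k * k) = a" using h t by (simp_all add: k_def adj_simps)
  have "norm a = t * (norm k)\<^sup>2" unfolding k(2)[symmetric] using t norm_self_mult[OF k(1)] by simp
  then have "t * (norm k)\<^sup>2 \<le> t" using assms(2) by simp
  then have "norm k \<le> 1" using t by (simp add: power2_le_iff_abs_le abs_square_le_1)
  then have "t * norm (1 - k * k) \<le> t" using norm_one_minus_square[OF k(1)] t by simp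
  moreover have "norm (t *\<^sub>R 1 - a) = t * norm (1 - k * k)"
    using t by (simp add: k(2)[symmetric] scaleR_diff_right[symmetric])
  ultimately show ?thesis by simp
qed (use assms in simp)

text \<open>Writing \<open>a = t (1 - x)\<close> puts \<open>x\<close> into the unit ball, where
  \<open>sqrt_one_minus\<close> applies. The last clause is the norm criterion for \<open>h\<close>,
  from which \<open>pos_sqrt\<close> obtains a positive root.\<close>

lemma norm_le_imp_sqrt:
  fixes a :: "'a::cstar_normed_algebra_1"
  assumes "adj a = a" "norm (t *\<^sub>R 1 - a) \<le> t"
  obtains h where "adj h = h" "a = h * h" "\<And>z. z * a = a * z \<Longrightarrow> z * h = h * z"
    "norm (sqrt t *\<^sub>R 1 - h) \<le> sqrt t"
proof (cases "t = 0")
  case True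
  then show thesis using assms that[of 0] by simp
next
  case False
  then have t: "t > 0" using assms(2) norm_ge_zero[of "t *\<^sub>R 1 - a"] by linarith
  let ?x = "1 - (1/t) *\<^sub>R a"
  have "t *\<^sub>R ?x = t *\<^sub>R 1 - a" using t by (simp add: scaleR_diff_right)
  then have "norm (t *\<^sub>R 1 - a) = t * norm ?x" using t by (metis norm_scaleR abs_of_pos)
  then have "t * norm ?x \<le> t" using assms(2) by simp
  then have "norm ?x \<le> 1" using t by simp
  moreover have "adj ?x = ?x" using assms(1) by (simp add: adj_simps)
  ultimately obtain s where s: "adj s = s" "s * s = 1 - ?x"
      "\<And>z. z * ?x = ?x * z \<Longrightarrow> z * s = s * z" "norm (1 - s) \<le> 1"
    using sqrt_one_minus[of ?x] by blast
  show thesis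
  proof (rule that[of "sqrt t *\<^sub>R s"])
    show "a = (sqrt t *\<^sub>R s) * (sqrt t *\<^sub>R s)" using s(2) t by simp
    show "z * sqrt t *\<^sub>R s = sqrt t *\<^sub>R s * z" if "z * a = a * z" for z
      using s(3)[of z] that by (simp add: algebra_simps)
    have "norm (sqrt t *\<^sub>R 1 - sqrt t *\<^sub>R s) = sqrt t * norm (1 - s)"
      using t by (simp flip: scaleR_diff_right)
    then show "norm (sqrt t *\<^sub>R 1 - sqrt t *\<^sub>R s) \<le> sqrt t"
      using s(4) t by (simp add: mult_left_le)
  qed (use s(1) in \<open>simp add: adj_simps\<close>)
qed

lemma norm_le_imp_pos:
  fixes a :: "'a::cstar_normed_algebra_1"
  assumes "adj a = a" "norm (t *\<^sub>R 1 - a) \<le> t"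
  shows "pos a"
proof -
  obtain h where "adj h = h" "a = h * h" by (rule norm_le_imp_sqrt[OF assms])
  then show ?thesis by (auto simp: pos_def)
qed

lemma pos_sqrt:
  fixes a :: "'a::cstar_normed_algebra_1"
  assumes "pos a"
  obtains h where "adj h = h" "a = h * h" "\<And>z. z * a = a * z \<Longrightarrow> z * h = h * z" "pos h"
proof (rule norm_le_imp_sqrt[OF pos_adj[OF assms] pos_imp_norm_le[OF assms order_refl]])
  fix h :: 'a assume h: "adj h = h" "a = h * h" "\<And>z. z * a = a * z \<Longrightarrow> z * h = h * z"
    and "norm (sqrt (norm a) *\<^sub>R 1 - h) \<le> sqrt (norm a)"
  then have "pos h" by (intro norm_le_imp_pos)
  with h show thesis by (rule that)
qed

lemma pos_add:
  fixes a b :: "'a::cstar_normed_algebra_1"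
  assumes "pos a" "pos b"
  shows "pos (a + b)"
proof (rule norm_le_imp_pos)
  show "adj (a + b) = a + b" using assms by (simp add: pos_adj adj_simps)
  have "(norm a + norm b) *\<^sub>R 1 - (a + b) = (norm a *\<^sub>R 1 - a) + (norm b *\<^sub>R 1 - b)"
    by (simp add: algebra_simps)
  then show "norm ((norm a + norm b) *\<^sub>R 1 - (a + b)) \<le> norm a + norm b"
    by (simp only:) (rule order_trans[OF norm_triangle_ineq
        add_mono[OF pos_imp_norm_le[OF assms(1) order_refl] pos_imp_norm_le[OF assms(2) order_refl]]])
qed

lemma pos_scaleR: "pos a \<Longrightarrow> r \<ge> 0 \<Longrightarrow> pos (r *\<^sub>R a)"
proof -
  assume r: "r \<ge> 0" and "pos a"
  then obtain h where "adj h = h" "a = h * h" by (auto simp: pos_def)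
  then have "adj (sqrt r *\<^sub>R h) = sqrt r *\<^sub>R h" "r *\<^sub>R a = (sqrt r *\<^sub>R h) * (sqrt r *\<^sub>R h)"
    using r by (simp_all add: adj_simps)
  then show ?thesis unfolding pos_def by blast
qed

lemma pos_1 [simp]: "pos (1::'a::cstar_normed_algebra_1)"
  using pos_square[of "1::'a"] by simp

text \<open>With one bound \<open>t\<close> for the norms of all \<open>X n\<close>, the criterion
  holds for every \<open>n\<close> with the same \<open>t\<close> and passes to the limit.\<close>

lemma pos_lim:
  fixes a :: "'a::cstar_normed_algebra_1"
  assumes "X \<longlonglongrightarrow> a" "\<And>n. pos (X n)"
  shows "pos a"
proof -
  have "Bseq X" by (rule convergent_imp_Bseq[OF convergentI[OF assms(1)]])
  then obtain t where t: "\<And>n. norm (X n) \<le> t" by (auto simp: Bseq_def)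
  have "(\<lambda>n. adj (X n)) \<longlonglongrightarrow> adj a" by (intro tendsto_adj assms)
  then have "X \<longlonglongrightarrow> adj a" using assms(2) by (simp add: pos_adj)
  then have "adj a = a" using assms(1) LIMSEQ_unique by blast
  moreover have "(\<lambda>n. norm (t *\<^sub>R 1 - X n)) \<longlonglongrightarrow> norm (t *\<^sub>R 1 - a)"
    by (intro tendsto_intros assms)
  then have "norm (t *\<^sub>R 1 - a) \<le> t"
    by (rule LIMSEQ_le_const2) (use pos_imp_norm_le assms(2) t in blast)
  ultimately show ?thesis by (rule norm_le_imp_pos)
qed

text \<open>Each root commutes with everything that commutes with its square. Hence the two roots
  commute, and \<open>a * b\<close> is the square of their self-adjoint product.\<close>

lemma pos_mult:
  fixes a b :: "'a::cstar_normed_algebra_1"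
  assumes "pos a" "pos b" "a * b = b * a"
  shows "pos (a * b)"
proof -
  obtain h where h: "adj h = h" "a = h * h" "\<And>z. z * a = a * z \<Longrightarrow> z * h = h * z"
    using pos_sqrt[OF assms(1)] by blast
  obtain k where k: "adj k = k" "b = k * k" "\<And>z. z * b = b * z \<Longrightarrow> z * k = k * z"
    using pos_sqrt[OF assms(2)] by blast
  have hk: "h * k = k * h" using h(3)[of b] k(3)[of h] assms(3) by simp
  have "a * b = h * (h * k) * k" by (simp add: h(2) k(2) mult.assoc)
  also have "\<dots> = h * (k * h) * k" by (simp only: hk)
  also have "\<dots> = (h * k) * (h * k)" by (simp only: mult.assoc)
  finally have "a * b = (h * k) * (h * k)" .
  then show ?thesis using pos_square[of "h * k"] by (simp add: adj_mult h(1) k(1) flip: hk)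
qed

lemma pos_power:
  fixes a :: "'a::cstar_normed_algebra_1"
  shows "pos a \<Longrightarrow> pos (a ^ n)"
proof (induction n)
  case (Suc n)
  then show ?case using pos_mult[of a "a ^ n"] by (simp add: power_commutes)
qed simp

text \<open>For commuting roots \<open>h\<close>, \<open>k\<close> the norms of \<open>p\<close> and
  \<open>p + q\<close> are the squares of the norms of \<open>h\<close> and of
  \<open>h + i k\<close>. Applied to \<open>q = t 1 - p\<close>, which commutes with
  \<open>p\<close>, this yields \<open>norm_le_of_pos\<close> and then monotonicity of the norm
  without commutation in \<open>norm_pos_add\<close>.\<close>

lemma norm_pos_add_commute:
  fixes p q :: "'a::cstar_normed_algebra_1"
  assumes "pos p" "pos q" "p * q = q * p"
  shows "norm p \<le> norm (p + q)"
proof -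
  obtain h where h: "adj h = h" "p = h * h" "\<And>z. z * p = p * z \<Longrightarrow> z * h = h * z"
    using pos_sqrt[OF assms(1)] by blast
  obtain k where k: "adj k = k" "q = k * k" "\<And>z. z * q = q * z \<Longrightarrow> z * k = k * z"
    using pos_sqrt[OF assms(2)] by blast
  have "h * k = k * h" using h(3)[of q] k(3)[of h] assms(3) by simp
  from square_plus_square[OF h(1) k(1) this]
  have "norm (p + q) = (norm (h + \<i> *\<^sub>C k))\<^sup>2" by (simp add: h(2) k(2) flip: norm_adj_mult)
  moreover have "norm p = (norm h)\<^sup>2" by (simp add: h(1,2) norm_self_mult)
  ultimately show ?thesis using norm_le_norm_add_ii[OF h(1) k(1)] by (simp add: power_mono)
qed

lemma pos_norm_minus:
  fixes a :: "'a::cstar_normed_algebra_1"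
  assumes "adj a = a" "norm a \<le> t"
  shows "pos (t *\<^sub>R 1 - a)"
  by (rule norm_le_imp_pos[of _ t]) (use assms in \<open>auto simp: adj_simps\<close>)

lemma norm_le_of_pos:
  fixes p :: "'a::cstar_normed_algebra_1"
  assumes "pos p" "pos (t *\<^sub>R 1 - p)" "t \<ge> 0"
  shows "norm p \<le> t"
  using norm_pos_add_commute[OF assms(1,2)] assms(3) by (simp add: algebra_simps)

lemma norm_pos_add:
  fixes p q :: "'a::cstar_normed_algebra_1"
  assumes "pos p" "pos q"
  shows "norm p \<le> norm (p + q)"
proof (rule norm_le_of_pos[OF assms(1)])
  have "pos (norm (p + q) *\<^sub>R 1 - (p + q) + q)"
    by (intro pos_add pos_norm_minus assms) (use assms in \<open>auto simp: pos_adj adj_simps\<close>)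
  then show "pos (norm (p + q) *\<^sub>R 1 - p)" by simp
qed simp

text \<open>For \<open>p = - d\<^sup>* d\<close> and \<open>q = d d\<^sup>*\<close> with \<open>\<parallel>d\<parallel> = 1\<close>, the identity \<open>(1 + q)\<^sup>N d = d (1 - p)\<^sup>N\<close> bounds
  \<open>(1 + q)\<^sup>N q\<close> independently of \<open>N\<close>, whereas it dominates \<open>N q\<^sup>2\<close>.\<close>

lemma adj_mult_self_neg_imp_0:
  fixes c :: "'a::cstar_normed_algebra_1"
  assumes "pos (- (adj c * c))"
  shows "c = 0"
proof (rule ccontr)
  assume "c \<noteq> 0"
  define d where "d = (1 / norm c) *\<^sub>R c"
  define p where "p = - (adj d * d)"
  define q where "q = d * adj d"
  have nd: "norm d = 1" using \<open>c \<noteq> 0\<close> by (simp add: d_def)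
  have "p = (1 / norm c)\<^sup>2 *\<^sub>R (- (adj c * c))"
    by (simp add: p_def d_def adj_simps power2_eq_square)
  then have p: "pos p" using pos_scaleR[OF assms] by simp
  have np: "norm p = 1" by (simp add: p_def norm_adj_mult nd)
  have nq: "norm q = 1" by (simp add: q_def norm_mult_adj nd)
  have "pos q"
  proof -
    \<comment> \<open>Up to sign these are twice the real and imaginary parts of \<open>d\<close>.
      The sum of their squares is \<open>2 (adj d * d + d * adj d)\<close>, so \<open>q\<close> is
      half of it plus the positive element \<open>p\<close>.\<close>
    let ?x = "d + adj d" and ?y = "\<i> *\<^sub>C (d - adj d)"
    have adj: "adj ?x = ?x" "adj ?y = ?y"
      by (simp_all add: adj_simps scaleC_simps)
    have "?y * ?y = - ((d - adj d) * (d - adj d))"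
      by (simp add: mult_scaleC_left mult_scaleC_right scaleC_scaleC scaleC_minus_left)
    then have "q + q = ?x * ?x + ?y * ?y + p + p"
      by (simp add: p_def q_def algebra_simps)
    then have "q = (1/2) *\<^sub>R (?x * ?x + ?y * ?y + p + p)"
      by (metis scaleR_half_double)
    moreover have "pos (?x * ?x + ?y * ?y + p + p)"
      by (intro pos_add pos_square p adj)
    ultimately show ?thesis using pos_scaleR[of _ "1/2"] by simp
  qed
  have shift: "(1 + q) ^ N * d = d * (1 - p) ^ N" for N
  proof (induction N)
    case (Suc N)
    have "(1 + q) * d = d * (1 - p)" by (simp add: p_def q_def distrib_left distrib_right mult.assoc)
    then show ?case by (metis Suc mult.assoc power_Suc power_commutes)
  qed simp
  \<comment> \<open>The induction multiplies the difference by \<open>1 + q\<close>, which is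
    positive and commutes with it. The product falls short of the next difference by
    \<open>N q^3\<close>, again a positive element.\<close>
  have growth: "pos ((1 + q) ^ N * q - q - real N *\<^sub>R (q * q))" for N
  proof (induction N)
    case (Suc N)
    let ?D = "(1 + q) ^ N * q - q - real N *\<^sub>R (q * q)"
    have "(1 + q) ^ N * q = q * (1 + q) ^ N"
      by (rule power_commuting_commutes) (simp add: distrib_left distrib_right)
    then have "q * ((1 + q) ^ N * q) = (1 + q) ^ N * q * q" by (simp add: mult.assoc)
    then have "?D * q = q * ?D"
      by (simp add: left_diff_distrib right_diff_distrib mult.assoc)
    then have comm: "?D * (1 + q) = (1 + q) * ?D" by (simp only: distrib_left distrib_right) simp
    have qqq: "pos (q * (q * q))"
      by (intro pos_mult \<open>pos q\<close>) (simp_all add: mult.assoc)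
    have "?D * (1 + q) + real N *\<^sub>R (q * (q * q)) = (1 + q) ^ N * q * (1 + q) - (q + q * q) - real N *\<^sub>R (q * q)"
      by (simp add: left_diff_distrib distrib_left mult.assoc scaleR_add_right)
    also have "\<dots> = (1 + q) ^ Suc N * q - q - real (Suc N) *\<^sub>R (q * q)"
      by (simp add: power_Suc2 mult.assoc distrib_left distrib_right scaleR_add_left del: power_Suc)
    finally have "(1 + q) ^ Suc N * q - q - real (Suc N) *\<^sub>R (q * q)
        = ?D * (1 + q) + real N *\<^sub>R (q * (q * q))" ..
    moreover have "pos (?D * (1 + q))"
      by (rule pos_mult[OF Suc pos_add[OF pos_1 \<open>pos q\<close>] comm])
    ultimately show ?case using qqq by (simp only: pos_add pos_scaleR of_nat_0_le_iff)
  qed simp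
  have "real N \<le> 1" for N
  proof -
    have nqq: "norm (q * q) = 1" using norm_self_mult[OF pos_adj[OF \<open>pos q\<close>]] nq by simp
    have "norm (1 - p) \<le> 1" using pos_imp_norm_le[OF p, of 1] np by simp
    then have *: "norm ((1 - p) ^ N) \<le> 1"
      by (meson norm_power_ineq order_trans norm_ge_zero power_le_one)
    have "(1 + q) ^ N * q = d * (1 - p) ^ N * adj d"
      unfolding q_def mult.assoc[symmetric] using shift[unfolded q_def] by simp
    moreover have "norm (d * (1 - p) ^ N * adj d) \<le> norm (d * (1 - p) ^ N) * norm (adj d)"
      by (rule norm_mult_ineq)
    moreover have "norm (d * (1 - p) ^ N) \<le> norm d * norm ((1 - p) ^ N)"
      by (rule norm_mult_ineq)
    ultimately have 1: "norm ((1 + q) ^ N * q) \<le> 1" using * nd by simp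
    have "pos (real N *\<^sub>R (q * q))"
      by (intro pos_scaleR pos_square pos_adj \<open>pos q\<close>) simp
    \<comment> \<open>Adding \<open>q\<close> to \<open>growth\<close> compares \<open>N q^2\<close>
      with \<open>(1 + q)^N q\<close>, whose norm is at most \<open>1\<close>; since
      \<open>q^2\<close> has norm \<open>1\<close>, every \<open>N\<close> would be at most
      \<open>1\<close>.\<close>
    moreover have "pos ((1 + q) ^ N * q - q - real N *\<^sub>R (q * q) + q)"
      by (intro pos_add growth \<open>pos q\<close>)
    ultimately have "norm (real N *\<^sub>R (q * q)) \<le>
        norm (real N *\<^sub>R (q * q) + ((1 + q) ^ N * q - q - real N *\<^sub>R (q * q) + q))"
      by (rule norm_pos_add)
    then show ?thesis using 1 nqq by simp
  qed
  from this[of 2] show False by simp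
qed

text \<open>Let \<open>s = sqrt (a\<^sup>2)\<close> and \<open>y = s - a\<close> for \<open>a = b\<^sup>* b\<close>. Since \<open>y a = - s y\<close>, the element
  \<open>(b y)\<^sup>* (b y) = - s y\<^sup>2\<close> is negative, hence zero, and then \<open>a = s\<close>.\<close>

theorem pos_adj_mult:
  fixes b :: "'a::cstar_normed_algebra_1"
  shows "pos (adj b * b)"
proof -
  define a where "a = adj b * b"
  have a: "adj a = a" by (simp add: a_def adj_mult)
  obtain s where s: "adj s = s" "a * a = s * s" "pos s"
      and comm: "\<And>z. z * (a * a) = (a * a) * z \<Longrightarrow> z * s = s * z"
    using pos_sqrt[OF pos_square[OF a]] by blast
  have as: "a * s = s * a" by (rule comm) (simp add: mult.assoc)
  define y where "y = s - a"
  have y: "adj y = y" by (simp add: y_def adj_simps a s)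
  have ya: "y * a = - (s * y)" "a * y = - (s * y)" "y * s = s * y"
    by (simp_all add: y_def algebra_simps as s(2))
  have "adj (b * y) * (b * y) = y * a * y" by (simp add: adj_mult y a_def mult.assoc)
  also have "\<dots> = - (s * (y * y))" by (simp add: ya mult.assoc)
  finally have c: "- (adj (b * y) * (b * y)) = s * (y * y)" by simp
  have "s * (y * y) = (y * y) * s" by (metis ya(3) mult.assoc)
  then have "pos (s * (y * y))" by (intro pos_mult s pos_square y)
  then have "b * y = 0" using adj_mult_self_neg_imp_0[of "b * y"] c by simp
  then have "s * (y * y) = 0" using c by simp
  then have "(s * y) * (s * y) = 0" by (metis mult.assoc mult_zero_right ya(3))
  then have sy: "s * y = 0" using adj_mult_eq_0[of "s * y"] by (simp add: adj_mult y s ya)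
  \<comment> \<open>\<open>y * y = s * y - a * y\<close>, and \<open>a * y = - (s * y)\<close>; both
    terms vanish.\<close>
  then have "y * y = 0" using ya(2) by (simp add: y_def[symmetric] left_diff_distrib[of s a y, folded y_def])
  then have "y = 0" using adj_mult_eq_0[of y] y by simp
  then show ?thesis using s(3) by (simp add: y_def a_def)
qed

section \<open>Unitization\<close>

datatype 'a unitization = Unitization (elt: 'a) (scal: complex)

definition left_action :: "'a::cstar_normed_algebra unitization \<Rightarrow> 'a \<Rightarrow> 'a" where
  "left_action u y = elt u * y + scal u *\<^sub>C y"

lemma bounded_linear_scaleC: "bounded_linear (\<lambda>y::'a::cstar_normed_algebra. c *\<^sub>C y)"
  by (rule bounded_linear_intro[where K = "cmod c"])
    (simp_all add: scaleC_add_right norm_scaleC scaleR_scaleC scaleC_scaleC mult.commute)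

lemma bounded_linear_left_action [simp]: "bounded_linear (left_action u)"
  unfolding left_action_def[abs_def]
  by (intro bounded_linear_add bounded_linear_mult_right bounded_linear_scaleC)

lemma norm_left_action_le: "norm (left_action u y) \<le> onorm (left_action u) * norm y"
  by (rule onorm[OF bounded_linear_left_action])

lemma onorm_left_action_nonneg: "0 \<le> onorm (left_action u)"
  by (rule onorm_pos_le[OF bounded_linear_left_action])

text \<open>The norm is the maximum of the modulus of the scalar part and the norm of the left
  multiplication. The latter alone would vanish on \<open>(- 1, 1)\<close> if \<open>'a\<close> had a unit \<open>1\<close>.\<close>

instantiation unitization :: (cstar_normed_algebra) real_normed_algebra_1
begin

definition zero_unitization :: "'a unitization" where "0 = Unitization 0 0"
definition one_unitization :: "'a unitization" where "1 = Unitization 0 1"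
definition plus_unitization :: "'a unitization \<Rightarrow> 'a unitization \<Rightarrow> 'a unitization" where
  "u + v = Unitization (elt u + elt v) (scal u + scal v)"
definition minus_unitization :: "'a unitization \<Rightarrow> 'a unitization \<Rightarrow> 'a unitization" where
  "u - v = Unitization (elt u - elt v) (scal u - scal v)"
definition uminus_unitization :: "'a unitization \<Rightarrow> 'a unitization" where
  "- u = Unitization (- elt u) (- scal u)"
definition times_unitization :: "'a unitization \<Rightarrow> 'a unitization \<Rightarrow> 'a unitization" where
  "u * v = Unitization (elt u * elt v + scal u *\<^sub>C elt v + scal v *\<^sub>C elt u) (scal u * scal v)"
definition scaleR_unitization :: "real \<Rightarrow> 'a unitization \<Rightarrow> 'a unitization" where
  "r *\<^sub>R u = Unitization (r *\<^sub>R elt u) (complex_of_real r * scal u)"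
definition norm_unitization :: "'a unitization \<Rightarrow> real" where
  "norm u = max (cmod (scal u)) (onorm (left_action u))"
definition sgn_unitization :: "'a unitization \<Rightarrow> 'a unitization" where
  "sgn_unitization u = Unitization (inverse (norm u) *\<^sub>R elt u) (complex_of_real (inverse (norm u)) * scal u)"
definition dist_unitization :: "'a unitization \<Rightarrow> 'a unitization \<Rightarrow> real" where
  "dist_unitization u v = norm (u - v)"
definition uniformity_unitization :: "('a unitization \<times> 'a unitization) filter" where
  "uniformity = (INF e\<in>{0<..}. principal {(x, y). dist (x::'a unitization) y < e})"
definition open_unitization :: "'a unitization set \<Rightarrow> bool" where
  "open_unitization S = (\<forall>x\<in>S. \<forall>\<^sub>F (x', y) in uniformity. x' = x \<longrightarrow> y \<in> S)"

lemmas unitization_defs = zero_unitization_def one_unitization_def plus_unitization_def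
  minus_unitization_def uminus_unitization_def times_unitization_def scaleR_unitization_def

lemma left_action_mult: "left_action (u * v) = left_action u \<circ> left_action v"
  for u v :: "'a unitization"
proof (rule ext)
  show "left_action (u * v) y = (left_action u \<circ> left_action v) y" for y
    by (simp add: left_action_def times_unitization_def distrib_left distrib_right mult.assoc scaleC_simps)
qed

lemma onorm_left_action_mult: "onorm (left_action (u * v)) \<le> onorm (left_action u) * onorm (left_action v)"
  for u v :: "'a unitization"
  unfolding left_action_mult by (intro onorm_compose bounded_linear_left_action)

text \<open>Left multiplication by \<open>x\<close> is tested on \<open>adj x\<close>, where the
  C*-identity gives the value \<open>(norm x)^2\<close>. Hence the algebra embeds isometrically into
  its unitization.\<close>

lemma norm_elt_le_onorm: "norm x \<le> onorm (left_action (Unitization x 0))"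
  for x :: 'a
proof (cases "norm x = 0")
  case False
  have "norm x * norm x \<le> onorm (left_action (Unitization x 0)) * norm x"
    using norm_left_action_le[of "Unitization x 0" "adj x"]
    by (simp add: left_action_def norm_mult_adj power2_eq_square)
  then show ?thesis using False by simp
qed (simp add: onorm_left_action_nonneg)

lemma norm_unitization_le: "norm u \<le> norm (elt u) + cmod (scal u)"
  for u :: "'a unitization"
proof -
  have "norm (left_action u y) \<le> (norm (elt u) + cmod (scal u)) * norm y" for y
    unfolding left_action_def distrib_right
    by (rule order_trans[OF norm_triangle_ineq add_mono[OF norm_mult_ineq]]) (simp add: norm_scaleC)
  then have "onorm (left_action u) \<le> norm (elt u) + cmod (scal u)"
    by (intro onorm_bound) simp_all
  then show ?thesis by (simp add: norm_unitization_def)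
qed

lemma norm_triangle_unitization: "norm (u + v) \<le> norm u + norm v"
  for u v :: "'a unitization"
proof -
  have "left_action (u + v) = (\<lambda>y. left_action u y + left_action v y)"
    by (rule ext) (simp add: left_action_def plus_unitization_def distrib_right scaleC_add_left)
  then have "onorm (left_action (u + v)) \<le> onorm (left_action u) + onorm (left_action v)"
    using onorm_triangle[OF bounded_linear_left_action bounded_linear_left_action] by metis
  then show ?thesis
    using norm_triangle_ineq[of "scal u" "scal v"]
    by (simp add: norm_unitization_def plus_unitization_def max_def split: if_splits)
qed

lemma norm_scaleR_unitization: "norm (r *\<^sub>R u) = \<bar>r\<bar> * norm u"
  for u :: "'a unitization"
proof -
  have "left_action (r *\<^sub>R u) = (\<lambda>y. r *\<^sub>R left_action u y)"
    by (rule ext) (simp add: left_action_def scaleR_unitization_def scaleR_scaleC scaleC_simps)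
  then have "onorm (left_action (r *\<^sub>R u)) = \<bar>r\<bar> * onorm (left_action u)"
    by (simp add: onorm_scaleR)
  then show ?thesis
    by (simp add: norm_unitization_def scaleR_unitization_def norm_mult max_mult_distrib_left)
qed

text \<open>Complements \<open>norm_unitization_le\<close>: the norm is equivalent to the sum of the
  norms of the two parts. Definiteness and completeness of the unitization rest on this.\<close>

lemma norm_elt_le: "norm (elt u) \<le> 2 * norm u"
  for u :: "'a unitization"
proof -
  have "norm (elt u) \<le> norm (Unitization (elt u) 0)"
    using norm_elt_le_onorm[of "elt u"] by (simp add: norm_unitization_def)
  also have "Unitization (elt u) 0 = u + Unitization 0 (- scal u)"
    by (simp add: plus_unitization_def)
  also have "norm \<dots> \<le> norm u + norm (Unitization (0::'a) (- scal u))"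
    by (rule norm_triangle_unitization)
  also have "norm (Unitization (0::'a) (- scal u)) \<le> cmod (scal u)"
    using norm_unitization_le[of "Unitization (0::'a) (- scal u)"] by simp
  also have "cmod (scal u) \<le> norm u" by (simp add: norm_unitization_def)
  finally show ?thesis by simp
qed

instance
proof
  fix u v w :: "'a unitization" and r s :: real
  show "u + v + w = u + (v + w)" "u + v = v + u" "0 + u = u" "- u + u = 0" "u - v = u + - v"
    by (simp_all add: unitization_defs)
  show "u * v * w = u * (v * w)" "(u + v) * w = u * w + v * w" "u * (v + w) = u * v + u * w"
      "1 * u = u" "u * 1 = u"
    by (simp_all add: unitization_defs distrib_left distrib_right mult.assoc scaleC_simps
        scaleC_add_left mult.commute mult.left_commute)
  show "(0::'a unitization) \<noteq> 1" by (simp add: unitization_defs)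
  show "r *\<^sub>R (u + v) = r *\<^sub>R u + r *\<^sub>R v" "(r + s) *\<^sub>R u = r *\<^sub>R u + s *\<^sub>R u"
      "r *\<^sub>R s *\<^sub>R u = (r * s) *\<^sub>R u" "1 *\<^sub>R u = u"
    by (simp_all add: unitization_defs scaleR_add_right scaleR_add_left distrib_left distrib_right)
  show "r *\<^sub>R u * v = r *\<^sub>R (u * v)" "u * r *\<^sub>R v = r *\<^sub>R (u * v)"
    by (simp_all add: unitization_defs scaleR_add_right scaleR_scaleC scaleC_simps mult.commute mult.left_commute)
  show "norm (r *\<^sub>R u) = \<bar>r\<bar> * norm u" by (rule norm_scaleR_unitization)
  show "norm (u + v) \<le> norm u + norm v" by (rule norm_triangle_unitization)
  show "(norm u = 0) = (u = 0)"
  proof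
    assume "norm u = 0"
    then have "cmod (scal u) = 0" "norm (elt u) = 0"
      using norm_elt_le[of u] onorm_left_action_nonneg[of u]
      by (auto simp: norm_unitization_def max_def split: if_splits)
    then show "u = 0" by (cases u) (simp add: zero_unitization_def)
  next
    assume "u = 0"
    then show "norm u = 0" using norm_unitization_le[of u] onorm_left_action_nonneg[of u]
      by (simp add: zero_unitization_def norm_unitization_def)
  qed
  have nn: "norm w \<ge> 0" for w :: "'a unitization" by (simp add: norm_unitization_def le_max_iff_disj)
  show "norm (u * v) \<le> norm u * norm v"
  proof -
    have "cmod (scal u * scal v) \<le> norm u * norm v" unfolding norm_mult
      by (intro mult_mono nn) (simp_all add: norm_unitization_def)
    moreover have "onorm (left_action (u * v)) \<le> norm u * norm v"
      by (rule order_trans[OF onorm_left_action_mult])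
        (intro mult_mono nn onorm_left_action_nonneg; simp add: norm_unitization_def)
    moreover have "scal (u * v) = scal u * scal v" by (simp add: times_unitization_def)
    ultimately show ?thesis by (simp only: norm_unitization_def[of "u * v"] max.bounded_iff)
  qed
  show "norm (1::'a unitization) = 1"
    using norm_unitization_le[of "1::'a unitization"]
    by (simp add: norm_unitization_def one_unitization_def)
  show "sgn u = inverse (norm u) *\<^sub>R u" by (simp add: sgn_unitization_def scaleR_unitization_def)
  show "dist u v = norm (u - v)" by (rule dist_unitization_def)
  show "uniformity = (INF e\<in>{0<..}. principal {(x, y). dist (x::'a unitization) y < e})"
    by (rule uniformity_unitization_def)
  show "open S = (\<forall>x\<in>S. \<forall>\<^sub>F (x', y) in uniformity. x' = x \<longrightarrow> y \<in> S)" for S :: "'a unitization set"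
    by (rule open_unitization_def)
qed

end

instantiation unitization :: (cstar_normed_algebra) cstar_normed_algebra_1
begin

definition scaleC_unitization :: "complex \<Rightarrow> 'a unitization \<Rightarrow> 'a unitization" where
  "c *\<^sub>C u = Unitization (c *\<^sub>C elt u) (c * scal u)"
definition adj_unitization :: "'a unitization \<Rightarrow> 'a unitization" where
  "adj u = Unitization (adj (elt u)) (cnj (scal u))"

lemma left_action_scaleC: "left_action (c *\<^sub>C u) = (\<lambda>y. c *\<^sub>C left_action u y)"
  for u :: "'a unitization"
proof (rule ext)
  show "left_action (c *\<^sub>C u) y = c *\<^sub>C left_action u y" for y
    by (simp add: left_action_def scaleC_unitization_def scaleC_simps)
qed

text \<open>The operator norm inherits the C*-property from the algebra it acts on: the square of
  \<open>u y\<close> in that algebra is \<open>adj y\<close> times the action of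
  \<open>adj u * u\<close> on \<open>y\<close>, so its norm is at most that of
  \<open>adj u * u\<close> times \<open>(norm y)^2\<close>.\<close>

lemma onorm_left_action_sq:
  fixes u :: "'a unitization"
  shows "(onorm (left_action u))\<^sup>2 \<le> onorm (left_action (adj u * u))"
proof -
  let ?S = "onorm (left_action (adj u * u))"
  have "norm (left_action u y) \<le> sqrt ?S * norm y" for y
  proof -
    have "adj (left_action u y) * left_action u y = adj y * left_action (adj u * u) y"
      by (simp add: left_action_def unitization_defs adj_unitization_def adj_simps distrib_left distrib_right
          mult.assoc scaleC_simps mult.commute[of "cnj _"])
    then have "(norm (left_action u y))\<^sup>2 = norm (adj y * left_action (adj u * u) y)"
      by (simp flip: norm_adj_mult)
    also have "\<dots> \<le> norm y * norm (left_action (adj u * u) y)"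
      using norm_mult_ineq[of "adj y"] by simp
    also have "\<dots> \<le> norm y * (?S * norm y)"
      by (intro mult_left_mono norm_left_action_le) simp
    also have "\<dots> = (sqrt ?S * norm y)\<^sup>2"
      by (simp add: power_mult_distrib onorm_left_action_nonneg power2_eq_square)
    finally show ?thesis
      by (rule power2_le_imp_le) (simp add: onorm_left_action_nonneg)
  qed
  then have "onorm (left_action u) \<le> sqrt ?S"
    by (rule onorm_bound[rotated]) (simp add: onorm_left_action_nonneg)
  then have "(onorm (left_action u))\<^sup>2 \<le> (sqrt ?S)\<^sup>2"
    by (intro power_mono onorm_left_action_nonneg)
  then show ?thesis by (simp add: onorm_left_action_nonneg)
qed

lemma onorm_left_action_adj: "onorm (left_action (adj u)) = onorm (left_action u)"
  for u :: "'a unitization"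
proof -
  have "onorm (left_action v) \<le> onorm (left_action (adj v))" for v :: "'a unitization"
  proof (cases "onorm (left_action v) = 0")
    case False
    have "onorm (left_action v) * onorm (left_action v) \<le> onorm (left_action (adj v)) * onorm (left_action v)"
      using onorm_left_action_sq[of v] onorm_left_action_mult[of "adj v" v]
      by (simp add: power2_eq_square)
    then show ?thesis using False onorm_left_action_nonneg[of v] by simp
  qed (simp add: onorm_left_action_nonneg)
  from this[of u] this[of "adj u"] show ?thesis
    by (simp add: adj_unitization_def)
qed

lemma norm_scaleC_unitization: "norm (c *\<^sub>C u) = cmod c * norm u"
  for u :: "'a unitization"
proof -
  have le: "norm (d *\<^sub>C v) \<le> cmod d * norm v" for d and v :: "'a unitization"
  proof -
    have "norm (left_action (d *\<^sub>C v) y) \<le> (cmod d * onorm (left_action v)) * norm y" for y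
      using norm_left_action_le[of v y]
      by (simp add: left_action_scaleC norm_scaleC mult.assoc mult_left_mono)
    then have "onorm (left_action (d *\<^sub>C v)) \<le> cmod d * onorm (left_action v)"
      by (intro onorm_bound) (simp_all add: onorm_left_action_nonneg)
    also have "\<dots> \<le> cmod d * norm v"
      by (intro mult_left_mono) (simp_all add: norm_unitization_def)
    finally have "onorm (left_action (d *\<^sub>C v)) \<le> cmod d * norm v" .
    moreover have "cmod (scal (d *\<^sub>C v)) \<le> cmod d * norm v"
      by (simp add: scaleC_unitization_def norm_mult mult_left_mono norm_unitization_def)
    ultimately show ?thesis by (simp only: norm_unitization_def[of "d *\<^sub>C v"] max.bounded_iff)
  qed
  show ?thesis
  proof (cases "c = 0")
    case True
    then show ?thesis using le[of c u] onorm_left_action_nonneg[of "c *\<^sub>C u"]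
      by (simp add: norm_unitization_def)
  next
    case False
    have "inverse c *\<^sub>C c *\<^sub>C u = u" using False
      by (cases u) (simp add: scaleC_unitization_def scaleC_scaleC flip: mult.assoc)
    then have "norm u \<le> inverse (cmod c) * norm (c *\<^sub>C u)"
      using le[of "inverse c" "c *\<^sub>C u"] by (simp add: norm_inverse)
    then have "cmod c * norm u \<le> norm (c *\<^sub>C u)" using False by (simp add: field_simps)
    then show ?thesis using le[of c u] by simp
  qed
qed

instance
proof
  fix u v w :: "'a unitization" and r s :: real and c d :: complex
  show "c *\<^sub>C (u + v) = c *\<^sub>C u + c *\<^sub>C v" "(c + d) *\<^sub>C u = c *\<^sub>C u + d *\<^sub>C u"
      "c *\<^sub>C d *\<^sub>C u = (c * d) *\<^sub>C u"
      "c *\<^sub>C u * v = c *\<^sub>C (u * v)" "u * c *\<^sub>C v = c *\<^sub>C (u * v)"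
    by (simp_all add: unitization_defs scaleC_unitization_def distrib_left distrib_right scaleC_simps scaleC_add_left
        mult.commute mult.left_commute)
  show "r *\<^sub>R u = complex_of_real r *\<^sub>C u"
    by (simp add: scaleR_unitization_def scaleC_unitization_def scaleR_scaleC)
  show "adj (u + v) = adj u + adj v" "adj (c *\<^sub>C u) = cnj c *\<^sub>C adj u" "adj (u * v) = adj v * adj u"
      "adj (adj u) = u"
    by (simp_all add: unitization_defs adj_unitization_def scaleC_unitization_def adj_simps)
  show "norm (c *\<^sub>C u) = cmod c * norm u" by (rule norm_scaleC_unitization)
  show "norm (adj u * u) = (norm u)\<^sup>2"
  proof -
    have "onorm (left_action (adj u * u)) = (onorm (left_action u))\<^sup>2"
      using onorm_left_action_sq[of u] onorm_left_action_mult[of "adj u" u]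
      by (simp add: onorm_left_action_adj power2_eq_square)
    moreover have "cmod (scal (adj u * u)) = (cmod (scal u))\<^sup>2"
      by (simp add: unitization_defs adj_unitization_def norm_mult power2_eq_square)
    moreover have "max (a\<^sup>2) (b\<^sup>2) = (max a b)\<^sup>2" if "a \<ge> 0" "b \<ge> 0" for a b :: real
      using that by (auto simp: max_def dest: power2_le_imp_le power_mono)
    ultimately show ?thesis by (simp add: norm_unitization_def onorm_left_action_nonneg)
  qed
next
  fix X :: "nat \<Rightarrow> 'a unitization"
  assume X: "Cauchy X"
  have "Cauchy (\<lambda>n. elt (X n))" "Cauchy (\<lambda>n. scal (X n))"
  proof -
    have *: "norm (elt (X m) - elt (X n)) \<le> 2 * norm (X m - X n)"
        "norm (scal (X m) - scal (X n)) \<le> 2 * norm (X m - X n)" for m n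
    proof -
      show "norm (elt (X m) - elt (X n)) \<le> 2 * norm (X m - X n)"
        using norm_elt_le[of "X m - X n"] by (simp add: minus_unitization_def)
      have "norm (scal (X m) - scal (X n)) \<le> norm (X m - X n)"
        by (simp add: norm_unitization_def minus_unitization_def)
      then show "norm (scal (X m) - scal (X n)) \<le> 2 * norm (X m - X n)"
        using norm_ge_zero[of "X m - X n"] by linarith
    qed
    have "\<exists>M. \<forall>m\<ge>M. \<forall>n\<ge>M. 2 * norm (X m - X n) < e" if "e > 0" for e
      using CauchyD[OF X, of "e / 2"] that by (simp add: field_simps)
    then show "Cauchy (\<lambda>n. elt (X n))" "Cauchy (\<lambda>n. scal (X n))"
      by (intro CauchyI; metis * le_less_trans)+
  qed
  then obtain x a where lim: "(\<lambda>n. elt (X n)) \<longlonglongrightarrow> x" "(\<lambda>n. scal (X n)) \<longlonglongrightarrow> a"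
    by (auto simp: Cauchy_convergent_iff convergent_def)
  have "(\<lambda>n. norm (elt (X n) - x) + norm (scal (X n) - a)) \<longlonglongrightarrow> norm (x - x) + norm (a - a)"
    by (intro tendsto_intros lim)
  then have lim0: "(\<lambda>n. norm (elt (X n) - x) + norm (scal (X n) - a)) \<longlonglongrightarrow> 0" by simp
  have "(\<lambda>n. norm (X n - Unitization x a)) \<longlonglongrightarrow> 0"
  proof (rule tendsto_sandwich[OF _ _ tendsto_const lim0])
    show "\<forall>\<^sub>F n in sequentially. norm (X n - Unitization x a) \<le> norm (elt (X n) - x) + norm (scal (X n) - a)"
      using norm_unitization_le[of "X _ - Unitization x a"] by (simp add: minus_unitization_def)
  qed simp
  then have "X \<longlonglongrightarrow> Unitization x a"
    by (simp only: tendsto_norm_zero_iff LIM_zero_iff)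
  then show "convergent X" by (rule convergentI)
qed

end

lemma norm_Unitization_0 [simp]: "norm (Unitization x 0) = norm x"
proof (rule antisym)
  show "norm (Unitization x 0) \<le> norm x" using norm_unitization_le[of "Unitization x 0"] by simp
  show "norm x \<le> norm (Unitization x 0)"
    using norm_elt_le_onorm[of x] by (simp add: norm_unitization_def)
qed

section \<open>Positivity without a unit\<close>

lemma Unitization_arith:
  fixes x y :: "'a::cstar_normed_algebra"
  shows "Unitization x a + Unitization y b = Unitization (x + y) (a + b)"
    and "Unitization x a - Unitization y b = Unitization (x - y) (a - b)"
    and "- Unitization x a = Unitization (- x) (- a)"
    and "Unitization x a * Unitization y b = Unitization (x * y + a *\<^sub>C y + b *\<^sub>C x) (a * b)"
    and "adj (Unitization x a) = Unitization (adj x) (cnj a)"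
    and "r *\<^sub>R Unitization x a = Unitization (r *\<^sub>R x) (r * a)"
  by (simp_all add: unitization_defs adj_unitization_def)

lemma scal_mult [simp]: "scal (u * v) = scal u * scal (v :: 'a::cstar_normed_algebra unitization)"
  and scal_diff [simp]: "scal (u - v) = scal u - scal v"
  and scal_one [simp]: "scal (1 :: 'a unitization) = 1"
  by (simp_all add: unitization_defs)

lemma scal_power [simp]: "scal (u ^ n) = scal (u :: 'a::cstar_normed_algebra unitization) ^ n"
  by (induction n) simp_all

lemma Unitization_elt: "scal u = 0 \<Longrightarrow> Unitization (elt u) 0 = u"
  by (cases u) simp

text \<open>A square root in the unitization of an element of the ideal lies in the ideal.\<close>

lemma pos_Unitization_iff: "pos (Unitization a 0) \<longleftrightarrow> pos (a :: 'a::cstar_normed_algebra)"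
proof
  assume "pos (Unitization a 0)"
  then obtain H where H: "adj H = H" "Unitization a 0 = H * H" by (auto simp: pos_def)
  obtain h c where "H = Unitization h c" by (cases H)
  moreover from this H have "c = 0" by (simp add: Unitization_arith)
  ultimately show "pos a" using H by (auto simp: pos_def Unitization_arith)
next
  assume "pos a"
  then obtain h where "adj h = h" "a = h * h" by (auto simp: pos_def)
  then have "adj (Unitization h 0) = Unitization h 0" "Unitization a 0 = Unitization h 0 * Unitization h 0"
    by (simp_all add: Unitization_arith)
  then show "pos (Unitization a 0)" unfolding pos_def by blast
qed

lemma nonunital_pos_add: "pos a \<Longrightarrow> pos b \<Longrightarrow> pos (a + b)"
  for a b :: "'a::cstar_normed_algebra"
  using pos_add[of "Unitization a 0" "Unitization b 0"]
  by (simp add: pos_Unitization_iff Unitization_arith)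

lemma nonunital_norm_pos_add: "pos a \<Longrightarrow> pos b \<Longrightarrow> norm a \<le> norm (a + b)"
  for a b :: "'a::cstar_normed_algebra"
  using norm_pos_add[of "Unitization a 0" "Unitization b 0"]
  by (simp add: pos_Unitization_iff Unitization_arith)

lemma nonunital_pos_adj_mult: "pos (adj b * b)"
  for b :: "'a::cstar_normed_algebra"
  using pos_adj_mult[of "Unitization b 0"]
  by (simp add: pos_Unitization_iff Unitization_arith)

lemma nonunital_pos_lim:
  fixes a :: "'a::cstar_normed_algebra"
  assumes "X \<longlonglongrightarrow> a" "\<And>n. pos (X n)"
  shows "pos a"
proof -
  have "(\<lambda>n. norm (X n - a)) \<longlonglongrightarrow> 0" using assms(1) by (simp add: LIM_zero tendsto_norm_zero_iff)
  then have "(\<lambda>n. norm (Unitization (X n) 0 - Unitization a 0)) \<longlonglongrightarrow> 0"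
    by (simp add: Unitization_arith)
  then have "(\<lambda>n. Unitization (X n) 0) \<longlonglongrightarrow> Unitization a 0"
    by (simp only: tendsto_norm_zero_iff LIM_zero_iff)
  then have "pos (Unitization a 0)"
    by (rule pos_lim) (simp add: pos_Unitization_iff assms(2))
  then show ?thesis by (simp only: pos_Unitization_iff)
qed

text \<open>The scalar inequality \<open>m a (1 - a)^m \<le> 1\<close> on the unit interval, without
  functional calculus. With \<open>z = 1 - a\<close> the stronger
  \<open>1 - z^m - m a z^m \<ge> 0\<close> goes through by induction, its increment from
  \<open>m\<close> to \<open>m + 1\<close> being \<open>(m + 1) a^2 z^m\<close>.\<close>

lemma norm_mult_power_one_minus_le:
  fixes a :: "'a::cstar_normed_algebra_1"
  assumes "pos a" "norm a \<le> 1"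
  shows "real m * norm (a * (1 - a) ^ m) \<le> 1"
proof -
  define z where "z = 1 - a"
  have z: "pos z" using pos_norm_minus[OF pos_adj[OF assms(1)], of 1] assms(2) by (simp add: z_def)
  have az: "a * z ^ m = z ^ m * a" for m
    using power_commuting_commutes[of z a m] by (simp add: z_def left_diff_distrib right_diff_distrib)
  have azm: "pos (a * z ^ m)" for m
    by (intro pos_mult pos_power z assms az)
  have "pos (1 - z ^ m - real m *\<^sub>R (a * z ^ m))"
  proof (induction m)
    case (Suc m)
    have eq: "1 - z ^ Suc m - real (Suc m) *\<^sub>R (a * z ^ Suc m)
      = (1 - z ^ m - real m *\<^sub>R (a * z ^ m)) + real (Suc m) *\<^sub>R (a * (a * z ^ m))"
      by (simp add: z_def left_diff_distrib right_diff_distrib scaleR_add_left scaleR_diff_right)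
    have "pos (a * (a * z ^ m))"
    proof (rule pos_mult[OF assms(1) azm])
      show "a * (a * z ^ m) = a * z ^ m * a" unfolding mult.assoc az[symmetric] ..
    qed
    then show ?case unfolding eq by (intro pos_add Suc pos_scaleR) simp_all
  qed simp
  then have "pos (1 - z ^ m - real m *\<^sub>R (a * z ^ m) + z ^ m)"
    by (intro pos_add pos_power z)
  then have "pos (1 *\<^sub>R 1 - real m *\<^sub>R (a * z ^ m))" by simp
  moreover have "pos (real m *\<^sub>R (a * z ^ m))" by (intro pos_scaleR azm) simp
  ultimately have "norm (real m *\<^sub>R (a * z ^ m)) \<le> 1" by (intro norm_le_of_pos) simp_all
  then show ?thesis by (simp add: z_def)
qed

text \<open>Take \<open>a\<close> to be \<open>x * adj x\<close> scaled to norm one and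
  \<open>e = 1 - (1 - a)^n\<close>, formed in the unitization. Then
  \<open>x - e x = (1 - a)^n x\<close>, and the squared norm of the latter is governed by
  \<open>a (1 - a)^n\<close>, which the preceding lemma bounds by \<open>1 / n\<close>. An element
  adapted to the one given \<open>x\<close> is enough for the Schwarz inequality.\<close>

lemma approximate_unit:
  fixes x :: "'a::cstar_normed_algebra"
  assumes "\<epsilon> > 0"
  obtains e where "adj e = e" "norm e \<le> 1" "norm (x - e * x) < \<epsilon>"
proof (cases "x = 0")
  case True
  then show thesis using that[of 0] assms by simp
next
  case False
  define X where "X = Unitization x 0"
  define t where "t = (norm x)\<^sup>2"
  have t: "t > 0" using False by (simp add: t_def)
  define a where "a = (1 / t) *\<^sub>R (X * adj X)"
  have a: "pos a" using pos_scaleR[OF pos_adj_mult[of "adj X"], of "1/t"] t by (simp add: a_def)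
  have ta: "t *\<^sub>R a = X * adj X" using t by (simp add: a_def)
  have na: "norm a = 1" using t by (simp add: a_def norm_mult_adj X_def t_def)
  have z: "pos (1 - a)" using pos_norm_minus[OF pos_adj[OF a], of 1] na by simp
  have nz: "norm (1 - a) \<le> 1" using pos_imp_norm_le[OF a, of 1] na by simp
  obtain n where n: "t / \<epsilon>\<^sup>2 < real n" using reals_Archimedean2 by blast
  then have n0: "real n > 0" using t assms by (smt (verit) divide_pos_pos zero_less_power)
  define Z where "Z = (1 - a) ^ n"
  have Z: "pos Z" unfolding Z_def by (intro pos_power z)
  have nZ: "norm Z \<le> 1" unfolding Z_def
    by (meson norm_power_ineq order_trans norm_ge_zero power_le_one nz)
  define e where "e = elt (1 - Z)"
  \<comment> \<open>The scalar part of \<open>1 - a\<close>, and so of its powers, is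
    \<open>1\<close>; hence \<open>1 - Z\<close> comes from the original algebra.\<close>
  have "scal (1 - Z) = 0"
    by (simp add: Z_def a_def X_def Unitization_arith)
  then have e: "Unitization e 0 = 1 - Z" unfolding e_def by (rule Unitization_elt)
  have "norm (1 - Z) \<le> 1" using pos_imp_norm_le[OF Z, of 1] nZ by simp
  then have e1: "norm e \<le> 1" by (simp flip: e)
  have "adj (Unitization e 0) = Unitization e 0"
    unfolding e by (simp add: adj_diff pos_adj[OF Z])
  then have e2: "adj e = e" by (simp add: Unitization_arith)
  have "a * (1 - a) ^ n = (1 - a) ^ n * a"
    using power_commuting_commutes[of "1 - a" a n] by (simp add: left_diff_distrib right_diff_distrib)
  then have comm: "Z * a = a * Z" by (simp add: Z_def)
  have "Unitization (x - e * x) 0 = X - Unitization e 0 * X"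
    by (simp add: X_def Unitization_arith)
  also have "\<dots> = Z * X" by (simp add: e left_diff_distrib)
  finally have "(norm (x - e * x))\<^sup>2 = (norm (Z * X))\<^sup>2" by (metis norm_Unitization_0)
  also have "\<dots> = norm (Z * X * adj (Z * X))" by (simp add: norm_mult_adj)
  also have "Z * X * adj (Z * X) = Z * (X * adj X) * Z" by (simp add: adj_mult pos_adj[OF Z] mult.assoc)
  also have "\<dots> = t *\<^sub>R (a * Z * Z)" by (simp add: comm flip: ta)
  also have "norm \<dots> \<le> t * (norm (a * Z) * norm Z)" using t norm_mult_ineq[of "a * Z" Z] by simp
  also have "\<dots> \<le> t * (norm (a * Z) * 1)" using t nZ by (intro mult_left_mono) simp_all
  also have "\<dots> < \<epsilon>\<^sup>2"
  proof -
    have "norm (a * Z) \<le> 1 / real n"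
      using norm_mult_power_one_minus_le[OF a, of n] na n0 by (simp add: Z_def field_simps)
    then have "t * norm (a * Z) \<le> t * (1 / real n)" using t by (intro mult_left_mono) simp_all
    also have "\<dots> < \<epsilon>\<^sup>2" using n n0 assms by (simp add: field_simps)
    finally show ?thesis by simp
  qed
  finally have "norm (x - e * x) < \<epsilon>" using assms by (simp add: power_less_imp_less_base)
  then show thesis using that e1 e2 by blast
qed

text \<open>The right-hand condition does not mention the norm; hence *-homomorphisms are contractive.\<close>

lemma norm_le_1_iff:
  fixes x :: "'a::cstar_normed_algebra"
  shows "norm x \<le> 1 \<longleftrightarrow> (\<exists>y. adj y = y \<and> y + y = adj x * x + y * y)"
proof
  assume "norm x \<le> 1"
  then have "norm (adj x * x) \<le> 1" by (simp add: norm_adj_mult power_le_one)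
  moreover have "adj (adj x * x) = adj x * x" by (simp add: adj_mult)
  ultimately show "\<exists>y. adj y = y \<and> y + y = adj x * x + y * y"
    using quadratic_root[of "adj x * x"] by metis
next
  assume "\<exists>y. adj y = y \<and> y + y = adj x * x + y * y"
  then obtain y where y: "adj y = y" "y + y = adj x * x + y * y" by blast
  define X Y where "X = Unitization x 0" and "Y = Unitization y 0"
  have Y: "adj Y = Y" "Y + Y = adj X * X + Y * Y"
    using y by (simp_all add: X_def Y_def Unitization_arith)
  \<comment> \<open>Completing the square: the equation says that \<open>1 - adj X * X\<close> is
    the square of the self-adjoint element \<open>1 - Y\<close>.\<close>
  have "(1 - Y) * (1 - Y) = 1 - (Y + Y - Y * Y)" by (simp add: algebra_simps)
  also have "\<dots> = 1 *\<^sub>R 1 - adj X * X" unfolding Y(2) by simp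
  finally have "pos (1 *\<^sub>R 1 - adj X * X)" using pos_square[of "1 - Y"] Y(1) by (simp add: adj_diff)
  then have "norm (adj X * X) \<le> 1" by (intro norm_le_of_pos pos_adj_mult) simp_all
  then have "(norm x)\<^sup>2 \<le> 1" by (simp add: norm_adj_mult X_def)
  then show "norm x \<le> 1" by (simp add: abs_square_le_1)
qed

text \<open>In the unitization \<open>1 - p\<close> has a self-adjoint root \<open>s\<close>, and
  the element in question is the square \<open>adj (s u) * (s u)\<close>, which lies in the original
  algebra again.\<close>

lemma contraction_compress:
  fixes p u :: "'a::cstar_normed_algebra"
  assumes "adj p = p" "norm p \<le> 1"
  shows "pos (adj u * u - adj u * p * u)"
proof -
  have "norm (Unitization p 0) \<le> 1" "adj (Unitization p 0) = Unitization p 0"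
    using assms by (simp_all add: Unitization_arith)
  then obtain s where s: "adj s = s" "s * s = 1 - Unitization p 0"
    using sqrt_one_minus by blast
  let ?w = "s * Unitization u 0"
  have "adj ?w * ?w = adj (Unitization u 0) * (s * s) * Unitization u 0"
    by (simp add: adj_mult s(1) mult.assoc)
  also have "\<dots> = Unitization (adj u * u - adj u * p * u) 0"
    unfolding s(2) by (simp add: right_diff_distrib left_diff_distrib Unitization_arith)
  finally show ?thesis using pos_adj_mult[of ?w] by (simp add: pos_Unitization_iff)
qed

text \<open>Here \<open>p, u, q\<close> are the entries of \<open>D\<^sup>* D\<close> for the \<open>2 \<times> 2\<close> matrix \<open>D\<close>; the first two
  summands of \<open>q - u\<^sup>* u\<close> are the squares of the entries of \<open>d\<^sub>2 - d\<^sub>1 u\<close> for the columns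
  \<open>d\<^sub>1, d\<^sub>2\<close> of \<open>D\<close>.\<close>

lemma schwarz_2x2:
  fixes d11 d12 d21 d22 :: "'a::cstar_normed_algebra"
  defines "p \<equiv> adj d11 * d11 + adj d21 * d21"
    and "u \<equiv> adj d11 * d12 + adj d21 * d22"
    and "q \<equiv> adj d12 * d12 + adj d22 * d22"
  assumes "norm p \<le> 1"
  shows "pos (q - adj u * u)"
proof -
  let ?w1 = "d12 - d11 * u" and ?w2 = "d22 - d21 * u"
  have p: "adj p = p" by (simp add: p_def adj_simps)
  have au: "adj u = adj d12 * d11 + adj d22 * d21" by (simp add: u_def adj_simps)
  have "adj ?w1 * ?w1 + adj ?w2 * ?w2 = q - (adj d12 * d11 + adj d22 * d21) * u
      - adj u * (adj d11 * d12 + adj d21 * d22) + adj u * (adj d11 * d11 + adj d21 * d21) * u"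
    by (simp add: q_def adj_simps left_diff_distrib right_diff_distrib distrib_left distrib_right mult.assoc)
  also have "\<dots> = q - adj u * u - adj u * u + adj u * p * u"
    by (simp only: au[symmetric] u_def[symmetric] p_def[symmetric])
  finally have "q - adj u * u = adj ?w1 * ?w1 + adj ?w2 * ?w2 + (adj u * u - adj u * p * u)"
    by simp
  then show ?thesis
    using nonunital_pos_add[OF nonunital_pos_add[OF nonunital_pos_adj_mult[of ?w1] nonunital_pos_adj_mult[of ?w2]]
        contraction_compress[OF p assms(4), of u]] by simp
qed

section \<open>C*-algebras on a carrier inside a single type\<close>

lemma complex_ring_simps [simp]: "carrier complex_ring = UNIV" "mult complex_ring = (*)"
  "one complex_ring = 1" "zero complex_ring = 0" "add complex_ring = (+)"
  by (simp_all add: complex_ring_def)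

lemma cring_complex_ring: "cring complex_ring"
proof (rule cringI)
  show "abelian_group complex_ring"
  proof (rule abelian_groupI)
    show "\<exists>y\<in>carrier complex_ring. y \<oplus>\<^bsub>complex_ring\<^esub> x = \<zero>\<^bsub>complex_ring\<^esub>" for x
      by (auto intro!: exI[of _ "- x"])
  qed simp_all
  show "comm_monoid complex_ring" by (rule comm_monoidI) (simp_all add: mult.assoc)
qed (simp_all add: distrib_right)

section \<open>Arithmetic and metric of one C*-algebra on its carrier\<close>

context cstar_algebra
begin

lemmas smult_closed' = smult_closed[unfolded complex_ring_simps, OF UNIV_I]
lemmas smult_l_distr' = smult_l_distr[unfolded complex_ring_simps, OF UNIV_I UNIV_I]
lemmas smult_r_distr' = smult_r_distr[unfolded complex_ring_simps, OF UNIV_I]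
lemmas smult_assoc' = smult_assoc1[unfolded complex_ring_simps, OF UNIV_I UNIV_I]
lemmas smult_one' = smult_one[unfolded complex_ring_simps]

lemma smult_minus_one: "x \<in> carrier A \<Longrightarrow> (- 1) \<odot> x = \<ominus> x"
proof -
  assume x: "x \<in> carrier A"
  have "(0::complex) \<odot> x \<oplus> 0 \<odot> x = 0 \<odot> x" using smult_l_distr'[OF x, of 0 0] by simp
  then have 0: "(0::complex) \<odot> x = \<zero>" using smult_closed'[OF x] M.add.l_cancel_one' by metis
  have "(- 1) \<odot> x \<oplus> x = \<zero>"
    using smult_l_distr'[OF x, of "-1" 1] 0 smult_one'[OF x] by simp
  then show ?thesis using M.minus_equality smult_closed'[OF x] x by metis
qed

lemma nrm_minus: "x \<in> carrier A \<Longrightarrow> nrm A (\<ominus> x) = nrm A x"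
  using nrm_smult[of x "-1"] by (simp add: smult_minus_one)

lemma nrm_zero: "nrm A \<zero> = 0"
  using nrm_eq_0_iff[OF M.zero_closed] by simp

lemma minus_telescope:
  "\<lbrakk>x \<in> carrier A; y \<in> carrier A; z \<in> carrier A\<rbrakk> \<Longrightarrow> x \<ominus> z = (x \<ominus> y) \<oplus> (y \<ominus> z)"
  by (simp add: M.minus_eq M.a_assoc M.r_neg1)

lemma minus_eq_zero_iff: "\<lbrakk>x \<in> carrier A; y \<in> carrier A\<rbrakk> \<Longrightarrow> x \<ominus> y = \<zero> \<longleftrightarrow> x = y"
proof
  assume xy: "x \<in> carrier A" "y \<in> carrier A" and "x \<ominus> y = \<zero>"
  then have "x \<ominus> y \<oplus> y = y" by simp
  then show "x = y" using xy by (simp add: M.minus_eq M.a_assoc M.l_neg)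
qed (simp add: M.minus_eq M.r_neg)

lemma Metric_space: "Metric_space (carrier A) (cdist A)"
proof
  show "0 \<le> cdist A x y" for x y by (simp add: cdist_def nrm_nonneg)
  show "cdist A x y = cdist A y x" for x y
  proof (cases "x \<in> carrier A \<and> y \<in> carrier A")
    case True
    then have "\<ominus> (x \<ominus> y) = y \<ominus> x"
      by (simp add: M.minus_eq M.minus_add M.add.m_comm)
    then show ?thesis using nrm_minus[of "x \<ominus> y"] True by (simp add: cdist_def)
  qed (auto simp: cdist_def)
  show "(cdist A x y = 0) = (x = y)" if "x \<in> carrier A" "y \<in> carrier A" for x y
    using that by (auto simp: cdist_def nrm_eq_0_iff minus_eq_zero_iff)
  show "cdist A x z \<le> cdist A x y + cdist A y z"
    if "x \<in> carrier A" "y \<in> carrier A" "z \<in> carrier A" for x y z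
  proof -
    have "x \<ominus> z = (x \<ominus> y) \<oplus> (y \<ominus> z)"
      using that by (rule minus_telescope)
    then show ?thesis using nrm_triangle[of "x \<ominus> y" "y \<ominus> z"] that by (simp add: cdist_def)
  qed
qed

lemmas zero_closed = M.zero_closed
lemmas add_closed = M.a_closed
lemmas a_inv_closed = M.a_inv_closed
lemmas minus_closed = M.minus_closed
lemmas add_assoc = M.a_assoc
lemmas add_commute = M.a_comm
lemmas add_zero_left = M.l_zero
lemmas a_inv_left = M.l_neg
lemmas minus_eq = M.minus_eq

lemma nrm_minus_le: "\<lbrakk>x \<in> carrier A; y \<in> carrier A\<rbrakk> \<Longrightarrow> nrm A (x \<ominus> y) \<le> nrm A x + nrm A y"
  using nrm_triangle[of x "\<ominus> y"] nrm_minus[of y] by (simp add: M.minus_eq)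

lemma nrm_star: "x \<in> carrier A \<Longrightarrow> nrm A (star A x) = nrm A x"
proof -
  have *: "nrm A y \<le> nrm A (star A y)" if y: "y \<in> carrier A" for y
  proof (cases "nrm A y = 0")
    case True then show ?thesis using nrm_nonneg[OF star_closed[OF y]] by simp
  next
    case False
    have "nrm A y * nrm A y \<le> nrm A (star A y) * nrm A y"
      using nrm_mult[OF star_closed[OF y] y] by (simp add: cstar_identity[OF y] power2_eq_square)
    then show ?thesis using False nrm_nonneg[OF y] by simp
  qed
  assume "x \<in> carrier A"
  then show ?thesis using *[of x] *[of "star A x"] by (simp add: star_closed star_star)
qed

lemma Cauchy_imp_limit:
  fixes \<sigma> :: "nat \<Rightarrow> 'a"
  assumes "\<And>n. \<sigma> n \<in> carrier A"
    and "\<And>\<epsilon>. \<epsilon> > 0 \<Longrightarrow> \<exists>N. \<forall>m\<ge>N. \<forall>n\<ge>N. nrm A (\<sigma> m \<ominus> \<sigma> n) < \<epsilon>"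
  shows "\<exists>x\<in>carrier A. \<forall>\<epsilon>>0. \<exists>N. \<forall>n\<ge>N. nrm A (\<sigma> n \<ominus> x) < \<epsilon>"
proof -
  interpret Metric_space "carrier A" "cdist A" by (rule Metric_space)
  have "MCauchy \<sigma>"
    unfolding MCauchy_def using assms by (auto simp: cdist_def)
  then obtain x where "limitin mtopology \<sigma> x sequentially"
    using complete unfolding mcomplete_def by blast
  then have "x \<in> carrier A" "\<forall>\<epsilon>>0. \<exists>N. \<forall>n\<ge>N. nrm A (\<sigma> n \<ominus> x) < \<epsilon>"
    using assms(1) by (auto simp: limit_metric_sequentially cdist_def)
  then show ?thesis by blast
qed

end

text \<open>Bounded families with one entry from each C*-algebra whose carrier lies in the type
  \<open>'a\<close>: a single type that contains all these algebras isometrically, so that the results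
  about type classes apply to C*-algebras on a carrier.\<close>

definition bounded_section :: "('a cstar \<Rightarrow> 'a) \<Rightarrow> bool" where
  "bounded_section F \<longleftrightarrow> (\<forall>A. if cstar_algebra A then F A \<in> carrier A else F A = undefined) \<and>
     (\<exists>K. \<forall>A. cstar_algebra A \<longrightarrow> nrm A (F A) \<le> K)"

text \<open>The fixed value off the C*-algebras makes the families extensional, so that elements of
  the type below are determined by their components at C*-algebras.\<close>

definition section_of :: "('a cstar \<Rightarrow> 'a) \<Rightarrow> 'a cstar \<Rightarrow> 'a" where
  "section_of f A = (if cstar_algebra A then f A else undefined)"

lemma section_of_apply [simp]: "cstar_algebra A \<Longrightarrow> section_of f A = f A"
  by (simp add: section_of_def)

lemma bounded_section_section_of:
  assumes "\<And>A. cstar_algebra A \<Longrightarrow> f A \<in> carrier A"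
    and "\<And>A. cstar_algebra A \<Longrightarrow> nrm A (f A) \<le> K"
  shows "bounded_section (section_of f)"
  using assms unfolding bounded_section_def section_of_def by auto

lemma zero_in_carrier: "cstar_algebra A \<Longrightarrow> \<zero>\<^bsub>A\<^esub> \<in> carrier A"
  using cstar_algebra.axioms(1) module.axioms(2) abelian_group.axioms(1) abelian_monoid.zero_closed
  by blast

typedef 'a cstar_product = "{F :: 'a cstar \<Rightarrow> 'a. bounded_section F}"
  morphisms component Abs_cstar_product
proof
  show "section_of (\<lambda>A. \<zero>\<^bsub>A\<^esub>) \<in> {F. bounded_section F}"
    by (simp, rule bounded_section_section_of[where K = 0])
      (simp_all add: zero_in_carrier cstar_algebra.nrm_zero)
qed

definition mk_product :: "('a cstar \<Rightarrow> 'a) \<Rightarrow> 'a cstar_product" where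
  "mk_product f = Abs_cstar_product (section_of f)"

lemma component_mk_product:
  assumes "\<And>A. cstar_algebra A \<Longrightarrow> f A \<in> carrier A"
    and "\<And>A. cstar_algebra A \<Longrightarrow> nrm A (f A) \<le> K"
    and "cstar_algebra A"
  shows "component (mk_product f) A = f A"
  using bounded_section_section_of[of f K, OF assms(1,2)] assms(3)
  by (simp add: mk_product_def Abs_cstar_product_inverse)

lemma component_closed [simp]: "cstar_algebra A \<Longrightarrow> component F A \<in> carrier A"
  using component[of F] by (auto simp: bounded_section_def)

lemma cstar_product_eqI:
  assumes "\<And>A. cstar_algebra A \<Longrightarrow> component F A = component G A"
  shows "F = G"
proof -
  have "component F A = component G A" for A
    using assms[of A] component[of F] component[of G] by (cases "cstar_algebra A") (auto simp: bounded_section_def)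
  then show ?thesis by (simp add: component_inject[symmetric] fun_eq_iff)
qed

text \<open>The inserted \<open>0\<close> makes the set nonempty and the supremum nonnegative
  without exhibiting any C*-algebra on the type.\<close>

definition product_norm :: "'a cstar_product \<Rightarrow> real" where
  "product_norm F = Sup (insert 0 {nrm A (component F A) | A. cstar_algebra A})"

lemma bdd_above_component: "bdd_above (insert 0 {nrm A (component F A) | A. cstar_algebra A})"
proof -
  obtain K where "\<And>A. cstar_algebra A \<Longrightarrow> nrm A (component F A) \<le> K"
    using component[of F] by (auto simp: bounded_section_def)
  then show ?thesis by (intro bdd_aboveI[of _ "max 0 K"]) (auto intro: le_max_iff_disj[THEN iffD2])
qed

lemma nrm_component_le: "cstar_algebra A \<Longrightarrow> nrm A (component F A) \<le> product_norm F"
  unfolding product_norm_def by (rule cSup_upper[OF _ bdd_above_component]) auto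

lemma product_norm_nonneg: "0 \<le> product_norm F"
  unfolding product_norm_def by (rule cSup_upper[OF _ bdd_above_component]) auto

lemma product_norm_le:
  "K \<ge> 0 \<Longrightarrow> (\<And>A. cstar_algebra A \<Longrightarrow> nrm A (component F A) \<le> K) \<Longrightarrow> product_norm F \<le> K"
  unfolding product_norm_def by (rule cSup_least) auto

instantiation cstar_product :: (type) real_normed_algebra
begin

definition zero_cstar_product :: "'a cstar_product" where
  "0 = mk_product (\<lambda>A. \<zero>\<^bsub>A\<^esub>)"
definition plus_cstar_product :: "'a cstar_product \<Rightarrow> 'a cstar_product \<Rightarrow> 'a cstar_product" where
  "F + G = mk_product (\<lambda>A. component F A \<oplus>\<^bsub>A\<^esub> component G A)"
definition minus_cstar_product :: "'a cstar_product \<Rightarrow> 'a cstar_product \<Rightarrow> 'a cstar_product" where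
  "F - G = mk_product (\<lambda>A. component F A \<ominus>\<^bsub>A\<^esub> component G A)"
definition uminus_cstar_product :: "'a cstar_product \<Rightarrow> 'a cstar_product" where
  "- F = mk_product (\<lambda>A. \<ominus>\<^bsub>A\<^esub> component F A)"
definition times_cstar_product :: "'a cstar_product \<Rightarrow> 'a cstar_product \<Rightarrow> 'a cstar_product" where
  "F * G = mk_product (\<lambda>A. component F A \<otimes>\<^bsub>A\<^esub> component G A)"
definition scaleR_cstar_product :: "real \<Rightarrow> 'a cstar_product \<Rightarrow> 'a cstar_product" where
  "r *\<^sub>R F = mk_product (\<lambda>A. complex_of_real r \<odot>\<^bsub>A\<^esub> component F A)"
definition norm_cstar_product :: "'a cstar_product \<Rightarrow> real" where
  "norm F = product_norm F"
definition sgn_cstar_product :: "'a cstar_product \<Rightarrow> 'a cstar_product" where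
  "sgn_cstar_product F = mk_product (\<lambda>A. complex_of_real (inverse (norm F)) \<odot>\<^bsub>A\<^esub> component F A)"
definition dist_cstar_product :: "'a cstar_product \<Rightarrow> 'a cstar_product \<Rightarrow> real" where
  "dist_cstar_product F G = norm (F - G)"
definition uniformity_cstar_product :: "('a cstar_product \<times> 'a cstar_product) filter" where
  "uniformity = (INF e\<in>{0<..}. principal {(F, G). dist (F::'a cstar_product) G < e})"
definition open_cstar_product :: "'a cstar_product set \<Rightarrow> bool" where
  "open_cstar_product S = (\<forall>x\<in>S. \<forall>\<^sub>F (x', y) in uniformity. x' = x \<longrightarrow> y \<in> S)"

lemma component_zero [simp]: "cstar_algebra A \<Longrightarrow> component 0 A = \<zero>\<^bsub>A\<^esub>"
  for A :: "'a cstar"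
  unfolding zero_cstar_product_def
  by (rule component_mk_product[where K = 0])
    (simp_all add: zero_in_carrier cstar_algebra.nrm_zero)

lemma component_add [simp]: "cstar_algebra A \<Longrightarrow> component (F + G) A = component F A \<oplus>\<^bsub>A\<^esub> component G A"
  for A :: "'a cstar"
  unfolding plus_cstar_product_def
proof (rule component_mk_product[where K = "product_norm F + product_norm G"])
  show "nrm A (component F A \<oplus>\<^bsub>A\<^esub> component G A) \<le> product_norm F + product_norm G" if "cstar_algebra A" for A
    using cstar_algebra.nrm_triangle[OF that, of "component F A" "component G A"]
      nrm_component_le[OF that, of F] nrm_component_le[OF that, of G] that by simp
qed (simp_all add: cstar_algebra.add_closed)

lemma component_minus [simp]: "cstar_algebra A \<Longrightarrow> component (F - G) A = component F A \<ominus>\<^bsub>A\<^esub> component G A"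
  for A :: "'a cstar"
  unfolding minus_cstar_product_def
proof (rule component_mk_product[where K = "product_norm F + product_norm G"])
  show "nrm A (component F A \<ominus>\<^bsub>A\<^esub> component G A) \<le> product_norm F + product_norm G" if "cstar_algebra A" for A
    using cstar_algebra.nrm_minus_le[OF that, of "component F A" "component G A"]
      nrm_component_le[OF that, of F] nrm_component_le[OF that, of G] that by simp
qed (simp_all add: cstar_algebra.minus_closed)

lemma component_uminus [simp]: "cstar_algebra A \<Longrightarrow> component (- F) A = \<ominus>\<^bsub>A\<^esub> component F A"
  for A :: "'a cstar"
  unfolding uminus_cstar_product_def
  by (rule component_mk_product[where K = "product_norm F"])
    (simp_all add: cstar_algebra.a_inv_closed cstar_algebra.nrm_minus nrm_component_le)

lemma component_mult [simp]: "cstar_algebra A \<Longrightarrow> component (F * G) A = component F A \<otimes>\<^bsub>A\<^esub> component G A"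
  for A :: "'a cstar"
  unfolding times_cstar_product_def
proof (rule component_mk_product[where K = "product_norm F * product_norm G"])
  show "nrm A (component F A \<otimes>\<^bsub>A\<^esub> component G A) \<le> product_norm F * product_norm G" if "cstar_algebra A" for A
    by (rule order_trans[OF cstar_algebra.nrm_mult[OF that] mult_mono])
      (simp_all add: that nrm_component_le product_norm_nonneg cstar_algebra.nrm_nonneg)
qed (simp_all add: cstar_algebra.mult_closed)

lemma component_smult:
  "cstar_algebra A \<Longrightarrow> component (mk_product (\<lambda>A. c \<odot>\<^bsub>A\<^esub> component F A)) A = c \<odot>\<^bsub>A\<^esub> component F A"
  for A :: "'a cstar"
  by (rule component_mk_product[where K = "cmod c * product_norm F"])
    (simp_all add: cstar_algebra.smult_closed' cstar_algebra.nrm_smult nrm_component_le mult_left_mono)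

lemma component_scaleR [simp]:
  "cstar_algebra A \<Longrightarrow> component (r *\<^sub>R F) A = complex_of_real r \<odot>\<^bsub>A\<^esub> component F A"
  for A :: "'a cstar"
  unfolding scaleR_cstar_product_def by (rule component_smult)

lemma product_norm_smult:
  assumes "\<And>A. cstar_algebra A \<Longrightarrow> component G A = c \<odot>\<^bsub>A\<^esub> component F A"
  shows "product_norm G = cmod c * product_norm F"
proof (rule antisym)
  show "product_norm G \<le> cmod c * product_norm F"
    by (rule product_norm_le)
      (simp_all add: assms cstar_algebra.nrm_smult nrm_component_le mult_left_mono product_norm_nonneg)
  show "cmod c * product_norm F \<le> product_norm G"
  proof (cases "c = 0")
    case False
    have "product_norm F \<le> product_norm G / cmod c"
    proof (rule product_norm_le)
      show "nrm A (component F A) \<le> product_norm G / cmod c" if "cstar_algebra A" for A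
        using nrm_component_le[OF that, of G] False
        by (simp add: assms that cstar_algebra.nrm_smult field_simps)
    qed (simp add: product_norm_nonneg)
    then show ?thesis using False by (simp add: field_simps)
  qed (simp add: product_norm_nonneg)
qed

instance
proof
  fix F G H :: "'a cstar_product" and r s :: real
  show "F + G + H = F + (G + H)" "F + G = G + F" "0 + F = F" "- F + F = 0" "F - G = F + - G"
    by (rule cstar_product_eqI; simp add: cstar_algebra.add_assoc cstar_algebra.add_commute
        cstar_algebra.add_zero_left cstar_algebra.a_inv_left cstar_algebra.minus_eq)+
  show "F * G * H = F * (G * H)" "(F + G) * H = F * H + G * H" "F * (G + H) = F * G + F * H"
    by (rule cstar_product_eqI; simp add: cstar_algebra.mult_assoc cstar_algebra.distrib_left
        cstar_algebra.distrib_right)+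
  show "r *\<^sub>R (F + G) = r *\<^sub>R F + r *\<^sub>R G" "(r + s) *\<^sub>R F = r *\<^sub>R F + s *\<^sub>R F"
      "r *\<^sub>R s *\<^sub>R F = (r * s) *\<^sub>R F" "1 *\<^sub>R F = F"
      "r *\<^sub>R F * G = r *\<^sub>R (F * G)" "F * r *\<^sub>R G = r *\<^sub>R (F * G)"
    by (rule cstar_product_eqI; simp add: cstar_algebra.smult_r_distr' cstar_algebra.smult_l_distr'
        cstar_algebra.smult_assoc' cstar_algebra.smult_one' cstar_algebra.smult_mult_left
        cstar_algebra.smult_mult_right)+
  show "norm (r *\<^sub>R F) = \<bar>r\<bar> * norm F"
    unfolding norm_cstar_product_def by (subst product_norm_smult[where c = "complex_of_real r" and F = F]) simp_all
  show "norm (F + G) \<le> norm F + norm G"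
    unfolding norm_cstar_product_def
  proof (rule product_norm_le)
    show "nrm A (component (F + G) A) \<le> product_norm F + product_norm G" if "cstar_algebra A" for A
      using cstar_algebra.nrm_triangle[OF that, of "component F A" "component G A"]
        nrm_component_le[OF that, of F] nrm_component_le[OF that, of G] that by simp
  qed (simp add: product_norm_nonneg)
  show "norm (F * G) \<le> norm F * norm G"
    unfolding norm_cstar_product_def
  proof (rule product_norm_le)
    show "nrm A (component (F * G) A) \<le> product_norm F * product_norm G" if "cstar_algebra A" for A
      unfolding component_mult[OF that]
      by (rule order_trans[OF cstar_algebra.nrm_mult[OF that] mult_mono])
        (simp_all add: that nrm_component_le product_norm_nonneg cstar_algebra.nrm_nonneg)
  qed (simp add: product_norm_nonneg)
  show "(norm F = 0) = (F = 0)"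
  proof
    assume "norm F = 0"
    then have "nrm A (component F A) = 0" if "cstar_algebra A" for A
      using nrm_component_le[OF that, of F] cstar_algebra.nrm_nonneg[OF that component_closed[OF that], of F]
      by (simp add: norm_cstar_product_def)
    then show "F = 0"
      by (intro cstar_product_eqI) (simp add: cstar_algebra.nrm_eq_0_iff)
  next
    assume "F = 0"
    moreover have "product_norm (0 :: 'a cstar_product) \<le> 0"
      by (rule product_norm_le) (simp_all add: cstar_algebra.nrm_zero)
    ultimately show "norm F = 0"
      using product_norm_nonneg[of F] by (simp add: norm_cstar_product_def)
  qed
  show "sgn F = inverse (norm F) *\<^sub>R F"
    by (simp add: sgn_cstar_product_def scaleR_cstar_product_def)
  show "dist F G = norm (F - G)" by (rule dist_cstar_product_def)
  show "uniformity = (INF e\<in>{0<..}. principal {(F, G). dist (F::'a cstar_product) G < e})"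
    by (rule uniformity_cstar_product_def)
  show "open S = (\<forall>x\<in>S. \<forall>\<^sub>F (x', y) in uniformity. x' = x \<longrightarrow> y \<in> S)" for S :: "'a cstar_product set"
    by (rule open_cstar_product_def)
qed

end

instantiation cstar_product :: (type) cstar_normed_algebra
begin

definition scaleC_cstar_product :: "complex \<Rightarrow> 'a cstar_product \<Rightarrow> 'a cstar_product" where
  "c *\<^sub>C F = mk_product (\<lambda>A. c \<odot>\<^bsub>A\<^esub> component F A)"
definition adj_cstar_product :: "'a cstar_product \<Rightarrow> 'a cstar_product" where
  "adj F = mk_product (\<lambda>A. star A (component F A))"

lemma component_scaleC [simp]: "cstar_algebra A \<Longrightarrow> component (c *\<^sub>C F) A = c \<odot>\<^bsub>A\<^esub> component F A"
  for A :: "'a cstar"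
  unfolding scaleC_cstar_product_def by (rule component_smult)

lemma component_adj [simp]: "cstar_algebra A \<Longrightarrow> component (adj F) A = star A (component F A)"
  for A :: "'a cstar"
  unfolding adj_cstar_product_def
  by (rule component_mk_product[where K = "product_norm F"])
    (simp_all add: cstar_algebra.star_closed cstar_algebra.nrm_star nrm_component_le)

instance
proof
  fix F G :: "'a cstar_product" and r :: real and c d :: complex
  show "r *\<^sub>R F = complex_of_real r *\<^sub>C F"
    by (simp add: scaleR_cstar_product_def scaleC_cstar_product_def)
  show "c *\<^sub>C (F + G) = c *\<^sub>C F + c *\<^sub>C G" "(c + d) *\<^sub>C F = c *\<^sub>C F + d *\<^sub>C F"
      "c *\<^sub>C d *\<^sub>C F = (c * d) *\<^sub>C F" "c *\<^sub>C F * G = c *\<^sub>C (F * G)" "F * c *\<^sub>C G = c *\<^sub>C (F * G)"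
    by (rule cstar_product_eqI; simp add: cstar_algebra.smult_r_distr' cstar_algebra.smult_l_distr'
        cstar_algebra.smult_assoc' cstar_algebra.smult_mult_left cstar_algebra.smult_mult_right)+
  show "norm (c *\<^sub>C F) = cmod c * norm F"
    unfolding norm_cstar_product_def by (rule product_norm_smult) simp
  show "adj (F + G) = adj F + adj G" "adj (c *\<^sub>C F) = cnj c *\<^sub>C adj F" "adj (F * G) = adj G * adj F"
      "adj (adj F) = F"
    by (rule cstar_product_eqI; simp add: cstar_algebra.star_add cstar_algebra.star_smult
        cstar_algebra.star_mult cstar_algebra.star_star)+
  show "norm (adj F * F) = (norm F)\<^sup>2"
  proof (rule antisym)
    have n: "nrm A (component (adj F * F) A) = (nrm A (component F A))\<^sup>2" if "cstar_algebra A" for A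
      using that by (simp add: cstar_algebra.cstar_identity)
    show "norm (adj F * F) \<le> (norm F)\<^sup>2" unfolding norm_cstar_product_def
      by (rule product_norm_le) (simp_all only: n zero_le_power2, simp add: power_mono
          nrm_component_le cstar_algebra.nrm_nonneg)
    have "norm F \<le> sqrt (norm (adj F * F))" unfolding norm_cstar_product_def
    proof (rule product_norm_le)
      show "nrm A (component F A) \<le> sqrt (product_norm (adj F * F))" if "cstar_algebra A" for A
        using nrm_component_le[OF that, of "adj F * F"] unfolding n[OF that] by (rule real_le_rsqrt)
    qed (simp add: product_norm_nonneg)
    then have "(norm F)\<^sup>2 \<le> (sqrt (norm (adj F * F)))\<^sup>2" by (intro power_mono) simp_all
    then show "(norm F)\<^sup>2 \<le> norm (adj F * F)" by simp
  qed
next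
  fix X :: "nat \<Rightarrow> 'a cstar_product"
  assume X: "Cauchy X"
  have comp: "nrm A (component (X m) A \<ominus>\<^bsub>A\<^esub> component (X n) A) \<le> norm (X m - X n)"
    if "cstar_algebra A" for A m n
    using nrm_component_le[OF that, of "X m - X n"] that by (simp add: norm_cstar_product_def)
  have "\<exists>x\<in>carrier A. \<forall>\<epsilon>>0. \<exists>N. \<forall>n\<ge>N. nrm A (component (X n) A \<ominus>\<^bsub>A\<^esub> x) < \<epsilon>"
    if A: "cstar_algebra A" for A
  proof (rule cstar_algebra.Cauchy_imp_limit[OF A])
    show "\<exists>N. \<forall>m\<ge>N. \<forall>n\<ge>N. nrm A (component (X m) A \<ominus>\<^bsub>A\<^esub> component (X n) A) < \<epsilon>" if "\<epsilon> > 0" for \<epsilon>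
      using CauchyD[OF X that] comp[OF A] by (meson le_less_trans)
  qed (simp add: A)
  then obtain f where f: "\<And>A. cstar_algebra A \<Longrightarrow> f A \<in> carrier A"
    and lim: "\<And>A \<epsilon>. cstar_algebra A \<Longrightarrow> \<epsilon> > 0 \<Longrightarrow>
      \<exists>N. \<forall>n\<ge>N. nrm A (component (X n) A \<ominus>\<^bsub>A\<^esub> f A) < \<epsilon>"
    by metis
  \<comment> \<open>Within one component the comparison index may be chosen as far out as that
    component demands, while the bound \<open>\<epsilon>\<close> is the same for all of them. So
    componentwise limits are limits in the supremum norm.\<close>
  have near: "nrm A (component G A \<ominus>\<^bsub>A\<^esub> f A) \<le> \<epsilon>"
    if A: "cstar_algebra A" and \<epsilon>: "\<And>m. m \<ge> N \<Longrightarrow> norm (G - X m) \<le> \<epsilon>" for A G N \<epsilon>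
  proof (rule field_le_epsilon)
    fix \<delta> :: real assume "\<delta> > 0"
    then obtain M where M: "\<forall>n\<ge>M. nrm A (component (X n) A \<ominus>\<^bsub>A\<^esub> f A) < \<delta>" using lim[OF A] by blast
    interpret cstar_algebra A by (rule A)
    let ?m = "max M N" and ?g = "component G A"
    let ?x = "component (X ?m) A"
    have c: "?g \<in> carrier A" "?x \<in> carrier A" "f A \<in> carrier A" using A f by simp_all
    have "?g \<ominus>\<^bsub>A\<^esub> f A = (?g \<ominus>\<^bsub>A\<^esub> ?x) \<oplus>\<^bsub>A\<^esub> (?x \<ominus>\<^bsub>A\<^esub> f A)"
      using c(1,2,3) by (rule minus_telescope)
    then have "nrm A (?g \<ominus>\<^bsub>A\<^esub> f A) \<le> nrm A (?g \<ominus>\<^bsub>A\<^esub> ?x) + nrm A (?x \<ominus>\<^bsub>A\<^esub> f A)"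
      using nrm_triangle[of "?g \<ominus>\<^bsub>A\<^esub> ?x" "?x \<ominus>\<^bsub>A\<^esub> f A"] c by (simp add: minus_closed)
    moreover have "nrm A (?g \<ominus>\<^bsub>A\<^esub> ?x) \<le> \<epsilon>"
      using nrm_component_le[OF A, of "G - X ?m"] \<epsilon>[of ?m] A by (simp add: norm_cstar_product_def)
    moreover have "nrm A (?x \<ominus>\<^bsub>A\<^esub> f A) < \<delta>" using M by simp
    ultimately show "nrm A (?g \<ominus>\<^bsub>A\<^esub> f A) \<le> \<epsilon> + \<delta>" by simp
  qed
  obtain K where K: "\<And>n. norm (X n) \<le> K" using Cauchy_Bseq[OF X] by (auto simp: Bseq_def)
  \<comment> \<open>The case \<open>G = 0\<close>, \<open>N = 0\<close> of \<open>near\<close>: the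
    componentwise limits form a bounded family.\<close>
  have fK: "nrm A (f A) \<le> K" if A: "cstar_algebra A" for A
  proof -
    interpret cstar_algebra A by (rule A)
    have "nrm A (component 0 A \<ominus>\<^bsub>A\<^esub> f A) \<le> K" by (rule near[OF A, of 0]) (simp add: K)
    then show ?thesis using A f[OF A] by (simp add: M.minus_eq nrm_minus)
  qed
  define L where "L = mk_product f"
  have L: "component L A = f A" if "cstar_algebra A" for A
    unfolding L_def by (rule component_mk_product[OF f fK that])
  have "X \<longlonglongrightarrow> L"
  proof (rule LIMSEQ_I)
    fix r :: real assume "r > 0"
    then obtain N where N: "\<forall>m\<ge>N. \<forall>n\<ge>N. norm (X m - X n) < r / 2"
      using CauchyD[OF X, of "r / 2"] by auto
    have "norm (X n - L) < r" if "n \<ge> N" for n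
    proof -
      have "norm (X n - L) \<le> r / 2" unfolding norm_cstar_product_def
      proof (rule product_norm_le)
        show "nrm A (component (X n - L) A) \<le> r / 2" if A: "cstar_algebra A" for A
          using near[OF A, of N "X n" "r / 2"] N \<open>n \<ge> N\<close> A by (simp add: L less_imp_le)
      qed (use \<open>r > 0\<close> in simp)
      then show ?thesis using \<open>r > 0\<close> by simp
    qed
    then show "\<exists>N. \<forall>n\<ge>N. norm (X n - L) < r" by blast
  qed
  then show "convergent X" by (rule convergentI)
qed

end

text \<open>The isometric *-embedding as the summand at \<open>A\<close>. Statements about elements
  of \<open>A\<close> are proved for their images, and \<open>component\<close> at \<open>A\<close>
  carries witnesses back to the carrier.\<close>

definition emb :: "'a cstar \<Rightarrow> 'a \<Rightarrow> 'a cstar_product" where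
  "emb A x = mk_product (\<lambda>B. if B = A then x else \<zero>\<^bsub>B\<^esub>)"

context cstar_algebra
begin

lemma component_emb:
  assumes "x \<in> carrier A" "cstar_algebra B"
  shows "component (emb A x) B = (if B = A then x else \<zero>\<^bsub>B\<^esub>)"
  unfolding emb_def
  by (rule component_mk_product[where K = "nrm A x"])
    (use assms in \<open>auto simp: zero_in_carrier cstar_algebra.nrm_zero nrm_nonneg\<close>)

lemma component_emb_self [simp]: "x \<in> carrier A \<Longrightarrow> component (emb A x) A = x"
  using component_emb[OF _ cstar_algebra_axioms] by simp

lemma star_zero: "star A \<zero> = \<zero>"
proof -
  have "star A \<zero> \<oplus> star A \<zero> = star A \<zero>" using star_add[OF zero_closed zero_closed] by simp
  then show ?thesis using M.add.l_cancel_one' star_closed[OF zero_closed] by metis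
qed

lemma smult_zero: "c \<odot> \<zero> = \<zero>"
  using nrm_smult[OF zero_closed, of c] nrm_eq_0_iff[OF smult_closed'[OF zero_closed]] nrm_zero by simp

lemma mult_zero: "\<zero> \<otimes> \<zero> = \<zero>"
  using nrm_mult[OF zero_closed zero_closed] nrm_nonneg[OF mult_closed[OF zero_closed zero_closed]]
    nrm_eq_0_iff[OF mult_closed[OF zero_closed zero_closed]] nrm_zero by simp

lemma emb_add: "\<lbrakk>x \<in> carrier A; y \<in> carrier A\<rbrakk> \<Longrightarrow> emb A (x \<oplus> y) = emb A x + emb A y"
  by (rule cstar_product_eqI) (simp add: component_emb add_closed cstar_algebra.add_zero_left zero_in_carrier)

lemma emb_mult: "\<lbrakk>x \<in> carrier A; y \<in> carrier A\<rbrakk> \<Longrightarrow> emb A (x \<otimes> y) = emb A x * emb A y"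
  by (rule cstar_product_eqI) (simp add: component_emb mult_closed cstar_algebra.mult_zero)

lemma emb_smult: "x \<in> carrier A \<Longrightarrow> emb A (c \<odot> x) = c *\<^sub>C emb A x"
  by (rule cstar_product_eqI) (simp add: component_emb smult_closed' cstar_algebra.smult_zero)

lemma emb_star: "x \<in> carrier A \<Longrightarrow> emb A (star A x) = adj (emb A x)"
  by (rule cstar_product_eqI) (simp add: component_emb star_closed cstar_algebra.star_zero)

lemma emb_zero: "emb A \<zero> = 0"
  by (rule cstar_product_eqI) (simp add: component_emb zero_closed)

lemma emb_a_inv: "x \<in> carrier A \<Longrightarrow> emb A (\<ominus> x) = - emb A x"
  using emb_smult[of x "-1"] by (simp add: smult_minus_one scaleC_minus_left)

lemma emb_minus: "\<lbrakk>x \<in> carrier A; y \<in> carrier A\<rbrakk> \<Longrightarrow> emb A (x \<ominus> y) = emb A x - emb A y"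
  by (simp add: M.minus_eq emb_add emb_a_inv)

lemma norm_emb: "x \<in> carrier A \<Longrightarrow> norm (emb A x) = nrm A x"
  unfolding norm_cstar_product_def
proof (rule antisym)
  assume x: "x \<in> carrier A"
  show "product_norm (emb A x) \<le> nrm A x"
    by (rule product_norm_le) (simp_all add: x component_emb nrm_nonneg cstar_algebra.nrm_zero)
  show "nrm A x \<le> product_norm (emb A x)"
    using nrm_component_le[OF cstar_algebra_axioms, of "emb A x"] x by simp
qed

lemma emb_inject: "\<lbrakk>x \<in> carrier A; y \<in> carrier A\<rbrakk> \<Longrightarrow> emb A x = emb A y \<longleftrightarrow> x = y"
  by (metis component_emb_self)

lemmas emb_simps = emb_add emb_mult emb_smult emb_star emb_minus

lemma nrm_minus_eq: "\<lbrakk>x \<in> carrier A; y \<in> carrier A\<rbrakk> \<Longrightarrow> nrm A (x \<ominus> y) = norm (emb A x - emb A y)"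
  by (simp add: minus_closed flip: norm_emb emb_minus)

end

section \<open>The sequence algebra is a C*-algebra\<close>

text \<open>An infimum norm is accessible through its strict upper bounds; this removes the slack
  from estimates of products.\<close>

lemma le_mult_of_less:
  fixes x y z :: real
  assumes "\<And>s t. x < s \<Longrightarrow> y < t \<Longrightarrow> z \<le> s * t"
  shows "z \<le> x * y"
proof (rule LIMSEQ_le_const)
  have "(\<lambda>n. (x + inverse (real (Suc n))) * (y + inverse (real (Suc n)))) \<longlonglongrightarrow> (x + 0) * (y + 0)"
    by (intro tendsto_intros LIMSEQ_inverse_real_of_nat)
  then show "(\<lambda>n. (x + inverse (real (Suc n))) * (y + inverse (real (Suc n)))) \<longlonglongrightarrow> x * y" by simp
  show "\<exists>N. \<forall>n\<ge>N. z \<le> (x + inverse (real (Suc n))) * (y + inverse (real (Suc n)))"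
    by (intro exI[of _ 0] allI impI assms) simp_all
qed

section \<open>Bounded sequences modulo null sequences\<close>

locale cstar_sequence =
  fixes A :: "nat \<Rightarrow> 'a cstar"
  assumes cstar: "cstar_algebra (A n)"
begin

abbreviation S :: "(nat \<Rightarrow> 'a) set" where "S \<equiv> carrier (product_algebra A)"
abbreviation Q :: "(nat \<Rightarrow> 'a) set cstar" where "Q \<equiv> sequence_algebra A"
abbreviation cl :: "(nat \<Rightarrow> 'a) \<Rightarrow> (nat \<Rightarrow> 'a) set" where "cl \<equiv> sequence_class A"

text \<open>All entries of a sequence, although from different algebras, become points of one normed
  space. Membership in the null ideal and equality of classes turn into ordinary limits.\<close>

definition E :: "(nat \<Rightarrow> 'a) \<Rightarrow> nat \<Rightarrow> 'a cstar_product" where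
  "E a n = emb (A n) (a n)"

lemma S_iff: "a \<in> S \<longleftrightarrow> (\<forall>n. a n \<in> carrier (A n)) \<and> (\<exists>K. \<forall>n. norm (E a n) \<le> K)"
proof (cases "\<forall>n. a n \<in> carrier (A n)")
  case True
  then have "norm (E a n) = nrm (A n) (a n)" for n
    by (simp add: E_def cstar_algebra.norm_emb[OF cstar])
  then show ?thesis using True by (simp add: product_algebra_def bdd_above_def)
next
  case False
  then have "a \<notin> S" by (simp add: product_algebra_def)
  with False show ?thesis by blast
qed

lemma S_carrier: "a \<in> S \<Longrightarrow> a n \<in> carrier (A n)"
  by (simp add: S_iff)

lemma S_bounded: "a \<in> S \<Longrightarrow> \<exists>K. \<forall>n. norm (E a n) \<le> K"
  by (simp add: S_iff)

lemma E_add: "\<lbrakk>a \<in> S; b \<in> S\<rbrakk> \<Longrightarrow> E (\<lambda>n. a n \<oplus>\<^bsub>A n\<^esub> b n) n = E a n + E b n"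
  by (simp add: E_def S_carrier cstar_algebra.emb_add[OF cstar])
lemma E_minus: "\<lbrakk>a \<in> S; b \<in> S\<rbrakk> \<Longrightarrow> E (\<lambda>n. a n \<ominus>\<^bsub>A n\<^esub> b n) n = E a n - E b n"
  by (simp add: E_def S_carrier cstar_algebra.emb_minus[OF cstar])
lemma E_a_inv: "a \<in> S \<Longrightarrow> E (\<lambda>n. \<ominus>\<^bsub>A n\<^esub> a n) n = - E a n"
  by (simp add: E_def S_carrier cstar_algebra.emb_a_inv[OF cstar])
lemma E_mult: "\<lbrakk>a \<in> S; b \<in> S\<rbrakk> \<Longrightarrow> E (\<lambda>n. a n \<otimes>\<^bsub>A n\<^esub> b n) n = E a n * E b n"
  by (simp add: E_def S_carrier cstar_algebra.emb_mult[OF cstar])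
lemma E_smult: "a \<in> S \<Longrightarrow> E (\<lambda>n. c \<odot>\<^bsub>A n\<^esub> a n) n = c *\<^sub>C E a n"
  by (simp add: E_def S_carrier cstar_algebra.emb_smult[OF cstar])
lemma E_star: "a \<in> S \<Longrightarrow> E (\<lambda>n. star (A n) (a n)) n = adj (E a n)"
  by (simp add: E_def S_carrier cstar_algebra.emb_star[OF cstar])
lemma E_zero: "E (\<lambda>n. \<zero>\<^bsub>A n\<^esub>) n = 0"
  by (simp add: E_def cstar_algebra.emb_zero[OF cstar])

lemmas E_simps = E_add E_minus E_a_inv E_mult E_smult E_star E_zero

lemma S_I:
  assumes "\<And>n. a n \<in> carrier (A n)" "\<And>n. norm (E a n) \<le> K"
  shows "a \<in> S"
  using assms by (auto simp: S_iff)

lemma S_zero: "(\<lambda>n. \<zero>\<^bsub>A n\<^esub>) \<in> S"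
  by (rule S_I[where K = 0]) (simp_all add: E_simps cstar_algebra.zero_closed[OF cstar])

lemma S_add: assumes a: "a \<in> S" and b: "b \<in> S" shows "(\<lambda>n. a n \<oplus>\<^bsub>A n\<^esub> b n) \<in> S"
proof -
  obtain K L where "\<And>n. norm (E a n) \<le> K" "\<And>n. norm (E b n) \<le> L"
    using S_bounded[OF a] S_bounded[OF b] by blast
  then show ?thesis
    by (intro S_I[where K = "K + L"])
      (simp_all add: E_simps a b S_carrier cstar_algebra.add_closed[OF cstar] norm_triangle_mono)
qed

lemma S_mult: assumes a: "a \<in> S" and b: "b \<in> S" shows "(\<lambda>n. a n \<otimes>\<^bsub>A n\<^esub> b n) \<in> S"
proof -
  obtain K L where KL: "\<And>n. norm (E a n) \<le> K" "\<And>n. norm (E b n) \<le> L"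
    using S_bounded[OF a] S_bounded[OF b] by blast
  show ?thesis
  proof (rule S_I[where K = "K * L"])
    show "norm (E (\<lambda>n. a n \<otimes>\<^bsub>A n\<^esub> b n) n) \<le> K * L" for n
      unfolding E_mult[OF a b]
      by (rule order_trans[OF norm_mult_ineq mult_mono])
        (use KL[of n] norm_ge_zero[of "E a n"] in \<open>simp_all, linarith\<close>)
  qed (simp add: a b S_carrier cstar_algebra.mult_closed[OF cstar])
qed

lemma S_smult: assumes a: "a \<in> S" shows "(\<lambda>n. c \<odot>\<^bsub>A n\<^esub> a n) \<in> S"
proof -
  obtain K where "\<And>n. norm (E a n) \<le> K" using S_bounded[OF a] by blast
  then show ?thesis
    by (intro S_I[where K = "cmod c * K"])
      (simp_all add: E_simps a S_carrier cstar_algebra.smult_closed'[OF cstar] norm_scaleC mult_left_mono)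
qed

lemma S_star: assumes a: "a \<in> S" shows "(\<lambda>n. star (A n) (a n)) \<in> S"
proof -
  obtain K where "\<And>n. norm (E a n) \<le> K" using S_bounded[OF a] by blast
  then show ?thesis
    by (intro S_I[where K = K]) (simp_all add: E_simps a S_carrier cstar_algebra.star_closed[OF cstar])
qed

lemma S_a_inv: assumes a: "a \<in> S" shows "(\<lambda>n. \<ominus>\<^bsub>A n\<^esub> a n) \<in> S"
proof -
  obtain K where "\<And>n. norm (E a n) \<le> K" using S_bounded[OF a] by blast
  then show ?thesis
    by (intro S_I[where K = K]) (simp_all add: E_simps a S_carrier cstar_algebra.a_inv_closed[OF cstar])
qed

lemma S_minus: assumes a: "a \<in> S" and b: "b \<in> S" shows "(\<lambda>n. a n \<ominus>\<^bsub>A n\<^esub> b n) \<in> S"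
  using S_add[OF a S_a_inv[OF b]] by (simp add: a b S_carrier cstar_algebra.minus_eq[OF cstar])

lemmas S_closed = S_zero S_add S_mult S_smult S_star S_a_inv S_minus

lemma null_iff: "j \<in> null_sequences A \<longleftrightarrow> j \<in> S \<and> (\<lambda>n. E j n) \<longlonglongrightarrow> 0"
proof (cases "j \<in> S")
  case True
  then have "norm (E j n) = nrm (A n) (j n)" for n
    by (simp add: E_def S_carrier cstar_algebra.norm_emb[OF cstar])
  then show ?thesis using True tendsto_norm_zero_iff[of "E j" sequentially]
    by (simp add: null_sequences_def)
qed (simp add: null_sequences_def)

lemma mem_cl_iff:
  assumes a: "a \<in> S"
  shows "x \<in> cl a \<longleftrightarrow> x \<in> S \<and> (\<lambda>n. E x n - E a n) \<longlonglongrightarrow> 0"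
proof
  assume "x \<in> cl a"
  then obtain j where j: "j \<in> null_sequences A" "x = (\<lambda>n. j n \<oplus>\<^bsub>A n\<^esub> a n)"
    unfolding sequence_class_def a_r_coset_def' by (auto simp: product_algebra_def)
  then show "x \<in> S \<and> (\<lambda>n. E x n - E a n) \<longlonglongrightarrow> 0"
    using a by (simp add: null_iff E_simps S_closed)
next
  assume x: "x \<in> S \<and> (\<lambda>n. E x n - E a n) \<longlonglongrightarrow> 0"
  then have j: "(\<lambda>n. x n \<ominus>\<^bsub>A n\<^esub> a n) \<in> null_sequences A"
    using a by (simp add: null_iff E_simps S_closed)
  have "x n \<ominus>\<^bsub>A n\<^esub> a n \<oplus>\<^bsub>A n\<^esub> a n = x n" for n
  proof -
    interpret cstar_algebra "A n" by (rule cstar)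
    show ?thesis using x a by (simp add: minus_eq add_assoc a_inv_left S_carrier)
  qed
  then show "x \<in> cl a"
    unfolding sequence_class_def a_r_coset_def' using j
    by (auto simp: product_algebra_def intro!: bexI[OF _ j])
qed

lemma cl_self: "a \<in> S \<Longrightarrow> a \<in> cl a"
  by (simp add: mem_cl_iff)

lemma cl_eq_iff:
  assumes a: "a \<in> S" and b: "b \<in> S"
  shows "cl a = cl b \<longleftrightarrow> (\<lambda>n. E a n - E b n) \<longlonglongrightarrow> 0"
proof
  assume "cl a = cl b"
  then show "(\<lambda>n. E a n - E b n) \<longlonglongrightarrow> 0" using cl_self[OF a] by (simp add: mem_cl_iff[OF b])
next
  assume ab: "(\<lambda>n. E a n - E b n) \<longlonglongrightarrow> 0"
  have "(\<lambda>n. E x n - E a n) \<longlonglongrightarrow> 0 \<longleftrightarrow> (\<lambda>n. E x n - E b n) \<longlonglongrightarrow> 0" for x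
  proof
    assume "(\<lambda>n. E x n - E a n) \<longlonglongrightarrow> 0"
    from tendsto_add[OF this ab] show "(\<lambda>n. E x n - E b n) \<longlonglongrightarrow> 0" by simp
  next
    assume "(\<lambda>n. E x n - E b n) \<longlonglongrightarrow> 0"
    from tendsto_diff[OF this ab] show "(\<lambda>n. E x n - E a n) \<longlonglongrightarrow> 0" by simp
  qed
  then show "cl a = cl b" by (auto simp: mem_cl_iff a b)
qed

lemma carrier_Q: "carrier Q = cl ` S"
proof -
  have "carrier Q = (\<Union>a\<in>S. {cl a})"
    by (simp add: sequence_algebra_def quotient_algebra_def FactRing_def A_RCOSETS_def' sequence_class_def)
  then show ?thesis by blast
qed

lemma cl_closed [simp]: "a \<in> S \<Longrightarrow> cl a \<in> carrier Q"
  by (simp add: carrier_Q)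

lemma Q_cases: assumes "X \<in> carrier Q" obtains a where "a \<in> S" "X = cl a"
proof -
  from assms obtain a where "a \<in> S" "X = cl a" unfolding carrier_Q by (rule imageE)
  then show thesis by (rule that)
qed

lemma Q_zero: "\<zero>\<^bsub>Q\<^esub> = cl (\<lambda>n. \<zero>\<^bsub>A n\<^esub>)"
proof -
  have "\<zero>\<^bsub>Q\<^esub> = null_sequences A" by (simp add: sequence_algebra_def quotient_algebra_def FactRing_def)
  also have "\<dots> = cl (\<lambda>n. \<zero>\<^bsub>A n\<^esub>)" by (auto simp: null_iff mem_cl_iff S_zero E_simps)
  finally show ?thesis .
qed

lemma Q_add:
  assumes a: "a \<in> S" and b: "b \<in> S"
  shows "cl a \<oplus>\<^bsub>Q\<^esub> cl b = cl (\<lambda>n. a n \<oplus>\<^bsub>A n\<^esub> b n)"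
proof -
  have "cl a \<oplus>\<^bsub>Q\<^esub> cl b = {(\<lambda>n. x n \<oplus>\<^bsub>A n\<^esub> y n) | x y. x \<in> cl a \<and> y \<in> cl b}"
    by (auto simp: sequence_algebra_def quotient_algebra_def FactRing_def set_add_def' product_algebra_def)
  also have "\<dots> = cl (\<lambda>n. a n \<oplus>\<^bsub>A n\<^esub> b n)"
  proof (intro equalityI subsetI)
    fix z assume "z \<in> {(\<lambda>n. x n \<oplus>\<^bsub>A n\<^esub> y n) | x y. x \<in> cl a \<and> y \<in> cl b}"
    then obtain x y where z: "z = (\<lambda>n. x n \<oplus>\<^bsub>A n\<^esub> y n)" and x: "x \<in> cl a" and y: "y \<in> cl b" by auto
    have "(\<lambda>n. (E x n - E a n) + (E y n - E b n)) \<longlonglongrightarrow> 0 + 0"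
      using x y by (intro tendsto_add) (simp_all add: mem_cl_iff a b)
    then show "z \<in> cl (\<lambda>n. a n \<oplus>\<^bsub>A n\<^esub> b n)"
      using x y by (simp add: z mem_cl_iff a b S_closed E_simps algebra_simps)
  next
    fix z assume z: "z \<in> cl (\<lambda>n. a n \<oplus>\<^bsub>A n\<^esub> b n)"
    then have zS: "z \<in> S" by (simp add: mem_cl_iff a b S_closed)
    have "z = (\<lambda>n. (z n \<ominus>\<^bsub>A n\<^esub> b n) \<oplus>\<^bsub>A n\<^esub> b n)"
    proof
      fix n
      interpret cstar_algebra "A n" by (rule cstar)
      show "z n = (z n \<ominus>\<^bsub>A n\<^esub> b n) \<oplus>\<^bsub>A n\<^esub> b n"
        using zS b by (simp add: minus_eq add_assoc a_inv_left S_carrier)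
    qed
    moreover have "(\<lambda>n. z n \<ominus>\<^bsub>A n\<^esub> b n) \<in> cl a"
      using z by (simp add: mem_cl_iff a b zS S_closed E_simps algebra_simps)
    ultimately show "z \<in> {(\<lambda>n. x n \<oplus>\<^bsub>A n\<^esub> y n) | x y. x \<in> cl a \<and> y \<in> cl b}"
      by (intro CollectI exI[of _ "\<lambda>n. z n \<ominus>\<^bsub>A n\<^esub> b n"] exI[of _ b] conjI cl_self[OF b])
  qed
  finally show ?thesis .
qed

text \<open>The product of cosets is a union over all pairs of representatives. These cosets
  coincide, since \<open>x y - a b = x (y - b) + (x - a) b\<close> is a null sequence when
  \<open>x\<close> and \<open>b\<close> are bounded. Scalar multiples and adjoints are unions of the
  same kind.\<close>

lemma Q_mult:
  assumes a: "a \<in> S" and b: "b \<in> S"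
  shows "cl a \<otimes>\<^bsub>Q\<^esub> cl b = cl (\<lambda>n. a n \<otimes>\<^bsub>A n\<^esub> b n)"
proof -
  have eq: "cl (\<lambda>n. x n \<otimes>\<^bsub>A n\<^esub> y n) = cl (\<lambda>n. a n \<otimes>\<^bsub>A n\<^esub> b n)" if x: "x \<in> cl a" and y: "y \<in> cl b" for x y
  proof -
    have xy: "x \<in> S" "y \<in> S" "(\<lambda>n. E x n - E a n) \<longlonglongrightarrow> 0" "(\<lambda>n. E y n - E b n) \<longlonglongrightarrow> 0"
      using x y by (simp_all add: mem_cl_iff a b)
    obtain K L where K: "\<And>n. norm (E x n) \<le> K" and L: "\<And>n. norm (E b n) \<le> L"
      using S_bounded[OF xy(1)] S_bounded[OF b] by blast
    have "(\<lambda>n. E x n * (E y n - E b n)) \<longlonglongrightarrow> 0"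
    proof (rule Lim_null_comparison[OF always_eventually])
      show "\<forall>n. norm (E x n * (E y n - E b n)) \<le> K * norm (E y n - E b n)"
        by (intro allI order_trans[OF norm_mult_ineq mult_right_mono] K norm_ge_zero)
      show "(\<lambda>n. K * norm (E y n - E b n)) \<longlonglongrightarrow> 0"
        using tendsto_mult_right_zero[OF tendsto_norm_zero[OF xy(4)]] by simp
    qed
    moreover have "(\<lambda>n. (E x n - E a n) * E b n) \<longlonglongrightarrow> 0"
    proof (rule Lim_null_comparison[OF always_eventually])
      show "\<forall>n. norm ((E x n - E a n) * E b n) \<le> norm (E x n - E a n) * L"
        by (intro allI order_trans[OF norm_mult_ineq mult_left_mono] L norm_ge_zero)
      show "(\<lambda>n. norm (E x n - E a n) * L) \<longlonglongrightarrow> 0"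
        using tendsto_mult_left_zero[OF tendsto_norm_zero[OF xy(3)]] by simp
    qed
    ultimately have "(\<lambda>n. E x n * (E y n - E b n) + (E x n - E a n) * E b n) \<longlonglongrightarrow> 0 + 0"
      by (rule tendsto_add)
    then show ?thesis
      using xy by (subst cl_eq_iff) (simp_all add: a b S_closed E_simps algebra_simps)
  qed
  have "cl a \<otimes>\<^bsub>Q\<^esub> cl b = (\<Union>x\<in>cl a. \<Union>y\<in>cl b. cl (\<lambda>n. x n \<otimes>\<^bsub>A n\<^esub> y n))"
    by (simp add: sequence_algebra_def quotient_algebra_def FactRing_def rcoset_mult_def
        sequence_class_def) (simp add: product_algebra_def)
  also have "(\<Union>x\<in>cl a. \<Union>y\<in>cl b. cl (\<lambda>n. x n \<otimes>\<^bsub>A n\<^esub> y n)) = cl (\<lambda>n. a n \<otimes>\<^bsub>A n\<^esub> b n)"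
    using cl_self[OF a] cl_self[OF b] by (intro SUP_eq_const eq; blast)
  finally show ?thesis .
qed

lemma Q_smult:
  assumes a: "a \<in> S"
  shows "c \<odot>\<^bsub>Q\<^esub> cl a = cl (\<lambda>n. c \<odot>\<^bsub>A n\<^esub> a n)"
proof -
  have eq: "cl (\<lambda>n. c \<odot>\<^bsub>A n\<^esub> x n) = cl (\<lambda>n. c \<odot>\<^bsub>A n\<^esub> a n)" if x: "x \<in> cl a" for x
  proof -
    have x: "x \<in> S" "(\<lambda>n. E x n - E a n) \<longlonglongrightarrow> 0" using x by (simp_all add: mem_cl_iff a)
    have "(\<lambda>n. c *\<^sub>C (E x n - E a n)) \<longlonglongrightarrow> 0"
      by (rule bounded_linear.tendsto_zero[OF bounded_linear_scaleC x(2)])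
    then show ?thesis using x
      by (subst cl_eq_iff) (simp_all add: a S_closed E_simps scaleC_diff_right)
  qed
  have "c \<odot>\<^bsub>Q\<^esub> cl a = (\<Union>x\<in>cl a. cl (\<lambda>n. c \<odot>\<^bsub>A n\<^esub> x n))"
    by (simp add: sequence_algebra_def quotient_algebra_def sequence_class_def)
      (simp add: product_algebra_def)
  also have "\<dots> = cl (\<lambda>n. c \<odot>\<^bsub>A n\<^esub> a n)"
    using cl_self[OF a] by (intro SUP_eq_const eq; blast)
  finally show ?thesis .
qed

lemma Q_star:
  assumes a: "a \<in> S"
  shows "star Q (cl a) = cl (\<lambda>n. star (A n) (a n))"
proof -
  have eq: "cl (\<lambda>n. star (A n) (x n)) = cl (\<lambda>n. star (A n) (a n))" if x: "x \<in> cl a" for x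
  proof -
    have x: "x \<in> S" "(\<lambda>n. E x n - E a n) \<longlonglongrightarrow> 0" using x by (simp_all add: mem_cl_iff a)
    then have "(\<lambda>n. adj (E x n - E a n)) \<longlonglongrightarrow> adj 0" by (intro tendsto_adj)
    then show ?thesis using x
      by (subst cl_eq_iff) (simp_all add: a S_closed E_simps adj_diff)
  qed
  have "star Q (cl a) = (\<Union>x\<in>cl a. cl (\<lambda>n. star (A n) (x n)))"
    by (simp add: sequence_algebra_def quotient_algebra_def sequence_class_def)
      (simp add: product_algebra_def)
  also have "\<dots> = cl (\<lambda>n. star (A n) (a n))"
    using cl_self[OF a] by (intro SUP_eq_const eq; blast)
  finally show ?thesis .
qed

section \<open>The quotient norm as the limit superior of the norms of the entries\<close>

lemma nrm_Q: "nrm Q X = (INF x\<in>X. SUP n. norm (E x n))" if X: "X \<in> carrier Q"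
proof -
  obtain a where a: "a \<in> S" "X = cl a" by (rule Q_cases[OF X])
  have "nrm Q X = (INF x\<in>X. SUP n. nrm (A n) (x n))"
    by (simp add: sequence_algebra_def quotient_algebra_def product_algebra_def)
  also have "\<dots> = (INF x\<in>X. SUP n. norm (E x n))"
    by (intro INF_cong refl SUP_cong)
      (simp add: E_def a mem_cl_iff S_carrier cstar_algebra.norm_emb[OF cstar])
  finally show ?thesis .
qed

lemma SUP_E_nonneg: "x \<in> S \<Longrightarrow> 0 \<le> (SUP n. norm (E x n))"
proof -
  assume "x \<in> S"
  then have "bdd_above (range (\<lambda>n. norm (E x n)))" using S_bounded[of x] by (auto simp: bdd_above_def)
  then have "norm (E x 0) \<le> (SUP n. norm (E x n))" by (rule cSUP_upper[OF UNIV_I])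
  then show ?thesis using norm_ge_zero order_trans by blast
qed

lemma nrm_Q_nonneg: "a \<in> S \<Longrightarrow> 0 \<le> nrm Q (cl a)"
proof -
  assume a: "a \<in> S"
  show ?thesis unfolding nrm_Q[OF cl_closed[OF a]]
  proof (rule cINF_greatest)
    show "cl a \<noteq> {}" using cl_self[OF a] by blast
    show "0 \<le> (SUP n. norm (E x n))" if "x \<in> cl a" for x
      using that by (intro SUP_E_nonneg) (simp add: mem_cl_iff a)
  qed
qed

text \<open>Only finitely many entries exceed \<open>t\<close>; replacing them by zero stays in the
  class and gives a representative bounded by \<open>t\<close> throughout.\<close>

lemma nrm_Q_le:
  assumes a: "a \<in> S" and t: "t \<ge> 0" and ev: "\<forall>\<^sub>F n in sequentially. norm (E a n) \<le> t"
  shows "nrm Q (cl a) \<le> t"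
proof -
  define x where "x = (\<lambda>n. if norm (E a n) \<le> t then a n else \<zero>\<^bsub>A n\<^esub>)"
  have E0: "emb (A n) \<zero>\<^bsub>A n\<^esub> = 0" for n using E_zero[of n] by (simp add: E_def)
  have Ex: "E x n = (if norm (E a n) \<le> t then E a n else 0)" for n
    by (simp add: E_def x_def E0)
  have x: "x \<in> S"
    by (rule S_I[where K = t])
      (simp_all add: Ex t, simp add: x_def a S_carrier cstar_algebra.zero_closed[OF cstar])
  have "\<forall>\<^sub>F n in sequentially. E x n - E a n = 0" using ev by eventually_elim (simp add: Ex)
  then have "x \<in> cl a" using x by (simp add: mem_cl_iff a tendsto_eventually)
  moreover have "bdd_below ((\<lambda>x. SUP n. norm (E x n)) ` cl a)"
    by (rule bdd_belowI[of _ 0]) (auto simp: mem_cl_iff a intro: SUP_E_nonneg)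
  ultimately have "nrm Q (cl a) \<le> (SUP n. norm (E x n))"
    unfolding nrm_Q[OF cl_closed[OF a]] by (rule cINF_lower[rotated])
  also have "\<dots> \<le> t" by (rule cSUP_least) (simp_all add: Ex t)
  finally show ?thesis .
qed

text \<open>Some representative has supremum strictly below \<open>t\<close>, and \<open>a\<close>
  differs from it by a null sequence, which eventually fits into the gap.\<close>

lemma nrm_Q_less:
  assumes a: "a \<in> S" and t: "nrm Q (cl a) < t"
  shows "\<forall>\<^sub>F n in sequentially. norm (E a n) < t"
proof -
  have "bdd_below ((\<lambda>x. SUP n. norm (E x n)) ` cl a)"
    by (rule bdd_belowI[of _ 0]) (auto simp: mem_cl_iff a intro: SUP_E_nonneg)
  then obtain x where x: "x \<in> cl a" "(SUP n. norm (E x n)) < t" (is "?s < t")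
    using t cl_self[OF a] unfolding nrm_Q[OF cl_closed[OF a]] by (subst (asm) cINF_less_iff) auto
  have xS: "x \<in> S" and lim: "(\<lambda>n. E x n - E a n) \<longlonglongrightarrow> 0" using x(1) by (simp_all add: mem_cl_iff a)
  have "bdd_above (range (\<lambda>n. norm (E x n)))" using S_bounded[OF xS] by (auto simp: bdd_above_def)
  then have s: "norm (E x n) \<le> ?s" for n by (rule cSUP_upper[OF UNIV_I])
  have "\<forall>\<^sub>F n in sequentially. norm (E x n - E a n) < t - ?s"
    using order_tendstoD(2)[OF tendsto_norm_zero[OF lim], of "t - ?s"] x(2) by simp
  then show ?thesis
  proof eventually_elim
    case (elim n)
    have "norm (E a n) \<le> norm (E x n) + norm (E x n - E a n)"
      by (metis norm_triangle_sub norm_minus_commute)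
    then show ?case using elim s[of n] by linarith
  qed
qed

section \<open>The C*-axioms for classes of sequences\<close>

lemma abelian_group_Q: "abelian_group Q"
proof (rule abelian_groupI)
  note simps = Q_add Q_zero S_closed
  show "X \<oplus>\<^bsub>Q\<^esub> Y \<in> carrier Q" if "X \<in> carrier Q" "Y \<in> carrier Q" for X Y
    using that by (elim Q_cases) (simp add: simps)
  show "\<zero>\<^bsub>Q\<^esub> \<in> carrier Q" by (simp add: simps)
  show "X \<oplus>\<^bsub>Q\<^esub> Y \<oplus>\<^bsub>Q\<^esub> Z = X \<oplus>\<^bsub>Q\<^esub> (Y \<oplus>\<^bsub>Q\<^esub> Z)"
    if "X \<in> carrier Q" "Y \<in> carrier Q" "Z \<in> carrier Q" for X Y Z
    using that by (elim Q_cases) (simp add: simps S_carrier cstar_algebra.add_assoc[OF cstar])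
  show "X \<oplus>\<^bsub>Q\<^esub> Y = Y \<oplus>\<^bsub>Q\<^esub> X" if "X \<in> carrier Q" "Y \<in> carrier Q" for X Y
    using that by (elim Q_cases) (simp add: simps S_carrier cstar_algebra.add_commute[OF cstar])
  show "\<zero>\<^bsub>Q\<^esub> \<oplus>\<^bsub>Q\<^esub> X = X" if "X \<in> carrier Q" for X
    using that by (elim Q_cases) (simp add: simps S_carrier cstar_algebra.add_zero_left[OF cstar])
  show "\<exists>Y\<in>carrier Q. Y \<oplus>\<^bsub>Q\<^esub> X = \<zero>\<^bsub>Q\<^esub>" if X: "X \<in> carrier Q" for X
  proof -
    obtain a where a: "a \<in> S" "X = cl a" by (rule Q_cases[OF X])
    then have "cl (\<lambda>n. \<ominus>\<^bsub>A n\<^esub> a n) \<oplus>\<^bsub>Q\<^esub> X = \<zero>\<^bsub>Q\<^esub>"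
      by (simp add: simps S_carrier cstar_algebra.a_inv_left[OF cstar])
    then show ?thesis by (rule bexI) (simp add: a S_closed)
  qed
qed

lemma Q_a_inv: "a \<in> S \<Longrightarrow> \<ominus>\<^bsub>Q\<^esub> cl a = cl (\<lambda>n. \<ominus>\<^bsub>A n\<^esub> a n)"
  by (rule abelian_group.minus_equality[OF abelian_group_Q])
    (simp_all add: Q_add Q_zero S_closed S_carrier cstar_algebra.a_inv_left[OF cstar])

lemma Q_minus:
  assumes "a \<in> S" "b \<in> S"
  shows "cl a \<ominus>\<^bsub>Q\<^esub> cl b = cl (\<lambda>n. a n \<ominus>\<^bsub>A n\<^esub> b n)"
  unfolding a_minus_def using assms by (simp add: Q_a_inv Q_add S_closed)

lemma module_Q: "Module.module complex_ring Q"
proof (rule Module.moduleI[OF cring_complex_ring abelian_group_Q], unfold complex_ring_simps)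
  note simps = Q_add Q_smult S_closed
  show "c \<odot>\<^bsub>Q\<^esub> X \<in> carrier Q" if "X \<in> carrier Q" for c X
    using that by (elim Q_cases) (simp add: simps)
  show "(c + d) \<odot>\<^bsub>Q\<^esub> X = c \<odot>\<^bsub>Q\<^esub> X \<oplus>\<^bsub>Q\<^esub> d \<odot>\<^bsub>Q\<^esub> X" if "X \<in> carrier Q" for c d X
    using that by (elim Q_cases) (simp add: simps S_carrier cstar_algebra.smult_l_distr'[OF cstar])
  show "c \<odot>\<^bsub>Q\<^esub> (X \<oplus>\<^bsub>Q\<^esub> Y) = c \<odot>\<^bsub>Q\<^esub> X \<oplus>\<^bsub>Q\<^esub> c \<odot>\<^bsub>Q\<^esub> Y" if "X \<in> carrier Q" "Y \<in> carrier Q" for c X Y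
    using that by (elim Q_cases) (simp add: simps S_carrier cstar_algebra.smult_r_distr'[OF cstar])
  show "(c * d) \<odot>\<^bsub>Q\<^esub> X = c \<odot>\<^bsub>Q\<^esub> (d \<odot>\<^bsub>Q\<^esub> X)" if "X \<in> carrier Q" for c d X
    using that by (elim Q_cases) (simp add: simps S_carrier cstar_algebra.smult_assoc'[OF cstar])
  show "1 \<odot>\<^bsub>Q\<^esub> X = X" if "X \<in> carrier Q" for X
    using that by (elim Q_cases) (simp add: simps S_carrier cstar_algebra.smult_one'[OF cstar])
qed

lemma nrm_Q_zero: "nrm Q \<zero>\<^bsub>Q\<^esub> = 0"
  using nrm_Q_le[OF S_zero, of 0] nrm_Q_nonneg[OF S_zero] by (simp add: Q_zero E_simps)

lemma nrm_Q_eq_0: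
  assumes a: "a \<in> S"
  shows "nrm Q (cl a) = 0 \<longleftrightarrow> cl a = \<zero>\<^bsub>Q\<^esub>"
proof
  assume "nrm Q (cl a) = 0"
  then have "\<forall>\<^sub>F n in sequentially. norm (E a n) < e" if "e > 0" for e
    using nrm_Q_less[OF a, of e] that by simp
  then have "(\<lambda>n. E a n) \<longlonglongrightarrow> 0" by (simp add: tendsto_iff)
  then show "cl a = \<zero>\<^bsub>Q\<^esub>" by (simp add: Q_zero cl_eq_iff a S_zero E_simps)
qed (simp add: nrm_Q_zero)

lemma nrm_Q_triangle:
  assumes a: "a \<in> S" and b: "b \<in> S"
  shows "nrm Q (cl a \<oplus>\<^bsub>Q\<^esub> cl b) \<le> nrm Q (cl a) + nrm Q (cl b)"
proof (rule field_le_epsilon)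
  fix e :: real assume e: "e > 0"
  let ?s = "nrm Q (cl a) + e / 2" and ?t = "nrm Q (cl b) + e / 2"
  have "nrm Q (cl (\<lambda>n. a n \<oplus>\<^bsub>A n\<^esub> b n)) \<le> ?s + ?t"
  proof (rule nrm_Q_le)
    have "\<forall>\<^sub>F n in sequentially. norm (E a n) < ?s" "\<forall>\<^sub>F n in sequentially. norm (E b n) < ?t"
      using e by (auto intro: nrm_Q_less a b)
    then show "\<forall>\<^sub>F n in sequentially. norm (E (\<lambda>n. a n \<oplus>\<^bsub>A n\<^esub> b n) n) \<le> ?s + ?t"
      by eventually_elim (simp only: E_add[OF a b] norm_triangle_mono less_imp_le)
    show "0 \<le> ?s + ?t" using nrm_Q_nonneg[OF a] nrm_Q_nonneg[OF b] e by simp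
  qed (simp add: a b S_closed)
  then show "nrm Q (cl a \<oplus>\<^bsub>Q\<^esub> cl b) \<le> nrm Q (cl a) + nrm Q (cl b) + e" by (simp add: Q_add a b)
qed

lemma nrm_Q_mult:
  assumes a: "a \<in> S" and b: "b \<in> S"
  shows "nrm Q (cl a \<otimes>\<^bsub>Q\<^esub> cl b) \<le> nrm Q (cl a) * nrm Q (cl b)"
proof (rule le_mult_of_less)
  fix s t assume st: "nrm Q (cl a) < s" "nrm Q (cl b) < t"
  then have "0 \<le> s" using nrm_Q_nonneg[OF a] by simp
  have "0 \<le> t" using st nrm_Q_nonneg[OF b] by simp
  have "nrm Q (cl (\<lambda>n. a n \<otimes>\<^bsub>A n\<^esub> b n)) \<le> s * t"
  proof (rule nrm_Q_le)
    show "\<forall>\<^sub>F n in sequentially. norm (E (\<lambda>n. a n \<otimes>\<^bsub>A n\<^esub> b n) n) \<le> s * t"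
      using nrm_Q_less[OF a st(1)] nrm_Q_less[OF b st(2)]
    proof eventually_elim
      case (elim n)
      show ?case unfolding E_mult[OF a b]
        by (rule order_trans[OF norm_mult_ineq mult_mono]) (use elim \<open>0 \<le> s\<close> in simp_all)
    qed
  qed (simp_all add: a b S_closed \<open>0 \<le> s\<close> \<open>0 \<le> t\<close>)
  then show "nrm Q (cl a \<otimes>\<^bsub>Q\<^esub> cl b) \<le> s * t" by (simp add: Q_mult a b)
qed

lemma nrm_Q_smult:
  assumes a: "a \<in> S"
  shows "nrm Q (c \<odot>\<^bsub>Q\<^esub> cl a) = cmod c * nrm Q (cl a)"
proof -
  have le: "nrm Q (d \<odot>\<^bsub>Q\<^esub> cl b) \<le> cmod d * nrm Q (cl b)" if b: "b \<in> S" for d b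
  proof (rule le_mult_of_less)
    fix s t assume st: "cmod d < s" "nrm Q (cl b) < t"
    then have "0 \<le> s" "0 \<le> t" using nrm_Q_nonneg[OF b] norm_ge_zero[of d] by linarith+
    have "nrm Q (cl (\<lambda>n. d \<odot>\<^bsub>A n\<^esub> b n)) \<le> s * t"
    proof (rule nrm_Q_le)
      show "\<forall>\<^sub>F n in sequentially. norm (E (\<lambda>n. d \<odot>\<^bsub>A n\<^esub> b n) n) \<le> s * t"
        using nrm_Q_less[OF b st(2)]
        by eventually_elim (simp add: E_smult b norm_scaleC mult_mono st less_imp_le \<open>0 \<le> s\<close>)
    qed (simp_all add: b S_closed \<open>0 \<le> s\<close> \<open>0 \<le> t\<close>)
    then show "nrm Q (d \<odot>\<^bsub>Q\<^esub> cl b) \<le> s * t" by (simp add: Q_smult b)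
  qed
  show ?thesis
  proof (cases "c = 0")
    case True
    then show ?thesis using le[OF a, of 0] nrm_Q_nonneg[OF S_smult[OF a], of 0] by (simp add: Q_smult a)
  next
    case False
    have "inverse c \<odot>\<^bsub>Q\<^esub> cl (\<lambda>n. c \<odot>\<^bsub>A n\<^esub> a n) = cl a"
      using False a by (simp add: Q_smult S_closed S_carrier
          cstar_algebra.smult_assoc'[OF cstar, symmetric] cstar_algebra.smult_one'[OF cstar])
    then have "nrm Q (cl a) \<le> inverse (cmod c) * nrm Q (c \<odot>\<^bsub>Q\<^esub> cl a)"
      using le[OF S_smult[OF a], of "inverse c" c] by (simp add: Q_smult a norm_inverse)
    then have "cmod c * nrm Q (cl a) \<le> nrm Q (c \<odot>\<^bsub>Q\<^esub> cl a)" using False by (simp add: field_simps)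
    then show ?thesis using le[OF a, of c] by simp
  qed
qed

lemma cstar_identity_Q:
  assumes a: "a \<in> S"
  shows "nrm Q (star Q (cl a) \<otimes>\<^bsub>Q\<^esub> cl a) = (nrm Q (cl a))\<^sup>2"
proof (rule antisym)
  let ?b = "\<lambda>n. star (A n) (a n) \<otimes>\<^bsub>A n\<^esub> a n"
  have b: "?b \<in> S" by (simp add: a S_closed)
  have eq: "star Q (cl a) \<otimes>\<^bsub>Q\<^esub> cl a = cl ?b" by (simp add: a Q_star Q_mult S_closed)
  have Eb: "norm (E ?b n) = (norm (E a n))\<^sup>2" for n
    by (simp add: E_mult E_star S_closed a norm_adj_mult)
  show "nrm Q (star Q (cl a) \<otimes>\<^bsub>Q\<^esub> cl a) \<le> (nrm Q (cl a))\<^sup>2"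
    unfolding eq power2_eq_square
  proof (rule le_mult_of_less)
    fix s t assume st: "nrm Q (cl a) < s" "nrm Q (cl a) < t"
    then have "0 \<le> s" "0 \<le> t" using nrm_Q_nonneg[OF a] by linarith+
    show "nrm Q (cl ?b) \<le> s * t"
    proof (rule nrm_Q_le[OF b])
      show "\<forall>\<^sub>F n in sequentially. norm (E ?b n) \<le> s * t"
        using nrm_Q_less[OF a st(1)] nrm_Q_less[OF a st(2)]
        by eventually_elim (simp only: Eb power2_eq_square mult_mono less_imp_le norm_ge_zero \<open>0 \<le> s\<close>)
    qed (simp add: \<open>0 \<le> s\<close> \<open>0 \<le> t\<close>)
  qed
  show "(nrm Q (cl a))\<^sup>2 \<le> nrm Q (star Q (cl a) \<otimes>\<^bsub>Q\<^esub> cl a)"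
    unfolding eq
  proof (rule dense_ge)
    fix s assume s: "nrm Q (cl ?b) < s"
    then have "0 \<le> s" using nrm_Q_nonneg[OF b] by simp
    have "nrm Q (cl a) \<le> sqrt s"
    proof (rule nrm_Q_le[OF a])
      show "\<forall>\<^sub>F n in sequentially. norm (E a n) \<le> sqrt s"
        using nrm_Q_less[OF b s] by eventually_elim (simp add: Eb real_le_rsqrt)
    qed (simp add: \<open>0 \<le> s\<close>)
    then have "(nrm Q (cl a))\<^sup>2 \<le> (sqrt s)\<^sup>2" using nrm_Q_nonneg[OF a] by (rule power_mono)
    then show "(nrm Q (cl a))\<^sup>2 \<le> s" using \<open>0 \<le> s\<close> by simp
  qed
qed

lemma cdist_Q:
  assumes "a \<in> S" "b \<in> S"
  shows "cdist Q (cl a) (cl b) = nrm Q (cl (\<lambda>n. a n \<ominus>\<^bsub>A n\<^esub> b n))"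
  using assms by (simp add: cdist_def Q_minus)

lemma Metric_space_Q: "Metric_space (carrier Q) (cdist Q)"
proof
  show "0 \<le> cdist Q X Y" for X Y
  proof (cases "X \<in> carrier Q \<and> Y \<in> carrier Q")
    case True
    then show ?thesis by (elim conjE Q_cases) (simp add: cdist_Q nrm_Q_nonneg S_minus)
  qed (auto simp: cdist_def)
  show "cdist Q X Y = cdist Q Y X" for X Y
  proof (cases "X \<in> carrier Q \<and> Y \<in> carrier Q")
    case True
    then obtain a b where ab: "a \<in> S" "X = cl a" "b \<in> S" "Y = cl b" by (elim conjE Q_cases) blast
    have eq: "(-1) \<odot>\<^bsub>Q\<^esub> cl (\<lambda>n. a n \<ominus>\<^bsub>A n\<^esub> b n) = cl (\<lambda>n. b n \<ominus>\<^bsub>A n\<^esub> a n)"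
      using ab(1,3) by (simp add: Q_smult S_closed cl_eq_iff E_simps scaleC_minus_left)
    have "nrm Q (cl (\<lambda>n. b n \<ominus>\<^bsub>A n\<^esub> a n)) = nrm Q (cl (\<lambda>n. a n \<ominus>\<^bsub>A n\<^esub> b n))"
      using nrm_Q_smult[OF S_minus[OF ab(1,3)], of "-1"] unfolding eq by simp
    then show ?thesis using ab by (simp add: cdist_Q)
  qed (auto simp: cdist_def)
  show "(cdist Q X Y = 0) = (X = Y)" if XY: "X \<in> carrier Q" "Y \<in> carrier Q" for X Y
  proof -
    obtain a where a: "a \<in> S" "X = cl a" by (rule Q_cases[OF XY(1)])
    obtain b where b: "b \<in> S" "Y = cl b" by (rule Q_cases[OF XY(2)])
    show ?thesis using a b
      by (simp add: cdist_Q nrm_Q_eq_0 S_closed Q_zero cl_eq_iff E_simps)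
  qed
  show "cdist Q X Z \<le> cdist Q X Y + cdist Q Y Z"
    if XYZ: "X \<in> carrier Q" "Y \<in> carrier Q" "Z \<in> carrier Q" for X Y Z
  proof -
    obtain a where a: "a \<in> S" "X = cl a" by (rule Q_cases[OF XYZ(1)])
    obtain b where b: "b \<in> S" "Y = cl b" by (rule Q_cases[OF XYZ(2)])
    obtain c where c: "c \<in> S" "Z = cl c" by (rule Q_cases[OF XYZ(3)])
    have "cl (\<lambda>n. a n \<ominus>\<^bsub>A n\<^esub> c n) = cl (\<lambda>n. a n \<ominus>\<^bsub>A n\<^esub> b n) \<oplus>\<^bsub>Q\<^esub> cl (\<lambda>n. b n \<ominus>\<^bsub>A n\<^esub> c n)"
      using a b c by (simp add: Q_add S_closed cl_eq_iff E_simps)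
    then show ?thesis using a b c nrm_Q_triangle[of "\<lambda>n. a n \<ominus>\<^bsub>A n\<^esub> b n" "\<lambda>n. b n \<ominus>\<^bsub>A n\<^esub> c n"]
      by (simp add: cdist_Q S_closed)
  qed
qed

text \<open>Diagonal argument: pass to a fast Cauchy sequence of representatives \<open>b i\<close>; the \<open>n\<close>-th entry
  of the limit is \<open>b i n\<close> for the largest \<open>i \<le> n\<close> such that \<open>b 0 n, \<dots>, b i n\<close> are as close as
  their classes.\<close>

lemma mcomplete_Q: "Metric_space.mcomplete (carrier Q) (cdist Q)"
proof -
  interpret Metric_space "carrier Q" "cdist Q" by (rule Metric_space_Q)
  show ?thesis
    unfolding mcomplete_def
  proof (intro allI impI)
    fix \<sigma> assume \<sigma>: "MCauchy \<sigma>"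
    then have "range \<sigma> \<subseteq> cl ` S"
      unfolding MCauchy_def carrier_Q[symmetric] by blast
    then have "\<forall>k. \<exists>a. a \<in> S \<and> \<sigma> k = cl a" by blast
    then obtain a where a: "\<And>k. a k \<in> S" "\<And>k. \<sigma> k = cl (a k)" by metis
    have "\<exists>N. \<forall>j k. N \<le> j \<longrightarrow> N \<le> k \<longrightarrow> cdist Q (\<sigma> j) (\<sigma> k) < (1/2) ^ i" for i :: nat
      using \<sigma> unfolding MCauchy_def by simp
    then obtain K where K: "\<And>i j k. K i \<le> j \<Longrightarrow> K i \<le> k \<Longrightarrow> cdist Q (\<sigma> j) (\<sigma> k) < (1/2) ^ i" by metis
    \<comment> \<open>Partial sums give an index that is at least \<open>K j\<close> for all
      \<open>j \<le> i\<close>, so that one choice of representatives serves all the earlier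
      tolerances.\<close>
    define K' where "K' i = (\<Sum>j\<le>i. K j)" for i
    have K': "K i \<le> K' j" if "i \<le> j" for i j
      unfolding K'_def using that by (intro member_le_sum) simp_all
    define b where "b i = a (K' i)" for i
    have b: "b i \<in> S" for i by (simp add: b_def a)
    define close where "close i n \<longleftrightarrow> (\<forall>j\<le>i. norm (E (b j) n - E (b i) n) < (1/2) ^ j)" for i n
    have ev: "\<forall>\<^sub>F n in sequentially. close i n" for i
    proof -
      have "\<forall>\<^sub>F n in sequentially. norm (E (b j) n - E (b i) n) < (1/2) ^ j" if "j \<le> i" for j
      proof -
        have "nrm Q (cl (\<lambda>n. b j n \<ominus>\<^bsub>A n\<^esub> b i n)) < (1/2) ^ j"
          using K[of j "K' j" "K' i"] K'[of j j] K'[OF that] b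
          by (simp add: a(2) b_def[symmetric] cdist_Q)
        then show ?thesis using nrm_Q_less[OF S_minus[OF b b]] by (simp add: E_simps b)
      qed
      then have "\<forall>\<^sub>F n in sequentially. \<forall>j\<in>{..i}. norm (E (b j) n - E (b i) n) < (1/2) ^ j"
        by (intro eventually_ball_finite) auto
      then show ?thesis by eventually_elim (simp add: close_def)
    qed
    define m where "m n = (GREATEST i. i \<le> n \<and> close i n)" for n
    have m_ge: "i \<le> m n" and m_close: "close (m n) n" if "i \<le> n" "close i n" for i n
    proof -
      show "i \<le> m n" unfolding m_def by (rule Greatest_le_nat[where b = n]) (use that in auto)
      have "m n \<le> n \<and> close (m n) n" unfolding m_def by (rule GreatestI_nat[where b = n]) (use that in auto)
      then show "close (m n) n" ..
    qed
    define c where "c n = b (m n) n" for n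
    have Ec: "E c n = E (b (m n)) n" for n by (simp add: E_def c_def)
    have c_close: "norm (E (b i) n - E c n) < (1/2) ^ i" if "i \<le> n" "close i n" for i n
      using m_ge[OF that] m_close[OF that] by (simp add: Ec close_def)
    \<comment> \<open>For \<open>i = 0\<close> closeness compares \<open>b 0\<close> with itself.
      Thus every entry of \<open>c\<close> is within \<open>1\<close> of that of \<open>b 0\<close>,
      whence the bound \<open>L + 1\<close>.\<close>
    have close0: "close 0 n" for n by (simp add: close_def)
    obtain L where L: "\<And>n. norm (E (b 0) n) \<le> L" using S_bounded[OF b] by blast
    have c: "c \<in> S"
    proof (rule S_I[where K = "L + 1"])
      show "c n \<in> carrier (A n)" for n by (simp add: c_def S_carrier b)
      show "norm (E c n) \<le> L + 1" for n
        using c_close[OF _ close0, of n] L[of n] norm_triangle_sub[of "E c n" "E (b 0) n"]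
        by (simp add: norm_minus_commute)
    qed
    have bc: "cdist Q (cl (b i)) (cl c) \<le> (1/2) ^ i" for i
      unfolding cdist_Q[OF b c]
    proof (rule nrm_Q_le)
      show "\<forall>\<^sub>F n in sequentially. norm (E (\<lambda>n. b i n \<ominus>\<^bsub>A n\<^esub> c n) n) \<le> (1/2) ^ i"
        using ev[of i] eventually_ge_at_top[of i]
        by eventually_elim (simp add: E_minus b c c_close less_imp_le)
    qed (simp_all add: b c S_closed)
    have "limitin mtopology \<sigma> (cl c) sequentially"
      unfolding limit_metric_sequentially
    proof (intro conjI allI impI)
      show "cl c \<in> carrier Q" by (simp add: c)
      fix e :: real assume "e > 0"
      then obtain i where i: "(1/2::real) ^ i < e / 2" using real_arch_pow_inv[of "e/2" "1/2"] by auto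
      have "cdist Q (\<sigma> k) (cl c) < e" if "k \<ge> K' i" for k
      proof -
        have "cdist Q (\<sigma> k) (cl c) \<le> cdist Q (\<sigma> k) (cl (b i)) + cdist Q (cl (b i)) (cl c)"
          by (rule triangle) (simp_all add: a b c)
        moreover have "cdist Q (\<sigma> k) (cl (b i)) < (1/2) ^ i"
          using K[of i k "K' i"] K'[of i i] that by (simp add: a(2) b_def)
        ultimately show ?thesis using bc[of i] i by simp
      qed
      then show "\<exists>N. \<forall>n\<ge>N. \<sigma> n \<in> carrier Q \<and> cdist Q (\<sigma> n) (cl c) < e"
        by (intro exI[of _ "K' i"]) (simp add: a)
    qed
    then show "\<exists>x. limitin mtopology \<sigma> x sequentially" by blast
  qed
qed

theorem cstar_algebra_Q: "cstar_algebra Q"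
proof -
  note simps = Q_add Q_mult Q_smult Q_star S_closed S_carrier
  show ?thesis
  proof (intro cstar_algebra.intro cstar_algebra_axioms.intro module_Q)
    show "X \<otimes>\<^bsub>Q\<^esub> Y \<in> carrier Q" if "X \<in> carrier Q" "Y \<in> carrier Q" for X Y
      using that by (elim Q_cases) (simp add: simps)
    show "X \<otimes>\<^bsub>Q\<^esub> Y \<otimes>\<^bsub>Q\<^esub> Z = X \<otimes>\<^bsub>Q\<^esub> (Y \<otimes>\<^bsub>Q\<^esub> Z)"
      if "X \<in> carrier Q" "Y \<in> carrier Q" "Z \<in> carrier Q" for X Y Z
      using that by (elim Q_cases) (simp add: simps cstar_algebra.mult_assoc[OF cstar])
    show "(X \<oplus>\<^bsub>Q\<^esub> Y) \<otimes>\<^bsub>Q\<^esub> Z = X \<otimes>\<^bsub>Q\<^esub> Z \<oplus>\<^bsub>Q\<^esub> Y \<otimes>\<^bsub>Q\<^esub> Z"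
      if "X \<in> carrier Q" "Y \<in> carrier Q" "Z \<in> carrier Q" for X Y Z
      using that by (elim Q_cases) (simp add: simps cstar_algebra.distrib_right[OF cstar])
    show "Z \<otimes>\<^bsub>Q\<^esub> (X \<oplus>\<^bsub>Q\<^esub> Y) = Z \<otimes>\<^bsub>Q\<^esub> X \<oplus>\<^bsub>Q\<^esub> Z \<otimes>\<^bsub>Q\<^esub> Y"
      if "X \<in> carrier Q" "Y \<in> carrier Q" "Z \<in> carrier Q" for X Y Z
      using that by (elim Q_cases) (simp add: simps cstar_algebra.distrib_left[OF cstar])
    show "(c \<odot>\<^bsub>Q\<^esub> X) \<otimes>\<^bsub>Q\<^esub> Y = c \<odot>\<^bsub>Q\<^esub> (X \<otimes>\<^bsub>Q\<^esub> Y)" if "X \<in> carrier Q" "Y \<in> carrier Q" for X Y c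
      using that by (elim Q_cases) (simp add: simps cstar_algebra.smult_mult_left[OF cstar])
    show "X \<otimes>\<^bsub>Q\<^esub> (c \<odot>\<^bsub>Q\<^esub> Y) = c \<odot>\<^bsub>Q\<^esub> (X \<otimes>\<^bsub>Q\<^esub> Y)" if "X \<in> carrier Q" "Y \<in> carrier Q" for X Y c
      using that by (elim Q_cases) (simp add: simps cstar_algebra.smult_mult_right[OF cstar])
    show "star Q X \<in> carrier Q" if "X \<in> carrier Q" for X
      using that by (elim Q_cases) (simp add: simps)
    show "star Q (X \<oplus>\<^bsub>Q\<^esub> Y) = star Q X \<oplus>\<^bsub>Q\<^esub> star Q Y" if "X \<in> carrier Q" "Y \<in> carrier Q" for X Y
      using that by (elim Q_cases) (simp add: simps cstar_algebra.star_add[OF cstar])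
    show "star Q (c \<odot>\<^bsub>Q\<^esub> X) = cnj c \<odot>\<^bsub>Q\<^esub> star Q X" if "X \<in> carrier Q" for X c
      using that by (elim Q_cases) (simp add: simps cstar_algebra.star_smult[OF cstar])
    show "star Q (X \<otimes>\<^bsub>Q\<^esub> Y) = star Q Y \<otimes>\<^bsub>Q\<^esub> star Q X" if "X \<in> carrier Q" "Y \<in> carrier Q" for X Y
      using that by (elim Q_cases) (simp add: simps cstar_algebra.star_mult[OF cstar])
    show "star Q (star Q X) = X" if "X \<in> carrier Q" for X
      using that by (elim Q_cases) (simp add: simps cstar_algebra.star_star[OF cstar])
    show "0 \<le> nrm Q X" if "X \<in> carrier Q" for X
      using that by (elim Q_cases) (simp add: nrm_Q_nonneg)
    show "nrm Q X = 0 \<longleftrightarrow> X = \<zero>\<^bsub>Q\<^esub>" if "X \<in> carrier Q" for X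
      using that by (elim Q_cases) (simp add: nrm_Q_eq_0)
    show "nrm Q (X \<oplus>\<^bsub>Q\<^esub> Y) \<le> nrm Q X + nrm Q Y" if "X \<in> carrier Q" "Y \<in> carrier Q" for X Y
      using that by (elim Q_cases) (simp only: nrm_Q_triangle)
    show "nrm Q (c \<odot>\<^bsub>Q\<^esub> X) = cmod c * nrm Q X" if "X \<in> carrier Q" for X c
      using that by (elim Q_cases) (simp only: nrm_Q_smult)
    show "nrm Q (X \<otimes>\<^bsub>Q\<^esub> Y) \<le> nrm Q X * nrm Q Y" if "X \<in> carrier Q" "Y \<in> carrier Q" for X Y
      using that by (elim Q_cases) (simp only: nrm_Q_mult)
    show "nrm Q (star Q X \<otimes>\<^bsub>Q\<^esub> X) = (nrm Q X)\<^sup>2" if "X \<in> carrier Q" for X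
      using that by (elim Q_cases) (simp only: cstar_identity_Q)
    show "Metric_space.mcomplete (carrier Q) (cdist Q)" by (rule mcomplete_Q)
  qed
qed

end

section \<open>Uniqueness of the C*-norm\<close>

context cstar_algebra
begin

text \<open>The root is found in the product of all C*-algebras on the type; its component at
  \<open>A\<close> satisfies the same equation.\<close>

lemma nrm_le_1_iff:
  assumes x: "x \<in> carrier A"
  shows "nrm A x \<le> 1 \<longleftrightarrow> (\<exists>y\<in>carrier A. star A y = y \<and> y \<oplus> y = star A x \<otimes> x \<oplus> y \<otimes> y)"
proof
  assume "nrm A x \<le> 1"
  then obtain Y where Y: "adj Y = Y" "Y + Y = adj (emb A x) * emb A x + Y * Y"
    using norm_le_1_iff[of "emb A x"] by (auto simp: norm_emb x)
  let ?y = "component Y A"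
  have "star A ?y = ?y" using arg_cong[OF Y(1), of "\<lambda>F. component F A"] cstar_algebra_axioms by simp
  moreover have "?y \<oplus> ?y = star A x \<otimes> x \<oplus> ?y \<otimes> ?y"
    using arg_cong[OF Y(2), of "\<lambda>F. component F A"] cstar_algebra_axioms x by simp
  moreover have "?y \<in> carrier A" using cstar_algebra_axioms by simp
  ultimately show "\<exists>y\<in>carrier A. star A y = y \<and> y \<oplus> y = star A x \<otimes> x \<oplus> y \<otimes> y" by blast
next
  assume "\<exists>y\<in>carrier A. star A y = y \<and> y \<oplus> y = star A x \<otimes> x \<oplus> y \<otimes> y"
  then obtain y where y: "y \<in> carrier A" "star A y = y" "y \<oplus> y = star A x \<otimes> x \<oplus> y \<otimes> y" by blast
  have "adj (emb A y) = emb A y" using y(1,2) by (simp flip: emb_star)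
  moreover have "emb A y + emb A y = adj (emb A x) * emb A x + emb A y * emb A y"
    using arg_cong[OF y(3), of "emb A"] y(1) x by (simp add: emb_simps mult_closed star_closed)
  ultimately have "norm (emb A x) \<le> 1" unfolding norm_le_1_iff by blast
  then show "nrm A x \<le> 1" by (simp add: norm_emb x)
qed

text \<open>Bounds each entry of a matrix \<open>D\<close> by the diagonal of \<open>D* D\<close>.
  This is what keeps entrywise chosen square roots bounded along a sequence.\<close>

lemma nrm_adj_add_le:
  assumes "x \<in> carrier A" "y \<in> carrier A"
  shows "(nrm A x)\<^sup>2 \<le> nrm A (star A x \<otimes> x \<oplus> star A y \<otimes> y)"
proof -
  have "nrm A (star A x \<otimes> x \<oplus> star A y \<otimes> y) = norm (adj (emb A x) * emb A x + adj (emb A y) * emb A y)"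
    using assms by (simp add: emb_simps mult_closed star_closed add_closed flip: norm_emb)
  moreover have "(nrm A x)\<^sup>2 = norm (adj (emb A x) * emb A x)"
    using assms by (simp add: norm_adj_mult norm_emb)
  ultimately show ?thesis
    by (simp only: nonunital_norm_pos_add nonunital_pos_adj_mult)
qed

lemma pos_component:
  assumes "pos F"
  obtains v where "v \<in> carrier A" "component F A = star A v \<otimes> v"
proof -
  obtain h where h: "adj h = h" "F = h * h" using assms by (auto simp: pos_def)
  have "component F A = component (adj h * h) A" by (simp only: h)
  also have "\<dots> = star A (component h A) \<otimes> component h A" using cstar_algebra_axioms by simp
  finally show thesis using that cstar_algebra_axioms component_closed by blast
qed

end

text \<open>The equation that characterizes the unit ball in \<open>nrm_le_1_iff\<close> is
  preserved by \<open>f\<close>, and scaling by \<open>1 / s\<close> with \<open>s\<close> above the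
  norm of \<open>x\<close> leads into that ball. Applied in both directions to a bijection, this is
  uniqueness of the C*-norm.\<close>

lemma star_hom_contractive:
  assumes A: "cstar_algebra A" and B: "cstar_algebra B"
    and f: "\<And>x. x \<in> carrier A \<Longrightarrow> f x \<in> carrier B"
    and add: "\<And>x y. x \<in> carrier A \<Longrightarrow> y \<in> carrier A \<Longrightarrow> f (x \<oplus>\<^bsub>A\<^esub> y) = f x \<oplus>\<^bsub>B\<^esub> f y"
    and smult: "\<And>c x. x \<in> carrier A \<Longrightarrow> f (c \<odot>\<^bsub>A\<^esub> x) = c \<odot>\<^bsub>B\<^esub> f x"
    and mult: "\<And>x y. x \<in> carrier A \<Longrightarrow> y \<in> carrier A \<Longrightarrow> f (x \<otimes>\<^bsub>A\<^esub> y) = f x \<otimes>\<^bsub>B\<^esub> f y"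
    and star: "\<And>x. x \<in> carrier A \<Longrightarrow> f (star A x) = star B (f x)"
    and x: "x \<in> carrier A"
  shows "nrm B (f x) \<le> nrm A x"
proof (rule dense_ge)
  interpret A: cstar_algebra A by (rule A)
  interpret B: cstar_algebra B by (rule B)
  have unit: "nrm B (f z) \<le> 1" if z: "z \<in> carrier A" "nrm A z \<le> 1" for z
  proof -
    obtain y where y: "y \<in> carrier A" "star A y = y" "y \<oplus>\<^bsub>A\<^esub> y = star A z \<otimes>\<^bsub>A\<^esub> z \<oplus>\<^bsub>A\<^esub> y \<otimes>\<^bsub>A\<^esub> y"
      using z by (auto simp: A.nrm_le_1_iff)
    have "star B (f y) = f y" using star[OF y(1)] y(2) by simp
    moreover have "f y \<oplus>\<^bsub>B\<^esub> f y = star B (f z) \<otimes>\<^bsub>B\<^esub> f z \<oplus>\<^bsub>B\<^esub> f y \<otimes>\<^bsub>B\<^esub> f y"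
      using arg_cong[OF y(3), of f] y(1) z(1)
      by (simp add: add mult star A.mult_closed A.star_closed)
    ultimately show ?thesis using f[OF y(1)] f[OF z(1)] B.nrm_le_1_iff by blast
  qed
  fix s assume s: "nrm A x < s"
  then have "s > 0" using A.nrm_nonneg[OF x] by simp
  let ?z = "complex_of_real (1 / s) \<odot>\<^bsub>A\<^esub> x"
  have "nrm A ?z = nrm A x / s" using \<open>s > 0\<close> x by (simp add: A.nrm_smult norm_divide)
  then have "nrm A ?z \<le> 1" using s \<open>s > 0\<close> by simp
  then have "nrm B (f ?z) \<le> 1" by (intro unit A.smult_closed' x)
  moreover have "nrm B (f ?z) = nrm B (f x) / s"
    using \<open>s > 0\<close> x f[OF x] by (simp add: smult B.nrm_smult norm_divide)
  ultimately have "nrm B (f x) / s \<le> 1" by simp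
  then show "nrm B (f x) \<le> s" using \<open>s > 0\<close> by (simp only: pos_divide_le_eq mult_1)
qed

text \<open>Needed for the bijection of an algebra with its 1 by 1 matrices: it supplies a C*-norm
  there, hence a witness for the choice in \<open>matrix_algebra\<close>.\<close>

lemma cstar_algebra_transport:
  assumes A: "cstar_algebra A"
    and inj: "inj_on f (carrier A)" and carrier: "carrier B = f ` carrier A"
    and zero: "\<zero>\<^bsub>B\<^esub> = f \<zero>\<^bsub>A\<^esub>"
    and add: "\<And>x y. x \<in> carrier A \<Longrightarrow> y \<in> carrier A \<Longrightarrow> f x \<oplus>\<^bsub>B\<^esub> f y = f (x \<oplus>\<^bsub>A\<^esub> y)"
    and smult: "\<And>c x. x \<in> carrier A \<Longrightarrow> c \<odot>\<^bsub>B\<^esub> f x = f (c \<odot>\<^bsub>A\<^esub> x)"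
    and mult: "\<And>x y. x \<in> carrier A \<Longrightarrow> y \<in> carrier A \<Longrightarrow> f x \<otimes>\<^bsub>B\<^esub> f y = f (x \<otimes>\<^bsub>A\<^esub> y)"
    and star: "\<And>x. x \<in> carrier A \<Longrightarrow> star B (f x) = f (star A x)"
    and nrm: "\<And>x. x \<in> carrier A \<Longrightarrow> nrm B (f x) = nrm A x"
  shows "cstar_algebra B"
proof -
  interpret A: cstar_algebra A by (rule A)
  have cases: thesis if X: "X \<in> carrier B" and "\<And>x. x \<in> carrier A \<Longrightarrow> X = f x \<Longrightarrow> thesis" for X thesis
    using X that(2) unfolding carrier by (rule imageE)
  note ops = zero add smult mult star nrm A.add_closed A.smult_closed' A.mult_closed A.star_closed A.zero_closed
  have closed: "f x \<in> carrier B" if "x \<in> carrier A" for x using that by (simp add: carrier)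
  have group: "abelian_group B"
  proof (rule abelian_groupI)
    show "X \<oplus>\<^bsub>B\<^esub> Y \<in> carrier B" if "X \<in> carrier B" "Y \<in> carrier B" for X Y
      using that by (elim cases) (simp add: ops closed)
    show "\<zero>\<^bsub>B\<^esub> \<in> carrier B" by (simp add: ops closed)
    show "X \<oplus>\<^bsub>B\<^esub> Y \<oplus>\<^bsub>B\<^esub> Z = X \<oplus>\<^bsub>B\<^esub> (Y \<oplus>\<^bsub>B\<^esub> Z)"
      if "X \<in> carrier B" "Y \<in> carrier B" "Z \<in> carrier B" for X Y Z
      using that by (elim cases) (simp add: ops A.add_assoc)
    show "X \<oplus>\<^bsub>B\<^esub> Y = Y \<oplus>\<^bsub>B\<^esub> X" if "X \<in> carrier B" "Y \<in> carrier B" for X Y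
      using that by (elim cases) (simp add: ops A.add_commute)
    show "\<zero>\<^bsub>B\<^esub> \<oplus>\<^bsub>B\<^esub> X = X" if "X \<in> carrier B" for X
      using that by (elim cases) (simp add: ops)
    show "\<exists>Y\<in>carrier B. Y \<oplus>\<^bsub>B\<^esub> X = \<zero>\<^bsub>B\<^esub>" if X: "X \<in> carrier B" for X
    proof -
      obtain x where x: "x \<in> carrier A" "X = f x" by (rule cases[OF X])
      then have "f (\<ominus>\<^bsub>A\<^esub> x) \<oplus>\<^bsub>B\<^esub> X = \<zero>\<^bsub>B\<^esub>" by (simp add: ops A.a_inv_closed A.a_inv_left)
      then show ?thesis by (rule bexI) (simp add: closed A.a_inv_closed x)
    qed
  qed
  have minus: "f x \<ominus>\<^bsub>B\<^esub> f y = f (x \<ominus>\<^bsub>A\<^esub> y)" if "x \<in> carrier A" "y \<in> carrier A" for x y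
  proof -
    have "\<ominus>\<^bsub>B\<^esub> f y = f (\<ominus>\<^bsub>A\<^esub> y)"
      by (rule abelian_group.minus_equality[OF group])
        (simp_all add: that closed ops A.a_inv_closed A.a_inv_left)
    then show ?thesis by (simp add: a_minus_def that ops A.a_inv_closed)
  qed
  have cdist: "cdist B (f x) (f y) = cdist A x y" if "x \<in> carrier A" "y \<in> carrier A" for x y
    by (simp add: cdist_def that closed minus nrm A.minus_closed)
  have module: "Module.module complex_ring B"
  proof (rule Module.moduleI[OF cring_complex_ring group], unfold complex_ring_simps)
    show "c \<odot>\<^bsub>B\<^esub> X \<in> carrier B" if "X \<in> carrier B" for c X
      using that by (elim cases) (simp add: ops closed)
    show "(c + d) \<odot>\<^bsub>B\<^esub> X = c \<odot>\<^bsub>B\<^esub> X \<oplus>\<^bsub>B\<^esub> d \<odot>\<^bsub>B\<^esub> X" if "X \<in> carrier B" for c d X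
      using that by (elim cases) (simp add: ops A.smult_l_distr')
    show "c \<odot>\<^bsub>B\<^esub> (X \<oplus>\<^bsub>B\<^esub> Y) = c \<odot>\<^bsub>B\<^esub> X \<oplus>\<^bsub>B\<^esub> c \<odot>\<^bsub>B\<^esub> Y" if "X \<in> carrier B" "Y \<in> carrier B" for c X Y
      using that by (elim cases) (simp add: ops A.smult_r_distr')
    show "(c * d) \<odot>\<^bsub>B\<^esub> X = c \<odot>\<^bsub>B\<^esub> (d \<odot>\<^bsub>B\<^esub> X)" if "X \<in> carrier B" for c d X
      using that by (elim cases) (simp add: ops A.smult_assoc')
    show "1 \<odot>\<^bsub>B\<^esub> X = X" if "X \<in> carrier B" for X
      using that by (elim cases) (simp add: ops A.smult_one')
  qed
  have metric: "Metric_space (carrier B) (cdist B)"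
  proof -
    interpret M: Metric_space "carrier A" "cdist A" by (rule A.Metric_space)
    show ?thesis
    proof
      show "0 \<le> cdist B X Y" for X Y
      proof (cases "X \<in> carrier B \<and> Y \<in> carrier B")
        case True
        then show ?thesis by (elim conjE cases) (simp add: cdist)
      qed (auto simp: cdist_def)
      show "cdist B X Y = cdist B Y X" for X Y
      proof (cases "X \<in> carrier B \<and> Y \<in> carrier B")
        case True
        then show ?thesis by (elim conjE cases) (simp add: cdist M.commute)
      qed (auto simp: cdist_def)
      show "(cdist B X Y = 0) = (X = Y)" if "X \<in> carrier B" "Y \<in> carrier B" for X Y
        using that by (elim cases) (simp add: cdist inj_on_eq_iff[OF inj])
      show "cdist B X Z \<le> cdist B X Y + cdist B Y Z"
        if "X \<in> carrier B" "Y \<in> carrier B" "Z \<in> carrier B" for X Y Z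
        using that by (elim cases) (simp add: cdist M.triangle)
    qed
  qed
  have complete: "Metric_space.mcomplete (carrier B) (cdist B)"
  proof -
    interpret Metric_space "carrier B" "cdist B" by (rule metric)
    show ?thesis unfolding mcomplete_def
    proof (intro allI impI)
      fix \<sigma> assume \<sigma>: "MCauchy \<sigma>"
      then have "range \<sigma> \<subseteq> carrier B" by (simp add: MCauchy_def)
      then have "\<forall>n. \<exists>x. x \<in> carrier A \<and> \<sigma> n = f x" unfolding carrier by blast
      then obtain \<tau> where \<tau>: "\<And>n. \<tau> n \<in> carrier A" "\<And>n. \<sigma> n = f (\<tau> n)" by metis
      have "\<exists>x\<in>carrier A. \<forall>\<epsilon>>0. \<exists>N. \<forall>n\<ge>N. nrm A (\<tau> n \<ominus>\<^bsub>A\<^esub> x) < \<epsilon>"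
      proof (rule A.Cauchy_imp_limit[OF \<tau>(1)])
        show "\<exists>N. \<forall>m\<ge>N. \<forall>n\<ge>N. nrm A (\<tau> m \<ominus>\<^bsub>A\<^esub> \<tau> n) < \<epsilon>" if "\<epsilon> > 0" for \<epsilon>
          using \<sigma> that unfolding MCauchy_def \<tau>(2) cdist[OF \<tau>(1) \<tau>(1)] by (simp add: cdist_def \<tau>(1))
      qed
      then obtain x where x: "x \<in> carrier A" "\<forall>\<epsilon>>0. \<exists>N. \<forall>n\<ge>N. nrm A (\<tau> n \<ominus>\<^bsub>A\<^esub> x) < \<epsilon>" by blast
      then have "limitin mtopology \<sigma> (f x) sequentially"
        unfolding limit_metric_sequentially \<tau>(2) using \<tau>(1)
        by (simp add: closed cdist) (simp add: cdist_def)
      then show "\<exists>X. limitin mtopology \<sigma> X sequentially" by blast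
    qed
  qed
  show ?thesis
  proof (intro cstar_algebra.intro cstar_algebra_axioms.intro module)
    show "X \<otimes>\<^bsub>B\<^esub> Y \<in> carrier B" if "X \<in> carrier B" "Y \<in> carrier B" for X Y
      using that by (elim cases) (simp add: ops closed)
    show "X \<otimes>\<^bsub>B\<^esub> Y \<otimes>\<^bsub>B\<^esub> Z = X \<otimes>\<^bsub>B\<^esub> (Y \<otimes>\<^bsub>B\<^esub> Z)"
      if "X \<in> carrier B" "Y \<in> carrier B" "Z \<in> carrier B" for X Y Z
      using that by (elim cases) (simp add: ops A.mult_assoc)
    show "(X \<oplus>\<^bsub>B\<^esub> Y) \<otimes>\<^bsub>B\<^esub> Z = X \<otimes>\<^bsub>B\<^esub> Z \<oplus>\<^bsub>B\<^esub> Y \<otimes>\<^bsub>B\<^esub> Z"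
      if "X \<in> carrier B" "Y \<in> carrier B" "Z \<in> carrier B" for X Y Z
      using that by (elim cases) (simp add: ops A.distrib_right)
    show "Z \<otimes>\<^bsub>B\<^esub> (X \<oplus>\<^bsub>B\<^esub> Y) = Z \<otimes>\<^bsub>B\<^esub> X \<oplus>\<^bsub>B\<^esub> Z \<otimes>\<^bsub>B\<^esub> Y"
      if "X \<in> carrier B" "Y \<in> carrier B" "Z \<in> carrier B" for X Y Z
      using that by (elim cases) (simp add: ops A.distrib_left)
    show "(c \<odot>\<^bsub>B\<^esub> X) \<otimes>\<^bsub>B\<^esub> Y = c \<odot>\<^bsub>B\<^esub> (X \<otimes>\<^bsub>B\<^esub> Y)" if "X \<in> carrier B" "Y \<in> carrier B" for X Y c
      using that by (elim cases) (simp add: ops A.smult_mult_left)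
    show "X \<otimes>\<^bsub>B\<^esub> (c \<odot>\<^bsub>B\<^esub> Y) = c \<odot>\<^bsub>B\<^esub> (X \<otimes>\<^bsub>B\<^esub> Y)" if "X \<in> carrier B" "Y \<in> carrier B" for X Y c
      using that by (elim cases) (simp add: ops A.smult_mult_right)
    show "star B X \<in> carrier B" if "X \<in> carrier B" for X
      using that by (elim cases) (simp add: ops closed)
    show "star B (X \<oplus>\<^bsub>B\<^esub> Y) = star B X \<oplus>\<^bsub>B\<^esub> star B Y" if "X \<in> carrier B" "Y \<in> carrier B" for X Y
      using that by (elim cases) (simp add: ops A.star_add)
    show "star B (c \<odot>\<^bsub>B\<^esub> X) = cnj c \<odot>\<^bsub>B\<^esub> star B X" if "X \<in> carrier B" for X c
      using that by (elim cases) (simp add: ops A.star_smult)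
    show "star B (X \<otimes>\<^bsub>B\<^esub> Y) = star B Y \<otimes>\<^bsub>B\<^esub> star B X" if "X \<in> carrier B" "Y \<in> carrier B" for X Y
      using that by (elim cases) (simp add: ops A.star_mult)
    show "star B (star B X) = X" if "X \<in> carrier B" for X
      using that by (elim cases) (simp add: ops A.star_star)
    show "0 \<le> nrm B X" if "X \<in> carrier B" for X
      using that by (elim cases) (simp add: ops A.nrm_nonneg)
    show "nrm B X = 0 \<longleftrightarrow> X = \<zero>\<^bsub>B\<^esub>" if "X \<in> carrier B" for X
      using that by (elim cases) (simp add: ops A.nrm_eq_0_iff inj_on_eq_iff[OF inj])
    show "nrm B (X \<oplus>\<^bsub>B\<^esub> Y) \<le> nrm B X + nrm B Y" if "X \<in> carrier B" "Y \<in> carrier B" for X Y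
      using that by (elim cases) (simp add: ops A.nrm_triangle)
    show "nrm B (c \<odot>\<^bsub>B\<^esub> X) = cmod c * nrm B X" if "X \<in> carrier B" for X c
      using that by (elim cases) (simp add: ops A.nrm_smult)
    show "nrm B (X \<otimes>\<^bsub>B\<^esub> Y) \<le> nrm B X * nrm B Y" if "X \<in> carrier B" "Y \<in> carrier B" for X Y
      using that by (elim cases) (simp add: ops A.nrm_mult)
    show "nrm B (star B X \<otimes>\<^bsub>B\<^esub> X) = (nrm B X)\<^sup>2" if "X \<in> carrier B" for X
      using that by (elim cases) (simp add: ops A.cstar_identity)
    show "Metric_space.mcomplete (carrier B) (cdist B)" by (rule complete)
  qed
qed

section \<open>Matrices of size one and the norm of the algebra itself\<close>

definition mat_1x1 :: "'a \<Rightarrow> 'a mat" where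
  "mat_1x1 x = mat (Suc 0) (Suc 0) (\<lambda>_. x)"

lemma matrices_over_1: "matrices_over (Suc 0) X = mat_1x1 ` X"
proof (intro equalityI subsetI)
  fix M assume M: "M \<in> matrices_over (Suc 0) X"
  then have dim: "M \<in> carrier_mat (Suc 0) (Suc 0)" and el: "elements_mat M \<subseteq> X" by (auto simp: matrices_over_def)
  have "M = mat_1x1 (M $$ (0,0))" using dim by (intro eq_matI) (auto simp: mat_1x1_def)
  moreover have "M $$ (0,0) \<in> X" using el dim by (auto simp: elements_mat_def)
  ultimately show "M \<in> mat_1x1 ` X" by blast
qed (auto simp: mat_1x1_def matrices_over_def elements_mat_def)

lemma mat_1x1_simps:
  assumes "cstar_algebra A"
  shows "x \<in> carrier A \<Longrightarrow> y \<in> carrier A \<Longrightarrow>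
      mat_1x1 x \<otimes>\<^bsub>matrix_star_algebra A (Suc 0) N\<^esub> mat_1x1 y = mat_1x1 (x \<otimes>\<^bsub>A\<^esub> y)"
    and "mat_1x1 x \<oplus>\<^bsub>matrix_star_algebra A (Suc 0) N\<^esub> mat_1x1 y = mat_1x1 (x \<oplus>\<^bsub>A\<^esub> y)"
    and "c \<odot>\<^bsub>matrix_star_algebra A (Suc 0) N\<^esub> mat_1x1 x = mat_1x1 (c \<odot>\<^bsub>A\<^esub> x)"
    and "star (matrix_star_algebra A (Suc 0) N) (mat_1x1 x) = mat_1x1 (star A x)"
    and "\<zero>\<^bsub>matrix_star_algebra A (Suc 0) N\<^esub> = mat_1x1 \<zero>\<^bsub>A\<^esub>"
    and "carrier (matrix_star_algebra A (Suc 0) N) = mat_1x1 ` carrier A"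
    and "nrm (matrix_star_algebra A (Suc 0) N) M = N M"
proof -
  interpret cstar_algebra A by (rule assms)
  have "(\<Oplus>\<^bsub>A\<^esub>k\<in>{..<Suc 0}. f k) = f 0" if "f 0 \<in> carrier A" for f
    using that M.finsum_insert[of "{}" "0::nat" f] by (simp add: lessThan_Suc)
  then show "x \<in> carrier A \<Longrightarrow> y \<in> carrier A \<Longrightarrow>
      mat_1x1 x \<otimes>\<^bsub>matrix_star_algebra A (Suc 0) N\<^esub> mat_1x1 y = mat_1x1 (x \<otimes>\<^bsub>A\<^esub> y)"
    by (intro eq_matI) (auto simp: matrix_star_algebra_def mat_1x1_def mult_closed)
qed (auto simp: matrix_star_algebra_def mat_1x1_def matrices_over_1[unfolded mat_1x1_def[abs_def]]
    intro!: eq_matI)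

lemma index_mat_1x1 [simp]: "mat_1x1 x $$ (0, 0) = x"
  by (simp add: mat_1x1_def)

text \<open>The transported norm shows that the choice of a C*-norm succeeds. The chosen norm may be
  a different one a priori; contractivity of \<open>mat_1x1\<close> and of its inverse identifies it
  with the norm of \<open>A\<close>.\<close>

lemma nrm_matrix_algebra_1:
  assumes A: "cstar_algebra A" and x: "x \<in> carrier A"
  shows "nrm (matrix_algebra A (Suc 0)) (mat_1x1 x) = nrm A x"
proof -
  note simps = mat_1x1_simps[OF A]
  have "cstar_algebra (matrix_star_algebra A (Suc 0) (\<lambda>M. nrm A (M $$ (0,0))))"
    by (rule cstar_algebra_transport[OF A, of mat_1x1])
      (simp_all add: simps inj_on_def, metis index_mat_1x1)
  then have M: "cstar_algebra (matrix_algebra A (Suc 0))"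
    unfolding matrix_algebra_def by (rule someI[where P = "\<lambda>N. cstar_algebra (matrix_star_algebra A (Suc 0) N)"])
  note simps' = simps[where N = "SOME N. cstar_algebra (matrix_star_algebra A (Suc 0) N)", folded matrix_algebra_def]
  show ?thesis
  proof (rule antisym)
    show "nrm (matrix_algebra A (Suc 0)) (mat_1x1 x) \<le> nrm A x"
      by (rule star_hom_contractive[OF A M _ _ _ _ _ x]) (simp_all add: simps')
    have "nrm A (mat_1x1 x $$ (0,0)) \<le> nrm (matrix_algebra A (Suc 0)) (mat_1x1 x)"
      by (rule star_hom_contractive[OF M A]) (auto simp: simps' x)
    then show "nrm A x \<le> nrm (matrix_algebra A (Suc 0)) (mat_1x1 x)" by simp
  qed
qed

lemma completely_isometric_imp_isometric:
  assumes "cstar_algebra A" "cstar_algebra B" "completely_isometric A X B \<theta>"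
    and "X \<subseteq> carrier A" "\<theta> ` X \<subseteq> carrier B" "x \<in> X"
  shows "nrm B (\<theta> x) = nrm A x"
proof -
  have "mat_1x1 x \<in> matrices_over (Suc 0) X" using assms(6) by (simp add: matrices_over_1)
  then have "nrm (matrix_algebra B (Suc 0)) (map_mat \<theta> (mat_1x1 x)) = nrm (matrix_algebra A (Suc 0)) (mat_1x1 x)"
    using assms(3)[unfolded completely_isometric_def, rule_format, of "Suc 0"] by simp
  moreover have "map_mat \<theta> (mat_1x1 x) = mat_1x1 (\<theta> x)" by (auto simp: mat_1x1_def)
  moreover have "x \<in> carrier A" "\<theta> x \<in> carrier B" using assms(4-6) by auto
  ultimately show ?thesis
    by (simp add: nrm_matrix_algebra_1[OF assms(1)] nrm_matrix_algebra_1[OF assms(2)])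
qed

section \<open>2-positive maps\<close>

text \<open>The \<open>(i, j)\<close> entry of \<open>D\<^sup>* D\<close> for the \<open>2 \<times> 2\<close> matrix \<open>D\<close> with entries \<open>d k i\<close>.\<close>

definition gram :: "'a cstar \<Rightarrow> (nat \<Rightarrow> nat \<Rightarrow> 'a) \<Rightarrow> nat \<Rightarrow> nat \<Rightarrow> 'a" where
  "gram A d i j = star A (d 0 i) \<otimes>\<^bsub>A\<^esub> d 0 j \<oplus>\<^bsub>A\<^esub> star A (d 1 i) \<otimes>\<^bsub>A\<^esub> d 1 j"

lemma (in cstar_algebra) gram_closed:
  "(\<And>k i. d k i \<in> carrier A) \<Longrightarrow> gram A d i j \<in> carrier A"
  by (simp add: gram_def add_closed mult_closed star_closed)

text \<open>Positivity of a matrix is the algebraic condition \<open>M = D* D\<close>, so the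
  entries can be computed from the matrix operations alone, whichever norm has been chosen.\<close>

lemma positive_matrix_2_iff:
  assumes "cstar_algebra A" and M: "M \<in> carrier_mat 2 2"
  shows "positive (matrix_algebra A 2) M \<longleftrightarrow>
    (\<exists>d. (\<forall>k i. d k i \<in> carrier A) \<and> (\<forall>i<2. \<forall>j<2. M $$ (i,j) = gram A d i j))"
proof -
  interpret cstar_algebra A by (rule assms)
  have sum2: "(\<Oplus>\<^bsub>A\<^esub>k\<in>{..<2::nat}. f k) = f 0 \<oplus>\<^bsub>A\<^esub> f 1" if "\<And>k. k < 2 \<Longrightarrow> f k \<in> carrier A" for f
  proof -
    have "{..<2::nat} = {0, 1}" by auto
    then show ?thesis using that M.finsum_insert[of "{1}" 0 f] M.finsum_insert[of "{}" 1 f] by simp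
  qed
  show ?thesis
  proof
    assume "positive (matrix_algebra A 2) M"
    then obtain D where D: "D \<in> matrices_over 2 (carrier A)"
      and MD: "M = star (matrix_algebra A 2) D \<otimes>\<^bsub>matrix_algebra A 2\<^esub> D"
      by (auto simp: positive_def matrix_algebra_def matrix_star_algebra_def)
    have dim: "D \<in> carrier_mat 2 2" and el: "elements_mat D \<subseteq> carrier A"
      using D by (auto simp: matrices_over_def)
    have Dc: "D $$ (k, i) \<in> carrier A" if "k < 2" "i < 2" for k i
      using el elements_matI[OF dim that refl] by blast
    \<comment> \<open>Zero outside the range of indices, so that membership in the carrier holds for
      all \<open>k\<close>, \<open>i\<close>.\<close>
    define d where "d k i = (if k < 2 \<and> i < 2 then D $$ (k, i) else \<zero>\<^bsub>A\<^esub>)" for k i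
    have d: "d k i \<in> carrier A" for k i by (simp add: d_def Dc zero_closed)
    have "M $$ (i, j) = gram A d i j" if ij: "i < 2" "j < 2" for i j
    proof -
      have "M $$ (i, j) = (\<Oplus>\<^bsub>A\<^esub>k\<in>{..<2}. star A (D $$ (k, i)) \<otimes>\<^bsub>A\<^esub> D $$ (k, j))"
      proof -
        have "M $$ (i, j) = (\<Oplus>\<^bsub>A\<^esub>k\<in>{..<2}. mat 2 2 (\<lambda>(i, j). star A (D $$ (j, i))) $$ (i, k) \<otimes>\<^bsub>A\<^esub> D $$ (k, j))"
          using ij unfolding MD by (simp add: matrix_algebra_def matrix_star_algebra_def)
        also have "\<dots> = (\<Oplus>\<^bsub>A\<^esub>k\<in>{..<2}. star A (D $$ (k, i)) \<otimes>\<^bsub>A\<^esub> D $$ (k, j))"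
          using ij by (intro M.finsum_cong') (auto simp: Dc mult_closed star_closed)
        finally show ?thesis .
      qed
      also have "\<dots> = gram A d i j"
        using ij by (subst sum2) (simp_all add: gram_def d_def Dc mult_closed star_closed)
      finally show ?thesis .
    qed
    with d show "\<exists>d. (\<forall>k i. d k i \<in> carrier A) \<and> (\<forall>i<2. \<forall>j<2. M $$ (i,j) = gram A d i j)" by blast
  next
    assume "\<exists>d. (\<forall>k i. d k i \<in> carrier A) \<and> (\<forall>i<2. \<forall>j<2. M $$ (i,j) = gram A d i j)"
    then obtain d where d: "\<And>k i. d k i \<in> carrier A"
      and Md: "\<And>i j. i < 2 \<Longrightarrow> j < 2 \<Longrightarrow> M $$ (i,j) = gram A d i j" by blast
    define D where "D = mat 2 2 (\<lambda>(k, i). d k i)"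
    have "D \<in> matrices_over 2 (carrier A)"
      by (auto simp: D_def matrices_over_def elements_mat_def d)
    moreover have "M = star (matrix_algebra A 2) D \<otimes>\<^bsub>matrix_algebra A 2\<^esub> D"
    proof (rule eq_matI)
      fix i j assume "i < dim_row (star (matrix_algebra A 2) D \<otimes>\<^bsub>matrix_algebra A 2\<^esub> D)"
        and "j < dim_col (star (matrix_algebra A 2) D \<otimes>\<^bsub>matrix_algebra A 2\<^esub> D)"
      then have ij: "i < 2" "j < 2" by (simp_all add: matrix_algebra_def matrix_star_algebra_def)
      have "(star (matrix_algebra A 2) D \<otimes>\<^bsub>matrix_algebra A 2\<^esub> D) $$ (i, j)
          = (\<Oplus>\<^bsub>A\<^esub>k\<in>{..<2}. mat 2 2 (\<lambda>(i, j). star A (D $$ (j, i))) $$ (i, k) \<otimes>\<^bsub>A\<^esub> D $$ (k, j))"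
        using ij by (simp add: matrix_algebra_def matrix_star_algebra_def)
      also have "\<dots> = (\<Oplus>\<^bsub>A\<^esub>k\<in>{..<2}. star A (d k i) \<otimes>\<^bsub>A\<^esub> d k j)"
        using ij by (intro M.finsum_cong') (auto simp: D_def d mult_closed star_closed)
      also have "\<dots> = gram A d i j"
        by (subst sum2) (simp_all add: gram_def d mult_closed star_closed)
      finally show "M $$ (i, j) = (star (matrix_algebra A 2) D \<otimes>\<^bsub>matrix_algebra A 2\<^esub> D) $$ (i, j)"
        using Md[OF ij] by simp
    qed (use M in \<open>simp_all add: matrix_algebra_def matrix_star_algebra_def\<close>)
    ultimately show "positive (matrix_algebra A 2) M"
      by (auto simp: positive_def matrix_algebra_def matrix_star_algebra_def)
  qed
qed

text \<open>Positivity of the second amplification in terms of Gram entries. In this form it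
  composes directly, and it can be proved for the limit maps by choosing the entries stage by
  stage.\<close>

definition two_positive :: "'a cstar \<Rightarrow> 'a set \<Rightarrow> 'b cstar \<Rightarrow> ('a \<Rightarrow> 'b) \<Rightarrow> bool" where
  "two_positive A X B \<theta> \<longleftrightarrow>
     (\<forall>d. (\<forall>k i. d k i \<in> carrier A) \<longrightarrow> (\<forall>i<2. \<forall>j<2. gram A d i j \<in> X) \<longrightarrow>
       (\<exists>e. (\<forall>k i. e k i \<in> carrier B) \<and> (\<forall>i<2. \<forall>j<2. \<theta> (gram A d i j) = gram B e i j)))"

lemma completely_positive_imp_two_positive:
  assumes A: "cstar_algebra A" and B: "cstar_algebra B" and \<theta>: "completely_positive A X B Y \<theta>"
  shows "two_positive A X B \<theta>"
  unfolding two_positive_def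
proof (intro allI impI)
  fix d assume d: "\<forall>k i. d k i \<in> carrier A" and X: "\<forall>i<2. \<forall>j<2. gram A d i j \<in> X"
  define M where "M = mat 2 2 (\<lambda>(i, j). gram A d i j)"
  have M: "M \<in> matrices_over 2 X"
    using X by (auto simp: M_def matrices_over_def elements_mat_def)
  have "positive (matrix_algebra A 2) M"
    using d by (subst positive_matrix_2_iff[OF A]) (auto simp: M_def intro!: exI[of _ d])
  then have "positive (matrix_algebra B 2) (map_mat \<theta> M)"
    using \<theta> M unfolding completely_positive_def by (meson one_le_numeral)
  then obtain e where e: "\<forall>k i. e k i \<in> carrier B" "\<forall>i<2. \<forall>j<2. map_mat \<theta> M $$ (i,j) = gram B e i j"
    by (subst (asm) positive_matrix_2_iff[OF B]) (auto simp: M_def)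
  then show "\<exists>e. (\<forall>k i. e k i \<in> carrier B) \<and> (\<forall>i<2. \<forall>j<2. \<theta> (gram A d i j) = gram B e i j)"
    by (intro exI[of _ e]) (simp add: M_def)
qed

lemma two_positive_comp:
  assumes \<theta>: "two_positive A X B \<theta>" and \<eta>: "two_positive B Y C \<eta>" and XY: "\<theta> ` X \<subseteq> Y"
  shows "two_positive A X C (\<eta> \<circ> \<theta>)"
  unfolding two_positive_def
proof (intro allI impI)
  fix d assume d: "\<forall>k i. d k i \<in> carrier A" and X: "\<forall>i<2. \<forall>j<2. gram A d i j \<in> X"
  then obtain e where e: "\<forall>k i. e k i \<in> carrier B" "\<forall>i<2. \<forall>j<2. \<theta> (gram A d i j) = gram B e i j"
    using \<theta> unfolding two_positive_def by blast
  have "\<forall>i<2. \<forall>j<2. gram B e i j \<in> Y"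
    using X XY e(2) by (metis image_subset_iff)
  then obtain f where "\<forall>k i. f k i \<in> carrier C" "\<forall>i<2. \<forall>j<2. \<eta> (gram B e i j) = gram C f i j"
    using \<eta> e(1) unfolding two_positive_def by blast
  then show "\<exists>f. (\<forall>k i. f k i \<in> carrier C) \<and> (\<forall>i<2. \<forall>j<2. (\<eta> \<circ> \<theta>) (gram A d i j) = gram C f i j)"
    using e(2) by (intro exI[of _ f]) simp
qed

text \<open>What the Schwarz inequality takes from a c.p.c. map: 2-positivity provides the matrix,
  contractivity the bound on its upper left corner. The limit maps and their compositions with the
  inverse of \<open>\<psi>\<close> are shown to be of this kind.\<close>

locale cpc_map = A: cstar_algebra A + B: cstar_algebra B
  for A :: "'a cstar" and B :: "'b cstar" +
  fixes \<theta> :: "'a \<Rightarrow> 'b"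
  assumes star_linear: "star_linear A (carrier A) B (carrier B) \<theta>"
    and two_positive: "two_positive A (carrier A) B \<theta>"
    and contractive: "x \<in> carrier A \<Longrightarrow> nrm B (\<theta> x) \<le> nrm A x"
begin

lemma closed: "x \<in> carrier A \<Longrightarrow> \<theta> x \<in> carrier B"
  and add: "x \<in> carrier A \<Longrightarrow> y \<in> carrier A \<Longrightarrow> \<theta> (x \<oplus>\<^bsub>A\<^esub> y) = \<theta> x \<oplus>\<^bsub>B\<^esub> \<theta> y"
  and smult: "x \<in> carrier A \<Longrightarrow> \<theta> (c \<odot>\<^bsub>A\<^esub> x) = c \<odot>\<^bsub>B\<^esub> \<theta> x"
  and star: "x \<in> carrier A \<Longrightarrow> \<theta> (star A x) = star B (\<theta> x)"
  using star_linear by (auto simp: star_linear_def)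

lemma minus: "x \<in> carrier A \<Longrightarrow> y \<in> carrier A \<Longrightarrow> \<theta> (x \<ominus>\<^bsub>A\<^esub> y) = \<theta> x \<ominus>\<^bsub>B\<^esub> \<theta> y"
  by (simp add: a_minus_def add smult closed A.a_inv_closed
      flip: A.smult_minus_one B.smult_minus_one)

lemma image_carrier: "\<theta> ` carrier A \<subseteq> carrier B"
  by (auto simp: closed)

lemma norm_diff_le:
  assumes "x \<in> carrier A" "y \<in> carrier A"
  shows "norm (emb B (\<theta> x) - emb B (\<theta> y)) \<le> norm (emb A x - emb A y)"
  using contractive[of "x \<ominus>\<^bsub>A\<^esub> y"] assms
  by (simp add: minus A.minus_closed closed A.nrm_minus_eq B.nrm_minus_eq)

text \<open>The Kadison--Schwarz inequality. In the absence of a unit, \<open>2\<close>-positivity is applied to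
  \<open>D = (e x; 0 0)\<close> where \<open>e x\<close> is close to \<open>x\<close>.\<close>

lemma schwarz:
  assumes x: "x \<in> carrier A"
  obtains v where "v \<in> carrier B"
    "\<theta> (star A x \<otimes>\<^bsub>A\<^esub> x) = star B (\<theta> x) \<otimes>\<^bsub>B\<^esub> \<theta> x \<oplus>\<^bsub>B\<^esub> star B v \<otimes>\<^bsub>B\<^esub> v"
proof -
  have "\<exists>e\<in>carrier A. star A e = e \<and> nrm A e \<le> 1 \<and> norm (emb A x - emb A (e \<otimes>\<^bsub>A\<^esub> x)) < \<epsilon>"
    if "\<epsilon> > 0" for \<epsilon>
  proof -
    obtain F where F: "adj F = F" "norm F \<le> 1" "norm (emb A x - F * emb A x) < \<epsilon>"
      using approximate_unit[OF \<open>\<epsilon> > 0\<close>] by metis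
    let ?e = "component F A"
    have A: "cstar_algebra A" by (rule A.cstar_algebra_axioms)
    have e: "?e \<in> carrier A" using A by simp
    have "star A ?e = ?e" using arg_cong[OF F(1), of "\<lambda>F. component F A"] A by simp
    moreover have "nrm A ?e \<le> 1"
      using nrm_component_le[OF A, of F] F(2) by (simp add: norm_cstar_product_def)
    moreover have "nrm A (x \<ominus>\<^bsub>A\<^esub> ?e \<otimes>\<^bsub>A\<^esub> x) < \<epsilon>"
      using nrm_component_le[OF A, of "emb A x - F * emb A x"] F(3) A x
      by (simp add: norm_cstar_product_def)
    ultimately show ?thesis using e x by (auto simp: A.nrm_minus_eq A.mult_closed)
  qed
  then have "\<exists>e. e \<in> carrier A \<and> star A e = e \<and> nrm A e \<le> 1 \<and>
      norm (emb A x - emb A (e \<otimes>\<^bsub>A\<^esub> x)) < inverse (real (Suc n))" for n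
    by (meson inverse_positive_iff_positive of_nat_0_less_iff zero_less_Suc)
  then obtain e where e: "\<And>n. e n \<in> carrier A" "\<And>n. star A (e n) = e n" "\<And>n. nrm A (e n) \<le> 1"
    and ex: "\<And>n. norm (emb A x - emb A (e n \<otimes>\<^bsub>A\<^esub> x)) < inverse (real (Suc n))" by metis
  let ?q = "emb B (\<theta> (star A x \<otimes>\<^bsub>A\<^esub> x))" and ?Tx = "emb B (\<theta> x)"
  define u where "u n = emb B (\<theta> (e n \<otimes>\<^bsub>A\<^esub> x))" for n
  have pos_n: "pos (?q - adj (u n) * u n)" for n
  proof -
    define d where "d k i = (if k = 0 then if i = 0 then e n else x else \<zero>\<^bsub>A\<^esub>)" for k i :: nat
    have d: "d k i \<in> carrier A" for k i by (simp add: d_def e x A.zero_closed)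
    have g: "gram A d 0 0 = e n \<otimes>\<^bsub>A\<^esub> e n" "gram A d 0 1 = e n \<otimes>\<^bsub>A\<^esub> x" "gram A d 1 1 = star A x \<otimes>\<^bsub>A\<^esub> x"
      by (simp_all add: gram_def d_def e x A.star_zero A.mult_zero A.mult_closed A.star_closed)
    have "\<exists>f. (\<forall>k i. f k i \<in> carrier B) \<and> (\<forall>i<2. \<forall>j<2. \<theta> (gram A d i j) = gram B f i j)"
      using two_positive d A.gram_closed[of d] unfolding two_positive_def by blast
    then obtain f where f: "\<And>k i. f k i \<in> carrier B"
      and fg: "\<And>i j. i < 2 \<Longrightarrow> j < 2 \<Longrightarrow> \<theta> (gram A d i j) = gram B f i j" by blast
    have gf: "emb B (gram B f i j) = adj (emb B (f 0 i)) * emb B (f 0 j) + adj (emb B (f 1 i)) * emb B (f 1 j)" for i j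
      by (simp add: gram_def f B.emb_simps B.mult_closed B.star_closed)
    \<comment> \<open>The upper left corner is the image of \<open>e n * e n\<close>; its bound is
      the hypothesis on \<open>p\<close> in \<open>schwarz_2x2\<close>.\<close>
    have "norm (emb B (gram B f 0 0)) \<le> 1"
    proof -
      have "norm (emb B (gram B f 0 0)) = nrm B (\<theta> (e n \<otimes>\<^bsub>A\<^esub> e n))"
        using fg[of 0 0] by (simp add: g(1) B.norm_emb B.gram_closed f)
      also have "\<dots> \<le> nrm A (e n) * nrm A (e n)"
        by (rule order_trans[OF contractive A.nrm_mult]) (simp_all add: e A.mult_closed)
      also have "\<dots> \<le> 1" by (intro mult_le_one e A.nrm_nonneg)
      finally show ?thesis .
    qed
    then have schw: "pos (emb B (gram B f 1 1) - adj (emb B (gram B f 0 1)) * emb B (gram B f 0 1))"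
      unfolding gf by (rule schwarz_2x2)
    have "gram B f 0 1 = \<theta> (e n \<otimes>\<^bsub>A\<^esub> x)" "gram B f 1 1 = \<theta> (star A x \<otimes>\<^bsub>A\<^esub> x)"
      using fg[of 0 1] fg[of 1 1] unfolding g by simp_all
    then show ?thesis using schw by (simp only: u_def)
  qed
  have lim: "(\<lambda>n. ?q - adj (u n) * u n) \<longlonglongrightarrow> ?q - adj ?Tx * ?Tx"
  proof -
    have "u \<longlonglongrightarrow> ?Tx"
    proof (rule LIM_zero_cancel, rule Lim_null_comparison[OF always_eventually LIMSEQ_inverse_real_of_nat], rule allI)
      fix n
      have "norm (u n - ?Tx) \<le> norm (emb A (e n \<otimes>\<^bsub>A\<^esub> x) - emb A x)"
        unfolding u_def by (intro norm_diff_le A.mult_closed e x)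
      then show "norm (u n - ?Tx) \<le> inverse (real (Suc n))"
        using ex[of n] by (simp add: norm_minus_commute)
    qed
    then show ?thesis by (intro tendsto_intros tendsto_adj)
  qed
  have "pos (?q - adj ?Tx * ?Tx)" by (rule nonunital_pos_lim[OF lim pos_n])
  then obtain v where v: "v \<in> carrier B" "component (?q - adj ?Tx * ?Tx) B = star B v \<otimes>\<^bsub>B\<^esub> v"
    by (rule B.pos_component)
  have c: "\<theta> (star A x \<otimes>\<^bsub>A\<^esub> x) \<in> carrier B" "\<theta> x \<in> carrier B"
    by (simp_all add: x closed A.mult_closed A.star_closed)
  have "\<theta> (star A x \<otimes>\<^bsub>A\<^esub> x) \<ominus>\<^bsub>B\<^esub> star B (\<theta> x) \<otimes>\<^bsub>B\<^esub> \<theta> x = star B v \<otimes>\<^bsub>B\<^esub> v"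
    using v(2) c B.cstar_algebra_axioms by simp
  then have "emb B (star B v \<otimes>\<^bsub>B\<^esub> v) = ?q - emb B (star B (\<theta> x) \<otimes>\<^bsub>B\<^esub> \<theta> x)"
    using c by (simp add: B.mult_closed B.star_closed flip: B.emb_minus)
  then have "emb B (star B (\<theta> x) \<otimes>\<^bsub>B\<^esub> \<theta> x \<oplus>\<^bsub>B\<^esub> star B v \<otimes>\<^bsub>B\<^esub> v) = ?q"
    using c v(1) by (simp add: B.emb_add B.mult_closed B.star_closed)
  then have "star B (\<theta> x) \<otimes>\<^bsub>B\<^esub> \<theta> x \<oplus>\<^bsub>B\<^esub> star B v \<otimes>\<^bsub>B\<^esub> v = \<theta> (star A x \<otimes>\<^bsub>A\<^esub> x)"
    using c v(1) by (subst (asm) B.emb_inject) (simp_all add: B.mult_closed B.star_closed B.add_closed)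
  from that[OF v(1) this[symmetric]] show thesis .
qed

end

section \<open>Limit maps\<close>

lemma cpc_map_comp:
  assumes "cpc_map A B \<theta>" "cpc_map B C \<eta>"
  shows "cpc_map A C (\<eta> \<circ> \<theta>)"
proof -
  interpret T: cpc_map A B \<theta> by (rule assms(1))
  interpret H: cpc_map B C \<eta> by (rule assms(2))
  show ?thesis
  proof (intro cpc_map.intro cpc_map_axioms.intro T.A.cstar_algebra_axioms H.B.cstar_algebra_axioms)
    show "star_linear A (carrier A) C (carrier C) (\<eta> \<circ> \<theta>)"
      by (auto simp: star_linear_def T.closed T.add T.smult T.star H.closed H.add H.smult H.star)
    show "two_positive A (carrier A) C (\<eta> \<circ> \<theta>)"
      by (rule two_positive_comp[OF T.two_positive H.two_positive T.image_carrier])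
    show "nrm C ((\<eta> \<circ> \<theta>) x) \<le> nrm A x" if "x \<in> carrier A" for x
      using order_trans[OF H.contractive T.contractive] that by (simp add: T.closed)
  qed
qed

lemma cpc_map_id: "cstar_algebra A \<Longrightarrow> cpc_map A A (\<lambda>x. x)"
  by (intro cpc_map.intro cpc_map_axioms.intro) (auto simp: star_linear_def two_positive_def)

lemma cpc_map_connecting:
  assumes "cpc_system A \<rho>" and "n \<le> m"
  shows "cpc_map (A n) (A m) (connecting \<rho> m n)"
  using assms(2)
proof (induction m)
  case 0
  then show ?case using assms(1) cpc_map_id[of "A 0"] by (simp add: cpc_system_def id_def)
next
  case (Suc m)
  show ?case
  proof (cases "n \<le> m")
    case True
    have c: "cstar_algebra (A n)" for n using assms(1) by (simp add: cpc_system_def)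
    have cp: "completely_positive (A m) (carrier (A m)) (A (Suc m)) (carrier (A (Suc m))) (\<rho> m)"
      using assms(1) by (simp add: cpc_system_def)
    have "cpc_map (A m) (A (Suc m)) (\<rho> m)"
    proof (intro cpc_map.intro cpc_map_axioms.intro c)
      show "star_linear (A m) (carrier (A m)) (A (Suc m)) (carrier (A (Suc m))) (\<rho> m)"
        using cp by (simp add: completely_positive_def)
      show "two_positive (A m) (carrier (A m)) (A (Suc m)) (\<rho> m)"
        by (rule completely_positive_imp_two_positive[OF c c cp])
      show "nrm (A (Suc m)) (\<rho> m x) \<le> nrm (A m) x" if "x \<in> carrier (A m)" for x
        using assms(1) that by (simp add: cpc_system_def)
    qed
    from cpc_map_comp[OF Suc.IH[OF True] this] show ?thesis using True by (simp add: comp_def)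
  next
    case False
    with Suc.prems have "n = Suc m" by simp
    then show ?thesis using assms(1) cpc_map_id[of "A n"] by (simp add: cpc_system_def id_def)
  qed
qed

lemma connecting_connecting:
  assumes "n \<le> m" "m \<le> k"
  shows "connecting \<rho> k m (connecting \<rho> m n x) = connecting \<rho> k n x"
  using assms(2)
proof (induction k)
  case (Suc k)
  then show ?case using assms(1) by (cases "m = Suc k") simp_all
qed (use assms in simp)

locale cpc_sequence = cstar_sequence A for A :: "nat \<Rightarrow> 'a cstar" +
  fixes \<rho> :: "nat \<Rightarrow> 'a \<Rightarrow> 'a"
  assumes cpc_system: "cpc_system A \<rho>"
begin

definition orbit :: "nat \<Rightarrow> 'a \<Rightarrow> nat \<Rightarrow> 'a" where
  "orbit n x m = (if m > n then connecting \<rho> m n x else \<zero>\<^bsub>A m\<^esub>)"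

lemma limit_map_eq: "limit_map A \<rho> n x = cl (orbit n x)"
  by (simp add: limit_map_def orbit_def[abs_def])

lemma cpc_connecting: "n \<le> m \<Longrightarrow> cpc_map (A n) (A m) (connecting \<rho> m n)"
  by (rule cpc_map_connecting[OF cpc_system])

lemmas connecting_closed = cpc_map.closed[OF cpc_connecting]

lemma emb_zero_A: "emb (A m) \<zero>\<^bsub>A m\<^esub> = 0"
  using E_zero[of m] by (simp add: E_def)

lemma norm_E_orbit: "x \<in> carrier (A n) \<Longrightarrow> norm (E (orbit n x) m) \<le> nrm (A n) x"
  using cpc_map.contractive[OF cpc_connecting, of n m x] connecting_closed[of n m x]
  by (simp add: E_def orbit_def emb_zero_A cstar_algebra.norm_emb[OF cstar] cstar_algebra.nrm_nonneg[OF cstar])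

lemma orbit_S:
  assumes "x \<in> carrier (A n)"
  shows "orbit n x \<in> S"
proof (rule S_I)
  show "orbit n x m \<in> carrier (A m)" for m
    using assms by (simp add: orbit_def connecting_closed cstar_algebra.zero_closed[OF cstar])
  show "norm (E (orbit n x) m) \<le> nrm (A n) x" for m
    using assms by (rule norm_E_orbit)
qed

text \<open>Beyond stage \<open>m\<close> the two representing sequences agree, and a class depends
  on tails only.\<close>

lemma limit_map_connecting:
  assumes "n \<le> m" "x \<in> carrier (A n)"
  shows "limit_map A \<rho> m (connecting \<rho> m n x) = limit_map A \<rho> n x"
proof -
  have "\<forall>\<^sub>F k in sequentially. E (orbit m (connecting \<rho> m n x)) k - E (orbit n x) k = 0"
    using eventually_gt_at_top[of m]
    by eventually_elim (use assms(1) in \<open>simp add: E_def orbit_def connecting_connecting\<close>)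
  then show ?thesis
    using assms by (simp add: limit_map_eq cl_eq_iff orbit_S connecting_closed tendsto_eventually)
qed

text \<open>At every stage \<open>m > n\<close> the image of the Gram matrix has a square root in 2
  by 2 matrices over \<open>A m\<close>. Collected over \<open>m\<close>, the entries of these roots
  form bounded sequences, because the diagonal of the Gram matrix bounds them; their classes are the
  entries of a root over the sequence algebra.\<close>

lemma two_positive_limit_map: "two_positive (A n) (carrier (A n)) Q (limit_map A \<rho> n)"
  unfolding two_positive_def
proof (intro allI impI)
  fix d :: "nat \<Rightarrow> nat \<Rightarrow> 'a" assume d: "\<forall>k i. d k i \<in> carrier (A n)"
  have gc: "gram (A n) d i j \<in> carrier (A n)" for i j
    using d by (intro cstar_algebra.gram_closed[OF cstar]) simp
  have "\<exists>f. (\<forall>k i. f k i \<in> carrier (A m)) \<and>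
      (\<forall>i<2. \<forall>j<2. connecting \<rho> m n (gram (A n) d i j) = gram (A m) f i j)" if "m > n" for m
    using cpc_map.two_positive[OF cpc_connecting[of n m]] that d gc
    unfolding two_positive_def by simp
  then have "\<forall>m. \<exists>f. m > n \<longrightarrow> (\<forall>k i. f k i \<in> carrier (A m)) \<and>
      (\<forall>i<2. \<forall>j<2. connecting \<rho> m n (gram (A n) d i j) = gram (A m) f i j)" by blast
  then obtain f where f: "\<And>m k i. m > n \<Longrightarrow> f m k i \<in> carrier (A m)"
    and fg: "\<And>m i j. m > n \<Longrightarrow> i < 2 \<Longrightarrow> j < 2 \<Longrightarrow> connecting \<rho> m n (gram (A n) d i j) = gram (A m) (f m) i j"
    by metis
  \<comment> \<open>The zeros at stages \<open>m \<le> n\<close> reproduce the padding of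
    \<open>orbit\<close>, so the Gram entries match at every stage.\<close>
  define e where "e k i m = (if m > n \<and> k < 2 \<and> i < 2 then f m k i else \<zero>\<^bsub>A m\<^esub>)" for k i m
  have ec: "e k i m \<in> carrier (A m)" for k i m
    by (simp add: e_def f cstar_algebra.zero_closed[OF cstar])
  have ge: "gram (A m) (\<lambda>k i. e k i m) i j = orbit n (gram (A n) d i j) m" if "i < 2" "j < 2" for i j m
    using that fg[of m i j]
    by (auto simp: gram_def orbit_def e_def cstar_algebra.star_zero[OF cstar]
        cstar_algebra.mult_zero[OF cstar] cstar_algebra.add_zero_left[OF cstar] cstar_algebra.zero_closed[OF cstar])
  have eS: "e k i \<in> S" for k i
  proof (rule S_I)
    \<comment> \<open>The square of \<open>e k i m\<close> is one of the two summands of the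
      \<open>i\<close>-th diagonal Gram entry. That entry is the image of an element of
      \<open>A n\<close> under a contraction, or zero.\<close>
    show "norm (E (e k i) m) \<le> sqrt (nrm (A n) (gram (A n) d i i))" for m
    proof (cases "k < 2 \<and> i < 2")
      case True
      interpret Am: cstar_algebra "A m" by (rule cstar)
      have "(nrm (A m) (e k i m))\<^sup>2 \<le> nrm (A m) (gram (A m) (\<lambda>k i. e k i m) i i)"
      proof (cases "k = 0")
        case True
        then show ?thesis using Am.nrm_adj_add_le[OF ec[of 0 i m] ec[of 1 i m]] by (simp add: gram_def)
      next
        case False
        then have "k = 1" using \<open>k < 2 \<and> i < 2\<close> by simp
        then show ?thesis using Am.nrm_adj_add_le[OF ec[of 1 i m] ec[of 0 i m]]
          by (simp add: gram_def ec Am.add_commute Am.mult_closed Am.star_closed)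
      qed
      also have "\<dots> \<le> nrm (A n) (gram (A n) d i i)"
        using norm_E_orbit[OF gc[of i i], of m] True orbit_S[OF gc[of i i]]
        by (simp add: ge E_def Am.norm_emb S_carrier)
      finally have "nrm (A m) (e k i m) \<le> sqrt (nrm (A n) (gram (A n) d i i))" by (rule real_le_rsqrt)
      then show ?thesis by (simp add: E_def Am.norm_emb ec)
    next
      case False
      then show ?thesis
        by (auto simp: E_def e_def emb_zero_A intro: cstar_algebra.nrm_nonneg[OF cstar gc])
    qed
  qed (rule ec)
  have "limit_map A \<rho> n (gram (A n) d i j) = gram Q (\<lambda>k i. cl (e k i)) i j" if ij: "i < 2" "j < 2" for i j
  proof -
    have "gram Q (\<lambda>k i. cl (e k i)) i j = cl (\<lambda>m. gram (A m) (\<lambda>k i. e k i m) i j)"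
      by (simp add: gram_def Q_star Q_mult Q_add eS S_closed)
    then show ?thesis by (simp add: ge ij limit_map_eq)
  qed
  then show "\<exists>e. (\<forall>k i. e k i \<in> carrier Q) \<and>
      (\<forall>i<2. \<forall>j<2. limit_map A \<rho> n (gram (A n) d i j) = gram Q e i j)"
    by (intro exI[of _ "\<lambda>k i. cl (e k i)"]) (simp add: eS)
qed

lemma cpc_limit_map: "cpc_map (A n) Q (limit_map A \<rho> n)"
proof (intro cpc_map.intro cpc_map_axioms.intro cstar cstar_algebra_Q two_positive_limit_map)
  show "star_linear (A n) (carrier (A n)) Q (carrier Q) (limit_map A \<rho> n)"
    unfolding star_linear_def
  proof (intro conjI ballI allI funcsetI)
    fix x y c assume x: "x \<in> carrier (A n)"
    show "limit_map A \<rho> n x \<in> carrier Q" by (simp add: limit_map_eq orbit_S x)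
    have "orbit n (c \<odot>\<^bsub>A n\<^esub> x) = (\<lambda>m. c \<odot>\<^bsub>A m\<^esub> orbit n x m)"
      by (rule ext) (simp add: orbit_def x cpc_map.smult[OF cpc_connecting] cstar_algebra.smult_zero[OF cstar])
    then show "limit_map A \<rho> n (c \<odot>\<^bsub>A n\<^esub> x) = c \<odot>\<^bsub>Q\<^esub> limit_map A \<rho> n x"
      by (simp add: limit_map_eq Q_smult orbit_S x)
    have "orbit n (star (A n) x) = (\<lambda>m. star (A m) (orbit n x m))"
      by (rule ext) (simp add: orbit_def x cpc_map.star[OF cpc_connecting] cstar_algebra.star_zero[OF cstar])
    then show "limit_map A \<rho> n (star (A n) x) = star Q (limit_map A \<rho> n x)"
      by (simp add: limit_map_eq Q_star orbit_S x)
    assume y: "y \<in> carrier (A n)"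
    have "orbit n (x \<oplus>\<^bsub>A n\<^esub> y) = (\<lambda>m. orbit n x m \<oplus>\<^bsub>A m\<^esub> orbit n y m)"
      by (rule ext) (simp add: orbit_def x y cpc_map.add[OF cpc_connecting]
          cstar_algebra.add_zero_left[OF cstar] cstar_algebra.zero_closed[OF cstar])
    then show "limit_map A \<rho> n (x \<oplus>\<^bsub>A n\<^esub> y) = limit_map A \<rho> n x \<oplus>\<^bsub>Q\<^esub> limit_map A \<rho> n y"
      by (simp add: limit_map_eq Q_add orbit_S x y)
  qed
  show "nrm Q (limit_map A \<rho> n x) \<le> nrm (A n) x" if "x \<in> carrier (A n)" for x
    unfolding limit_map_eq
    by (rule nrm_Q_le) (simp_all add: that orbit_S norm_E_orbit cstar_algebra.nrm_nonneg[OF cstar])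
qed

section \<open>The limit subspace and its approximation by the stages\<close>

abbreviation L :: "(nat \<Rightarrow> 'a) set set" where "L \<equiv> system_limit A \<rho>"

sublocale Q: cstar_algebra Q by (rule cstar_algebra_Q)
sublocale QM: Metric_space "carrier Q" "cdist Q" by (rule Metric_space_Q)

lemma limit_map_closed: "x \<in> carrier (A n) \<Longrightarrow> limit_map A \<rho> n x \<in> carrier Q"
  by (rule cpc_map.closed[OF cpc_limit_map])

lemma cdist_Q_eq: "X \<in> carrier Q \<Longrightarrow> Y \<in> carrier Q \<Longrightarrow> cdist Q X Y = norm (emb Q X - emb Q Y)"
  by (simp add: cdist_def Q.nrm_minus_eq)

lemma L_carrier: "X \<in> L \<Longrightarrow> X \<in> carrier Q"
  by (simp add: system_limit_def QM.metric_closure_of)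

lemma limit_map_in_L: "x \<in> carrier (A n) \<Longrightarrow> limit_map A \<rho> n x \<in> L"
proof -
  have "(\<Union>n. limit_map A \<rho> n ` carrier (A n)) \<subseteq> L"
    unfolding system_limit_def by (rule closure_of_subset) (auto simp: limit_map_closed)
  then show "x \<in> carrier (A n) \<Longrightarrow> limit_map A \<rho> n x \<in> L" by blast
qed

lemma L_approx:
  assumes "X \<in> L" "\<epsilon> > 0"
  obtains n x where "x \<in> carrier (A n)" "norm (emb Q X - emb Q (limit_map A \<rho> n x)) < \<epsilon>"
proof -
  obtain n x where nx: "x \<in> carrier (A n)" "limit_map A \<rho> n x \<in> QM.mball X \<epsilon>"
    using assms unfolding system_limit_def QM.metric_closure_of by blast
  then have "norm (emb Q X - emb Q (limit_map A \<rho> n x)) < \<epsilon>"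
    using assms(1) by (simp add: cdist_Q_eq L_carrier limit_map_closed)
  with nx(1) show thesis by (rule that)
qed

lemma limitin_Q_iff:
  assumes "X \<in> carrier Q" "\<forall>\<^sub>F n in sequentially. f n \<in> carrier Q"
  shows "limitin QM.mtopology f X sequentially \<longleftrightarrow> (\<lambda>n. emb Q (f n)) \<longlonglongrightarrow> emb Q X"
proof -
  have "limitin QM.mtopology f X sequentially \<longleftrightarrow>
      (\<forall>\<epsilon>>0. \<forall>\<^sub>F n in sequentially. f n \<in> carrier Q \<and> cdist Q (f n) X < \<epsilon>)"
    using assms(1) by (simp add: QM.limit_metric_sequentially eventually_sequentially)
  also have "\<dots> \<longleftrightarrow> (\<forall>\<epsilon>>0. \<forall>\<^sub>F n in sequentially. norm (emb Q (f n) - emb Q X) < \<epsilon>)"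
  proof (intro all_cong eventually_subst)
    fix \<epsilon> :: real
    show "\<forall>\<^sub>F n in sequentially. (f n \<in> carrier Q \<and> cdist Q (f n) X < \<epsilon>) = (norm (emb Q (f n) - emb Q X) < \<epsilon>)"
      using assms(2) by eventually_elim (simp add: cdist_Q_eq assms(1))
  qed
  also have "\<dots> \<longleftrightarrow> (\<lambda>n. emb Q (f n)) \<longlonglongrightarrow> emb Q X"
    by (simp add: tendsto_iff dist_norm)
  finally show ?thesis .
qed

end

section \<open>The product transported from a complete order embedding\<close>

locale system_embedding = cpc_sequence A \<rho> + B: cstar_algebra B
  for A :: "nat \<Rightarrow> 'a cstar" and \<rho> :: "nat \<Rightarrow> 'a \<Rightarrow> 'a" and B :: "'b cstar" +
  fixes \<psi> :: "'b \<Rightarrow> (nat \<Rightarrow> 'a) set"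
  assumes order_embedding: "complete_order_embedding B (carrier B) Q (carrier Q) \<psi>"
    and image: "\<psi> ` carrier B = system_limit A \<rho>"
begin

lemma psi_L: "b \<in> carrier B \<Longrightarrow> \<psi> b \<in> L"
  using image by blast

lemma psi_closed: "b \<in> carrier B \<Longrightarrow> \<psi> b \<in> carrier Q"
  by (simp add: psi_L L_carrier)

lemma nrm_psi: "b \<in> carrier B \<Longrightarrow> nrm Q (\<psi> b) = nrm B b"
  using completely_isometric_imp_isometric[OF B.cstar_algebra_axioms cstar_algebra_Q, of "carrier B" \<psi> b]
    order_embedding psi_closed by (simp add: complete_order_embedding_def image_subset_iff)

lemma cpc_psi: "cpc_map B Q \<psi>"
proof (intro cpc_map.intro cpc_map_axioms.intro B.cstar_algebra_axioms cstar_algebra_Q)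
  have cp: "completely_positive B (carrier B) Q (carrier Q) \<psi>"
    using order_embedding by (simp add: complete_order_embedding_def)
  then show "star_linear B (carrier B) Q (carrier Q) \<psi>" by (simp add: completely_positive_def)
  show "two_positive B (carrier B) Q \<psi>"
    by (rule completely_positive_imp_two_positive[OF B.cstar_algebra_axioms cstar_algebra_Q cp])
qed (simp add: nrm_psi)

sublocale psi: cpc_map B Q \<psi> by (rule cpc_psi)

lemma norm_psi_diff:
  assumes "a \<in> carrier B" "b \<in> carrier B"
  shows "norm (emb Q (\<psi> a) - emb Q (\<psi> b)) = norm (emb B a - emb B b)"
  using nrm_psi[of "a \<ominus>\<^bsub>B\<^esub> b"] assms
  by (simp add: psi.minus B.minus_closed psi_closed Q.nrm_minus_eq B.nrm_minus_eq)

lemma psi_eq_iff: "a \<in> carrier B \<Longrightarrow> b \<in> carrier B \<Longrightarrow> \<psi> a = \<psi> b \<longleftrightarrow> a = b"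
  using norm_psi_diff[of a b] B.emb_inject[of a b] by auto

lemma inj_psi: "inj_on \<psi> (carrier B)"
  by (simp add: inj_on_def psi_eq_iff)

abbreviation psi_inv :: "(nat \<Rightarrow> 'a) set \<Rightarrow> 'b" where
  "psi_inv \<equiv> inv_into (carrier B) \<psi>"

lemma psi_inv_psi: "b \<in> carrier B \<Longrightarrow> psi_inv (\<psi> b) = b"
  by (rule inv_into_f_f[OF inj_psi])

lemma psi_psi_inv: "X \<in> L \<Longrightarrow> \<psi> (psi_inv X) = X"
  by (simp add: f_inv_into_f image)

lemma psi_inv_closed: "X \<in> L \<Longrightarrow> psi_inv X \<in> carrier B"
  by (simp add: inv_into_into image)

lemma L_cases:
  assumes "X \<in> L" obtains b where "b \<in> carrier B" "X = \<psi> b"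
  using assms psi_psi_inv psi_inv_closed by metis

definition phi :: "nat \<Rightarrow> 'a \<Rightarrow> 'b" where
  "phi n = psi_inv \<circ> limit_map A \<rho> n"

lemma psi_phi: "x \<in> carrier (A n) \<Longrightarrow> \<psi> (phi n x) = limit_map A \<rho> n x"
  by (simp add: phi_def psi_psi_inv limit_map_in_L)

lemma phi_closed: "x \<in> carrier (A n) \<Longrightarrow> phi n x \<in> carrier B"
  by (simp add: phi_def psi_inv_closed limit_map_in_L)

lemma phi_connecting:
  "n \<le> m \<Longrightarrow> x \<in> carrier (A n) \<Longrightarrow> phi m (connecting \<rho> m n x) = phi n x"
  by (simp add: phi_def limit_map_connecting)

text \<open>Linearity follows by applying the injective map \<open>\<psi>\<close>, contractivity
  from its isometry. For 2-positivity the inverse of \<open>\<psi>\<close> is available on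
  \<open>L\<close> only, and this suffices because the limit maps take their values there.\<close>

lemma cpc_phi: "cpc_map (A n) B (phi n)"
proof (intro cpc_map.intro cpc_map_axioms.intro cstar B.cstar_algebra_axioms)
  note lim = cpc_map.add[OF cpc_limit_map] cpc_map.smult[OF cpc_limit_map] cpc_map.star[OF cpc_limit_map]
  show "star_linear (A n) (carrier (A n)) B (carrier B) (phi n)"
    unfolding star_linear_def
  proof (intro conjI ballI allI funcsetI)
    fix x y c assume x: "x \<in> carrier (A n)"
    show "phi n x \<in> carrier B" by (rule phi_closed[OF x])
    have "\<psi> (phi n (c \<odot>\<^bsub>A n\<^esub> x)) = \<psi> (c \<odot>\<^bsub>B\<^esub> phi n x)"
      using x by (simp add: psi_phi psi.smult phi_closed lim cstar_algebra.smult_closed'[OF cstar])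
    then show "phi n (c \<odot>\<^bsub>A n\<^esub> x) = c \<odot>\<^bsub>B\<^esub> phi n x"
      using x by (simp add: psi_eq_iff phi_closed B.smult_closed' cstar_algebra.smult_closed'[OF cstar])
    have "\<psi> (phi n (star (A n) x)) = \<psi> (star B (phi n x))"
      using x by (simp add: psi_phi psi.star phi_closed lim cstar_algebra.star_closed[OF cstar])
    then show "phi n (star (A n) x) = star B (phi n x)"
      using x by (simp add: psi_eq_iff phi_closed B.star_closed cstar_algebra.star_closed[OF cstar])
    assume y: "y \<in> carrier (A n)"
    have "\<psi> (phi n (x \<oplus>\<^bsub>A n\<^esub> y)) = \<psi> (phi n x \<oplus>\<^bsub>B\<^esub> phi n y)"
      using x y by (simp add: psi_phi psi.add phi_closed lim cstar_algebra.add_closed[OF cstar])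
    then show "phi n (x \<oplus>\<^bsub>A n\<^esub> y) = phi n x \<oplus>\<^bsub>B\<^esub> phi n y"
      using x y by (simp add: psi_eq_iff phi_closed B.add_closed cstar_algebra.add_closed[OF cstar])
  qed
  have "completely_positive Q L B (carrier B) psi_inv"
    using order_embedding by (simp add: complete_order_embedding_def image)
  then have "two_positive Q L B psi_inv"
    by (rule completely_positive_imp_two_positive[OF cstar_algebra_Q B.cstar_algebra_axioms])
  then show "two_positive (A n) (carrier (A n)) B (phi n)"
    unfolding phi_def
    by (rule two_positive_comp[OF two_positive_limit_map]) (use limit_map_in_L in blast)
  show "nrm B (phi n x) \<le> nrm (A n) x" if "x \<in> carrier (A n)" for x
    using nrm_psi[OF phi_closed[OF that]] cpc_map.contractive[OF cpc_limit_map that]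
    by (simp add: psi_phi that)
qed

text \<open>Schwarz for \<open>phi m\<close> bounds \<open>phi m (x\<^sub>m\<^sup>* x\<^sub>m)\<close> from below by \<open>b\<^sup>* b\<close>, where \<open>b = phi k x\<close>.
  Schwarz for \<open>\<psi>\<close> at \<open>b\<close> bounds \<open>\<psi> (b\<^sup>* b)\<close>, which is close to some \<open>limit_map n d\<close>, from below by
  the class of \<open>x\<^sub>m\<^sup>* x\<^sub>m\<close>; this lifts to the \<open>A m\<close> for large \<open>m\<close> and is mapped back by \<open>phi m\<close>.\<close>

lemma phi_square_tendsto:
  assumes x: "x \<in> carrier (A k)"
  shows "(\<lambda>m. emb B (phi m (star (A m) (connecting \<rho> m k x) \<otimes>\<^bsub>A m\<^esub> connecting \<rho> m k x)))
    \<longlonglongrightarrow> adj (emb B (phi k x)) * emb B (phi k x)"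
proof (rule tendstoI)
  fix \<epsilon> :: real assume "\<epsilon> > 0"
  then have \<epsilon>: "\<epsilon> / 2 > 0" by simp
  define b where "b = phi k x"
  have b: "b \<in> carrier B" by (simp add: b_def phi_closed x)
  define c where "c = star B b \<otimes>\<^bsub>B\<^esub> b"
  have c: "c \<in> carrier B" by (simp add: c_def b B.mult_closed B.star_closed)
  have Ec: "emb B c = adj (emb B b) * emb B b"
    by (simp add: c_def b B.emb_simps B.star_closed)
  have psi_b: "\<psi> b = cl (orbit k x)" by (simp add: b_def psi_phi x limit_map_eq)
  obtain V where V: "V \<in> carrier Q" "\<psi> c = star Q (\<psi> b) \<otimes>\<^bsub>Q\<^esub> \<psi> b \<oplus>\<^bsub>Q\<^esub> star Q V \<otimes>\<^bsub>Q\<^esub> V"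
    using psi.schwarz[OF b] unfolding c_def by metis
  obtain v where v: "v \<in> S" "V = cl v" by (rule Q_cases[OF V(1)])
  obtain n d where d: "d \<in> carrier (A n)" "norm (emb Q (\<psi> c) - emb Q (limit_map A \<rho> n d)) < \<epsilon> / 2"
    by (rule L_approx[OF psi_L[OF c] \<epsilon>])
  have cd: "norm (emb B c - emb B (phi n d)) < \<epsilon> / 2"
    using d norm_psi_diff[OF c phi_closed[OF d(1)]] by (simp add: psi_phi)
  \<comment> \<open>By the Schwarz identity for \<open>\<psi>\<close>, the class of this sequence is
    \<open>\<psi> c\<close> minus the approximant from stage \<open>n\<close>. A small class means
    small entries for all large \<open>m\<close>.\<close>
  let ?w = "\<lambda>m. (star (A m) (orbit k x m) \<otimes>\<^bsub>A m\<^esub> orbit k x m \<oplus>\<^bsub>A m\<^esub> star (A m) (v m) \<otimes>\<^bsub>A m\<^esub> v m) \<ominus>\<^bsub>A m\<^esub> orbit n d m"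
  note orb = orbit_S[OF x] orbit_S[OF d(1)]
  have w: "?w \<in> S" by (simp add: orb v(1) S_closed)
  have "\<psi> c \<ominus>\<^bsub>Q\<^esub> limit_map A \<rho> n d = cl ?w"
    by (simp add: V(2) v psi_b limit_map_eq Q_star Q_mult Q_add Q_minus orb S_closed)
  then have "nrm Q (cl ?w) < \<epsilon> / 2"
    using d Q.nrm_minus_eq[OF psi_closed[OF c] limit_map_closed[OF d(1)]] by simp
  then have "\<forall>\<^sub>F m in sequentially. norm (E ?w m) < \<epsilon> / 2" by (rule nrm_Q_less[OF w])
  then show "\<forall>\<^sub>F m in sequentially. dist (emb B (phi m (star (A m) (connecting \<rho> m k x) \<otimes>\<^bsub>A m\<^esub> connecting \<rho> m k x)))
      (adj (emb B (phi k x)) * emb B (phi k x)) < \<epsilon>"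
    using eventually_gt_at_top[of k] eventually_gt_at_top[of n]
  proof eventually_elim
    case (elim m)
    interpret Am: cstar_algebra "A m" by (rule cstar)
    interpret phi: cpc_map "A m" B "phi m" by (rule cpc_phi)
    let ?x = "connecting \<rho> m k x" and ?d = "connecting \<rho> m n d"
    have xm: "?x \<in> carrier (A m)" and dm: "?d \<in> carrier (A m)" and vm: "v m \<in> carrier (A m)"
      using elim x d v(1) by (simp_all add: connecting_closed S_carrier)
    let ?xx = "star (A m) ?x \<otimes>\<^bsub>A m\<^esub> ?x" and ?vv = "star (A m) (v m) \<otimes>\<^bsub>A m\<^esub> v m"
    have xx: "?xx \<in> carrier (A m)" and vv: "?vv \<in> carrier (A m)"
      by (simp_all add: xm vm Am.mult_closed Am.star_closed)
    obtain t where t: "t \<in> carrier B" "phi m ?xx = star B (phi m ?x) \<otimes>\<^bsub>B\<^esub> phi m ?x \<oplus>\<^bsub>B\<^esub> star B t \<otimes>\<^bsub>B\<^esub> t"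
      by (rule phi.schwarz[OF xm])
    have "phi m ?x = b" using elim by (simp add: b_def phi_connecting x)
    then have Ex: "emb B (phi m ?xx) = emb B c + adj (emb B t) * emb B t"
      using t b by (simp add: Ec B.emb_simps B.mult_closed B.star_closed)
    \<comment> \<open>Positivity of \<open>phi m\<close> on the square of \<open>v m\<close> is read
      off from the Schwarz inequality.\<close>
    obtain s where s: "s \<in> carrier B" "phi m ?vv = star B (phi m (v m)) \<otimes>\<^bsub>B\<^esub> phi m (v m) \<oplus>\<^bsub>B\<^esub> star B s \<otimes>\<^bsub>B\<^esub> s"
      by (rule phi.schwarz[OF vm])
    have "emb B (phi m ?vv) = adj (emb B (phi m (v m))) * emb B (phi m (v m)) + adj (emb B s) * emb B s"
      using s vm by (simp add: B.emb_simps B.mult_closed B.star_closed phi.closed)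
    then have vpos: "pos (emb B (phi m ?vv))"
      by (simp add: nonunital_pos_add nonunital_pos_adj_mult)
    have "?w m = (?xx \<oplus>\<^bsub>A m\<^esub> ?vv) \<ominus>\<^bsub>A m\<^esub> ?d" using elim by (simp add: orbit_def)
    then have "norm (E ?w m) = norm (emb (A m) (?xx \<oplus>\<^bsub>A m\<^esub> ?vv) - emb (A m) ?d)"
      using xx vv dm by (simp add: E_def Am.emb_minus Am.add_closed)
    moreover have "norm (emb B (phi m (?xx \<oplus>\<^bsub>A m\<^esub> ?vv)) - emb B (phi m ?d))
        \<le> norm (emb (A m) (?xx \<oplus>\<^bsub>A m\<^esub> ?vv) - emb (A m) ?d)"
      by (rule phi.norm_diff_le) (simp_all add: xx vv dm Am.add_closed)
    moreover have "phi m ?d = phi n d" using elim by (simp add: phi_connecting d)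
    moreover have "emb B (phi m (?xx \<oplus>\<^bsub>A m\<^esub> ?vv)) = emb B (phi m ?xx) + emb B (phi m ?vv)"
      using xx vv by (simp add: phi.add phi.closed B.emb_add)
    ultimately have 1: "norm (emb B c + adj (emb B t) * emb B t + emb B (phi m ?vv) - emb B (phi n d)) < \<epsilon> / 2"
      using elim(1) by (simp add: Ex)
    \<comment> \<open>By the lower bound the deviation from \<open>c\<close> is exactly the positive
      element \<open>adj t * t\<close>. Adding the positive image of the square of
      \<open>v m\<close> can only increase its norm, and the sum is small: both \<open>c\<close> and
      \<open>c\<close> plus that sum are within half of \<open>\<epsilon>\<close> of
      \<open>phi n d\<close>.\<close>
    have "norm (adj (emb B t) * emb B t) \<le> norm (adj (emb B t) * emb B t + emb B (phi m ?vv))"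
      by (rule nonunital_norm_pos_add[OF nonunital_pos_adj_mult vpos])
    also have "\<dots> = norm ((emb B c + adj (emb B t) * emb B t + emb B (phi m ?vv) - emb B (phi n d))
        - (emb B c - emb B (phi n d)))" by (simp add: algebra_simps)
    also have "\<dots> < \<epsilon> / 2 + \<epsilon> / 2"
      by (rule le_less_trans[OF norm_triangle_ineq4 add_strict_mono[OF 1 cd]])
    finally have "norm (emb B (phi m ?xx) - emb B c) < \<epsilon>" by (simp add: Ex)
    then show ?case by (simp add: dist_norm Ec b_def)
  qed
qed

text \<open>Polarization. Since the limits on the diagonal are known at \<open>x\<close> and
  \<open>y\<close> themselves, the two vectors \<open>x + y\<close> and \<open>x + i y\<close>
  suffice instead of the usual four.\<close>

lemma phi_sesquilinear_tendsto:
  assumes x: "x \<in> carrier (A k)" and y: "y \<in> carrier (A k)"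
  shows "(\<lambda>m. emb B (phi m (star (A m) (connecting \<rho> m k x) \<otimes>\<^bsub>A m\<^esub> connecting \<rho> m k y)))
    \<longlonglongrightarrow> adj (emb B (phi k x)) * emb B (phi k y)"
proof -
  define F where "F m z w = emb B (phi m (star (A m) (connecting \<rho> m k z) \<otimes>\<^bsub>A m\<^esub> connecting \<rho> m k w))" for m z w
  define G where "G z w = adj (emb B (phi k z)) * emb B (phi k w)" for z w
  interpret Ak: cstar_algebra "A k" by (rule cstar)
  interpret phik: cpc_map "A k" B "phi k" by (rule cpc_phi)
  define s where "s = x \<oplus>\<^bsub>A k\<^esub> y"
  define t where "t = x \<oplus>\<^bsub>A k\<^esub> \<i> \<odot>\<^bsub>A k\<^esub> y"
  have st: "s \<in> carrier (A k)" "t \<in> carrier (A k)"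
    by (simp_all add: s_def t_def x y Ak.add_closed Ak.smult_closed')
  have lim: "(\<lambda>m. F m z z) \<longlonglongrightarrow> G z z" if "z \<in> carrier (A k)" for z
    unfolding F_def G_def by (rule phi_square_tendsto[OF that])
  \<comment> \<open>Here \<open>p, q, r, u\<close> are the values of the form at
    \<open>(x,x)\<close>, \<open>(x,y)\<close>, \<open>(y,x)\<close>, \<open>(y,y)\<close>: the
    first bracket is \<open>q + r\<close>, the second \<open>i (q - r)\<close>.\<close>
  have polar: "(p + q + r + u - p - u) - \<i> *\<^sub>C (p + \<i> *\<^sub>C q - \<i> *\<^sub>C r + u - p - u) = 2 *\<^sub>R q"
    for p q r u :: "'b cstar_product"
  proof -
    have "p + \<i> *\<^sub>C q - \<i> *\<^sub>C r + u - p - u = \<i> *\<^sub>C (q - r)" by (simp add: scaleC_diff_right)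
    then have "\<i> *\<^sub>C (p + \<i> *\<^sub>C q - \<i> *\<^sub>C r + u - p - u) = - (q - r)"
      by (simp only: scaleC_scaleC) (simp add: scaleC_minus_left)
    then show ?thesis by (simp add: scaleR_2)
  qed
  have Gs: "G s s = G x x + G x y + G y x + G y y"
    by (simp add: G_def s_def x y phik.add phik.closed B.emb_add adj_add distrib_left distrib_right)
  have Gt: "G t t = G x x + \<i> *\<^sub>C G x y - \<i> *\<^sub>C G y x + G y y"
    by (simp add: G_def t_def x y phik.add phik.smult phik.closed B.emb_add B.emb_smult B.smult_closed'
        Ak.smult_closed' adj_add adj_scaleC distrib_left distrib_right mult_scaleC_left mult_scaleC_right
        scaleC_scaleC scaleC_minus_left left_diff_distrib scaleC_diff_right)
  have F: "F m s s = F m x x + F m x y + F m y x + F m y y"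
      "F m t t = F m x x + \<i> *\<^sub>C F m x y - \<i> *\<^sub>C F m y x + F m y y" if "k \<le> m" for m
  proof -
    interpret Am: cstar_algebra "A m" by (rule cstar)
    interpret phi: cpc_map "A m" B "phi m" by (rule cpc_phi)
    interpret con: cpc_map "A k" "A m" "connecting \<rho> m k" by (rule cpc_connecting[OF that])
    have linear_rule: "emb B (phi m (a \<oplus>\<^bsub>A m\<^esub> b)) = emb B (phi m a) + emb B (phi m b)"
      if "a \<in> carrier (A m)" "b \<in> carrier (A m)" for a b
      using that by (simp add: phi.add phi.closed B.emb_add)
    have smult_rule: "emb B (phi m (c \<odot>\<^bsub>A m\<^esub> a)) = c *\<^sub>C emb B (phi m a)" if "a \<in> carrier (A m)" for a c
      using that by (simp add: phi.smult phi.closed B.emb_smult)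
    show "F m s s = F m x x + F m x y + F m y x + F m y y"
      by (simp add: F_def s_def x y con.add con.closed Am.star_add Am.star_closed Am.mult_closed Am.add_closed
          Am.distrib_left Am.distrib_right linear_rule add_ac)
    show "F m t t = F m x x + \<i> *\<^sub>C F m x y - \<i> *\<^sub>C F m y x + F m y y"
      by (simp add: F_def t_def x y con.add con.smult con.closed Ak.smult_closed' Am.star_add Am.star_smult
          Am.star_closed Am.mult_closed Am.add_closed Am.smult_closed' Am.distrib_left Am.distrib_right
          Am.smult_mult_left Am.smult_mult_right linear_rule smult_rule scaleC_scaleC scaleC_minus_left scaleC_diff_right add_ac)
  qed
  let ?P = "\<lambda>H :: 'a \<Rightarrow> 'a \<Rightarrow> 'b cstar_product.
    (1/2) *\<^sub>R ((H s s - H x x - H y y) - \<i> *\<^sub>C (H t t - H x x - H y y))"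
  have limP: "(\<lambda>m. ?P (F m)) \<longlonglongrightarrow> ?P G"
    by (intro tendsto_intros bounded_linear.tendsto[OF bounded_linear_scaleC] lim x y st)
  have eqG: "?P G = G x y" unfolding Gs Gt polar by simp
  have evF: "\<forall>\<^sub>F m in sequentially. ?P (F m) = F m x y"
    using eventually_ge_at_top[of k] by eventually_elim (simp only: F polar, simp)
  from Lim_transform_eventually[OF limP evF] have "(\<lambda>m. F m x y) \<longlonglongrightarrow> G x y" by (simp only: eqG)
  then show ?thesis by (simp only: F_def G_def)
qed

text \<open>Replacing \<open>x\<close> by its adjoint removes the star from the sesquilinear limit,
  as the connecting maps preserve adjoints. The isometry \<open>\<psi>\<close> then carries the
  convergence from \<open>B\<close> into the sequence algebra.\<close>

lemma limit_map_mult_tendsto: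
  assumes x: "x \<in> carrier (A k)" and y: "y \<in> carrier (A k)"
  shows "limitin QM.mtopology (\<lambda>m. limit_map A \<rho> m (connecting \<rho> m k x \<otimes>\<^bsub>A m\<^esub> connecting \<rho> m k y))
    (\<psi> (phi k x \<otimes>\<^bsub>B\<^esub> phi k y)) sequentially"
proof -
  interpret Ak: cstar_algebra "A k" by (rule cstar)
  have closed: "connecting \<rho> m k x \<otimes>\<^bsub>A m\<^esub> connecting \<rho> m k y \<in> carrier (A m)" if "m \<ge> k" for m
    using that x y by (simp add: connecting_closed cstar_algebra.mult_closed[OF cstar])
  have ab: "phi k x \<otimes>\<^bsub>B\<^esub> phi k y \<in> carrier B" by (simp add: x y phi_closed B.mult_closed)
  have ev: "\<forall>\<^sub>F m in sequentially.
      emb B (phi m (star (A m) (connecting \<rho> m k (star (A k) x)) \<otimes>\<^bsub>A m\<^esub> connecting \<rho> m k y))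
      = emb B (phi m (connecting \<rho> m k x \<otimes>\<^bsub>A m\<^esub> connecting \<rho> m k y))"
    using eventually_ge_at_top[of k]
    by eventually_elim
      (simp add: cpc_map.star[OF cpc_connecting] x connecting_closed cstar_algebra.star_star[OF cstar])
  have "adj (emb B (phi k (star (A k) x))) * emb B (phi k y) = emb B (phi k x \<otimes>\<^bsub>B\<^esub> phi k y)"
    using x y by (simp add: cpc_map.star[OF cpc_phi] phi_closed B.emb_star B.emb_mult)
  then have "(\<lambda>m. emb B (phi m (connecting \<rho> m k x \<otimes>\<^bsub>A m\<^esub> connecting \<rho> m k y))) \<longlonglongrightarrow> emb B (phi k x \<otimes>\<^bsub>B\<^esub> phi k y)"
    using Lim_transform_eventually[OF phi_sesquilinear_tendsto[OF Ak.star_closed[OF x] y] ev] by simp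
  then have "(\<lambda>m. norm (emb B (phi m (connecting \<rho> m k x \<otimes>\<^bsub>A m\<^esub> connecting \<rho> m k y)) - emb B (phi k x \<otimes>\<^bsub>B\<^esub> phi k y))) \<longlonglongrightarrow> 0"
    by (simp only: tendsto_norm_zero_iff LIM_zero_iff)
  moreover have "\<forall>\<^sub>F m in sequentially.
      norm (emb B (phi m (connecting \<rho> m k x \<otimes>\<^bsub>A m\<^esub> connecting \<rho> m k y)) - emb B (phi k x \<otimes>\<^bsub>B\<^esub> phi k y))
      = norm (emb Q (limit_map A \<rho> m (connecting \<rho> m k x \<otimes>\<^bsub>A m\<^esub> connecting \<rho> m k y)) - emb Q (\<psi> (phi k x \<otimes>\<^bsub>B\<^esub> phi k y)))"
    using eventually_ge_at_top[of k]
    by eventually_elim (simp add: norm_psi_diff[symmetric] ab closed phi_closed psi_phi)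
  ultimately have "(\<lambda>m. norm (emb Q (limit_map A \<rho> m (connecting \<rho> m k x \<otimes>\<^bsub>A m\<^esub> connecting \<rho> m k y))
      - emb Q (\<psi> (phi k x \<otimes>\<^bsub>B\<^esub> phi k y)))) \<longlonglongrightarrow> 0"
    by (rule Lim_transform_eventually)
  then have "(\<lambda>m. emb Q (limit_map A \<rho> m (connecting \<rho> m k x \<otimes>\<^bsub>A m\<^esub> connecting \<rho> m k y)))
      \<longlonglongrightarrow> emb Q (\<psi> (phi k x \<otimes>\<^bsub>B\<^esub> phi k y))"
    by (simp only: tendsto_norm_zero_iff LIM_zero_iff)
  moreover have "\<forall>\<^sub>F m in sequentially. limit_map A \<rho> m (connecting \<rho> m k x \<otimes>\<^bsub>A m\<^esub> connecting \<rho> m k y) \<in> carrier Q"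
    using eventually_ge_at_top[of k] by eventually_elim (simp add: closed limit_map_closed)
  ultimately show ?thesis by (simp only: limitin_Q_iff psi_closed ab)
qed

section \<open>The product transported from \<open>B\<close> as the product of the limit\<close>

lemma L_add: "X \<in> L \<Longrightarrow> Y \<in> L \<Longrightarrow> X \<oplus>\<^bsub>Q\<^esub> Y \<in> L"
  by (elim L_cases) (simp add: B.add_closed psi_L flip: psi.add)

lemma L_smult: "X \<in> L \<Longrightarrow> c \<odot>\<^bsub>Q\<^esub> X \<in> L"
  by (elim L_cases) (simp add: B.smult_closed' psi_L flip: psi.smult)

definition transported_product :: "(nat \<Rightarrow> 'a) set \<Rightarrow> (nat \<Rightarrow> 'a) set \<Rightarrow> (nat \<Rightarrow> 'a) set" where
  "transported_product X Y = \<psi> (psi_inv X \<otimes>\<^bsub>B\<^esub> psi_inv Y)"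

lemma transported_product_psi:
  "a \<in> carrier B \<Longrightarrow> b \<in> carrier B \<Longrightarrow> transported_product (\<psi> a) (\<psi> b) = \<psi> (a \<otimes>\<^bsub>B\<^esub> b)"
  by (simp add: transported_product_def psi_inv_psi)

text \<open>The algebraic clauses are those of \<open>B\<close>, the bound holds with
  \<open>C = 1\<close> because \<open>\<psi>\<close> is isometric, and the limit clause is
  \<open>limit_map_mult_tendsto\<close>. The choice in \<open>limit_product\<close> thereby has a
  witness.\<close>

lemma is_limit_product_transported: "is_limit_product A \<rho> transported_product"
proof -
  note simps = transported_product_psi B.add_closed B.smult_closed' B.mult_closed psi_L
  have "transported_product X Y \<in> L" if "X \<in> L" "Y \<in> L" for X Y
    using that by (elim L_cases) (simp add: simps)
  moreover have "transported_product (X \<oplus>\<^bsub>Q\<^esub> Y) Z = transported_product X Z \<oplus>\<^bsub>Q\<^esub> transported_product Y Z"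
    if "X \<in> L" "Y \<in> L" "Z \<in> L" for X Y Z
    using that by (elim L_cases) (simp add: simps B.distrib_right flip: psi.add)
  moreover have "transported_product Z (X \<oplus>\<^bsub>Q\<^esub> Y) = transported_product Z X \<oplus>\<^bsub>Q\<^esub> transported_product Z Y"
    if "X \<in> L" "Y \<in> L" "Z \<in> L" for X Y Z
    using that by (elim L_cases) (simp add: simps B.distrib_left flip: psi.add)
  moreover have "transported_product (c \<odot>\<^bsub>Q\<^esub> X) Y = c \<odot>\<^bsub>Q\<^esub> transported_product X Y"
    if "X \<in> L" "Y \<in> L" for c X Y
    using that by (elim L_cases) (simp add: simps B.smult_mult_left flip: psi.smult)
  moreover have "transported_product X (c \<odot>\<^bsub>Q\<^esub> Y) = c \<odot>\<^bsub>Q\<^esub> transported_product X Y"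
    if "X \<in> L" "Y \<in> L" for c X Y
    using that by (elim L_cases) (simp add: simps B.smult_mult_right flip: psi.smult)
  moreover have "transported_product (transported_product X Y) Z = transported_product X (transported_product Y Z)"
    if "X \<in> L" "Y \<in> L" "Z \<in> L" for X Y Z
    using that by (elim L_cases) (simp add: simps B.mult_assoc)
  moreover have "nrm Q (transported_product X Y) \<le> 1 * nrm Q X * nrm Q Y" if "X \<in> L" "Y \<in> L" for X Y
    using that by (elim L_cases) (simp add: simps nrm_psi B.nrm_mult)
  then have "\<exists>C. \<forall>X\<in>L. \<forall>Y\<in>L. nrm Q (transported_product X Y) \<le> C * nrm Q X * nrm Q Y" by blast
  moreover have "limitin QM.mtopology
      (\<lambda>n. limit_map A \<rho> n (connecting \<rho> n k x \<otimes>\<^bsub>A n\<^esub> connecting \<rho> n k y))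
      (transported_product (limit_map A \<rho> k x) (limit_map A \<rho> k y)) sequentially"
    if "x \<in> carrier (A k)" "y \<in> carrier (A k)" for k x y
    using limit_map_mult_tendsto[OF that] transported_product_psi[OF phi_closed phi_closed, OF that]
    by (simp add: psi_phi that)
  ultimately show ?thesis unfolding is_limit_product_def Let_def by simp
qed

text \<open>Boundedness and bilinearity give joint continuity, by splitting the difference as
  \<open>p (X' - X) Y' + p X (Y' - Y)\<close>.\<close>

lemma limit_product_continuous:
  assumes p: "is_limit_product A \<rho> p"
    and L: "X \<in> L" "Y \<in> L" "\<And>j. X' j \<in> L" "\<And>j. Y' j \<in> L"
    and lim: "(\<lambda>j. emb Q (X' j)) \<longlonglongrightarrow> emb Q X" "(\<lambda>j. emb Q (Y' j)) \<longlonglongrightarrow> emb Q Y"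
  shows "(\<lambda>j. emb Q (p (X' j) (Y' j))) \<longlonglongrightarrow> emb Q (p X Y)"
proof -
  note p' = p[unfolded is_limit_product_def Let_def]
  have pL: "p U V \<in> L" if "U \<in> L" "V \<in> L" for U V
    using p' that by simp
  have padd: "p (U \<oplus>\<^bsub>Q\<^esub> W) V = p U V \<oplus>\<^bsub>Q\<^esub> p W V" "p V (U \<oplus>\<^bsub>Q\<^esub> W) = p V U \<oplus>\<^bsub>Q\<^esub> p V W"
    if "U \<in> L" "V \<in> L" "W \<in> L" for U V W
    using p' that by simp_all
  have psmult: "p (c \<odot>\<^bsub>Q\<^esub> U) V = c \<odot>\<^bsub>Q\<^esub> p U V" "p U (c \<odot>\<^bsub>Q\<^esub> V) = c \<odot>\<^bsub>Q\<^esub> p U V"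
    if "U \<in> L" "V \<in> L" for c U V
    using p' that by simp_all
  have "\<exists>C. \<forall>U\<in>L. \<forall>V\<in>L. nrm Q (p U V) \<le> C * nrm Q U * nrm Q V"
    using p' by (elim conjE)
  then obtain C where C: "\<And>U V. U \<in> L \<Longrightarrow> V \<in> L \<Longrightarrow> nrm Q (p U V) \<le> C * nrm Q U * nrm Q V"
    by blast
  \<comment> \<open>Bilinearity is given by sums and scalar multiples of elements of
    \<open>L\<close>, so differences are rewritten with the scalar \<open>-1\<close> before they are
    split.\<close>
  have minus: "U \<ominus>\<^bsub>Q\<^esub> V = U \<oplus>\<^bsub>Q\<^esub> (- 1) \<odot>\<^bsub>Q\<^esub> V" if "U \<in> L" "V \<in> L" for U V
    using that by (simp add: a_minus_def Q.smult_minus_one L_carrier)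
  have minusL: "U \<ominus>\<^bsub>Q\<^esub> V \<in> L" if "U \<in> L" "V \<in> L" for U V
    using that by (simp add: minus L_add L_smult)
  have pminus: "emb Q (p (U \<ominus>\<^bsub>Q\<^esub> W) V) = emb Q (p U V) - emb Q (p W V)"
      "emb Q (p V (U \<ominus>\<^bsub>Q\<^esub> W)) = emb Q (p V U) - emb Q (p V W)"
    if "U \<in> L" "V \<in> L" "W \<in> L" for U V W
    using that by (simp_all add: minus padd psmult L_smult pL L_carrier Q.smult_closed' Q.emb_add
        Q.emb_smult scaleC_minus_left)
  have bound: "norm (emb Q (p (X' j) (Y' j)) - emb Q (p X Y))
      \<le> C * norm (emb Q (X' j) - emb Q X) * norm (emb Q (Y' j)) + C * norm (emb Q X) * norm (emb Q (Y' j) - emb Q Y)" for j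
  proof -
    have "emb Q (p (X' j) (Y' j)) - emb Q (p X (Y' j)) = emb Q (p (X' j \<ominus>\<^bsub>Q\<^esub> X) (Y' j))"
      using L by (simp add: pminus)
    then have 1: "norm (emb Q (p (X' j) (Y' j)) - emb Q (p X (Y' j)))
        \<le> C * norm (emb Q (X' j) - emb Q X) * norm (emb Q (Y' j))"
      using C[of "X' j \<ominus>\<^bsub>Q\<^esub> X" "Y' j"] L
      by (simp add: minusL pL L_carrier Q.norm_emb Q.nrm_minus_eq)
    have "emb Q (p X (Y' j)) - emb Q (p X Y) = emb Q (p X (Y' j \<ominus>\<^bsub>Q\<^esub> Y))"
      using L by (simp add: pminus)
    then have 2: "norm (emb Q (p X (Y' j)) - emb Q (p X Y))
        \<le> C * norm (emb Q X) * norm (emb Q (Y' j) - emb Q Y)"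
      using C[of X "Y' j \<ominus>\<^bsub>Q\<^esub> Y"] L
      by (simp add: minusL pL L_carrier Q.norm_emb Q.nrm_minus_eq)
    show ?thesis
      using norm_triangle_ineq[of "emb Q (p (X' j) (Y' j)) - emb Q (p X (Y' j))" "emb Q (p X (Y' j)) - emb Q (p X Y)"] 1 2
      by simp
  qed
  have "(\<lambda>j. C * norm (emb Q (X' j) - emb Q X) * norm (emb Q (Y' j)) + C * norm (emb Q X) * norm (emb Q (Y' j) - emb Q Y))
      \<longlonglongrightarrow> C * norm (emb Q X - emb Q X) * norm (emb Q Y) + C * norm (emb Q X) * norm (emb Q Y - emb Q Y)"
    by (intro tendsto_intros lim)
  then have 0: "(\<lambda>j. C * norm (emb Q (X' j) - emb Q X) * norm (emb Q (Y' j)) + C * norm (emb Q X) * norm (emb Q (Y' j) - emb Q Y))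
      \<longlonglongrightarrow> 0" by simp
  show ?thesis
    by (rule LIM_zero_cancel, rule Lim_null_comparison[OF always_eventually 0], rule allI, rule bound)
qed

text \<open>Both products are limits of the same sequence at pairs from the dense union, and
  continuity extends the equality to \<open>L\<close>. The limit clause speaks of two elements of
  the same stage, so approximants of \<open>X\<close> and \<open>Y\<close> must be brought to a
  common one.\<close>

lemma limit_product_unique:
  assumes p: "is_limit_product A \<rho> p" and q: "is_limit_product A \<rho> q" and XY: "X \<in> L" "Y \<in> L"
  shows "p X Y = q X Y"
proof -
  have "\<exists>k x y. x \<in> carrier (A k) \<and> y \<in> carrier (A k) \<and>
      norm (emb Q X - emb Q (limit_map A \<rho> k x)) < \<epsilon> \<and> norm (emb Q Y - emb Q (limit_map A \<rho> k y)) < \<epsilon>"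
    if "\<epsilon> > 0" for \<epsilon>
  proof -
    obtain n x where x: "x \<in> carrier (A n)" "norm (emb Q X - emb Q (limit_map A \<rho> n x)) < \<epsilon>"
      by (rule L_approx[OF XY(1) \<open>\<epsilon> > 0\<close>])
    obtain m y where y: "y \<in> carrier (A m)" "norm (emb Q Y - emb Q (limit_map A \<rho> m y)) < \<epsilon>"
      by (rule L_approx[OF XY(2) \<open>\<epsilon> > 0\<close>])
    show ?thesis
      using x y
      \<comment> \<open>The connecting maps move both approximants to stage \<open>max n m\<close>
        without changing their images in the limit.\<close>
      by (intro exI[of _ "max n m"] exI[of _ "connecting \<rho> (max n m) n x"] exI[of _ "connecting \<rho> (max n m) m y"])
        (simp add: connecting_closed limit_map_connecting)
  qed
  then have "\<forall>j. \<exists>k x y. x \<in> carrier (A k) \<and> y \<in> carrier (A k) \<and>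
      norm (emb Q X - emb Q (limit_map A \<rho> k x)) < inverse (real (Suc j)) \<and>
      norm (emb Q Y - emb Q (limit_map A \<rho> k y)) < inverse (real (Suc j))" by simp
  then obtain k x y where xy: "\<And>j. x j \<in> carrier (A (k j))" "\<And>j. y j \<in> carrier (A (k j))"
    and near: "\<And>j. norm (emb Q X - emb Q (limit_map A \<rho> (k j) (x j))) < inverse (real (Suc j))"
      "\<And>j. norm (emb Q Y - emb Q (limit_map A \<rho> (k j) (y j))) < inverse (real (Suc j))"
    by metis
  let ?X = "\<lambda>j. limit_map A \<rho> (k j) (x j)" and ?Y = "\<lambda>j. limit_map A \<rho> (k j) (y j)"
  have lim: "(\<lambda>j. emb Q (?X j)) \<longlonglongrightarrow> emb Q X" "(\<lambda>j. emb Q (?Y j)) \<longlonglongrightarrow> emb Q Y"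
    by (rule LIM_zero_cancel, rule Lim_null_comparison[OF always_eventually LIMSEQ_inverse_real_of_nat],
        use near in \<open>simp add: norm_minus_commute less_imp_le\<close>)+
  have eq: "p (?X j) (?Y j) = q (?X j) (?Y j)" for j
  proof (rule QM.limitin_metric_unique)
    show "limitin QM.mtopology (\<lambda>n. limit_map A \<rho> n (connecting \<rho> n (k j) (x j) \<otimes>\<^bsub>A n\<^esub> connecting \<rho> n (k j) (y j)))
        (p (?X j) (?Y j)) sequentially"
      using p xy unfolding is_limit_product_def Let_def by simp
    show "limitin QM.mtopology (\<lambda>n. limit_map A \<rho> n (connecting \<rho> n (k j) (x j) \<otimes>\<^bsub>A n\<^esub> connecting \<rho> n (k j) (y j)))
        (q (?X j) (?Y j)) sequentially"
      using q xy unfolding is_limit_product_def Let_def by simp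
  qed simp
  note cont = limit_product_continuous[OF _ XY limit_map_in_L[OF xy(1)] limit_map_in_L[OF xy(2)] lim]
  have "emb Q (p X Y) = emb Q (q X Y)"
    using cont[OF p] cont[OF q] unfolding eq by (rule LIMSEQ_unique)
  moreover have "p X Y \<in> carrier Q" "q X Y \<in> carrier Q"
    using p q XY L_carrier unfolding is_limit_product_def Let_def by simp_all
  ultimately show ?thesis by (simp only: Q.emb_inject)
qed

text \<open>The chosen product satisfies its specification, since the transported product does; by
  uniqueness the two agree on \<open>L\<close>. So \<open>\<psi>\<close> is multiplicative into the
  C*-limit.\<close>

lemma limit_product_psi:
  assumes "a \<in> carrier B" "b \<in> carrier B"
  shows "limit_product A \<rho> (\<psi> a) (\<psi> b) = \<psi> (a \<otimes>\<^bsub>B\<^esub> b)"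
proof -
  have "is_limit_product A \<rho> (limit_product A \<rho>)"
    unfolding limit_product_def
    by (rule someI[where P = "is_limit_product A \<rho>", OF is_limit_product_transported])
  then have "limit_product A \<rho> (\<psi> a) (\<psi> b) = transported_product (\<psi> a) (\<psi> b)"
    by (rule limit_product_unique[OF _ is_limit_product_transported]) (simp_all add: assms psi_L)
  then show ?thesis by (simp add: transported_product_psi assms)
qed

end

theorem corollary2p10:
  fixes A :: "nat \<Rightarrow> 'a cstar" and \<rho> :: "nat \<Rightarrow> 'a \<Rightarrow> 'a"
    and B :: "'b cstar" and \<psi> :: "'b \<Rightarrow> (nat \<Rightarrow> 'a) set"
  assumes "cpc_system A \<rho>" and "cstar_encoding A \<rho>"
    and "cstar_algebra B"
    and "complete_order_embedding B (carrier B)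
           (sequence_algebra A) (carrier (sequence_algebra A)) \<psi>"
    and "\<psi> ` carrier B = system_limit A \<rho>"
  shows "star_isomorphism B (cstar_limit A \<rho>)
           (inv_into (carrier (cstar_limit A \<rho>)) (limit_embedding A \<rho>) \<circ> \<psi>)"
proof -
  interpret system_embedding A \<rho> B \<psi>
  proof (intro system_embedding.intro cpc_sequence.intro cstar_sequence.intro cpc_sequence_axioms.intro
      system_embedding_axioms.intro assms)
    show "cstar_algebra (A n)" for n using assms(1) by (simp add: cpc_system_def)
  qed
  let ?f = "inv_into (carrier (cstar_limit A \<rho>)) (limit_embedding A \<rho>) \<circ> \<psi>"
  have carrier: "carrier (cstar_limit A \<rho>) = L" by (simp add: cstar_limit_def)
  have inj: "inj_on (limit_embedding A \<rho>) L"
    by (simp add: inj_on_def limit_embedding_def carrier)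
  \<comment> \<open>\<open>limit_embedding\<close> is the identity on \<open>L\<close>, so its
    inverse changes no value of \<open>\<psi>\<close>, and the claims become statements about
    \<open>\<psi>\<close>.\<close>
  have f: "?f b = \<psi> b" if "b \<in> carrier B" for b
    using inv_into_f_f[OF inj psi_L[OF that]] psi_L[OF that]
    by (simp add: carrier limit_embedding_def)
  have "bij_betw \<psi> (carrier B) L" unfolding bij_betw_def by (simp add: inj_psi image)
  then have "bij_betw ?f (carrier B) (carrier (cstar_limit A \<rho>))"
    unfolding carrier by (subst bij_betw_cong[where g = \<psi>]) (use f carrier in simp_all)
  moreover have "?f (x \<oplus>\<^bsub>B\<^esub> y) = ?f x \<oplus>\<^bsub>cstar_limit A \<rho>\<^esub> ?f y"
    if "x \<in> carrier B" "y \<in> carrier B" for x y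
    unfolding f[OF that(1)] f[OF that(2)] f[OF B.add_closed[OF that]]
    by (simp add: cstar_limit_def psi.add that)
  moreover have "?f (c \<odot>\<^bsub>B\<^esub> x) = c \<odot>\<^bsub>cstar_limit A \<rho>\<^esub> ?f x" if "x \<in> carrier B" for c x
    unfolding f[OF that] f[OF B.smult_closed'[OF that]]
    by (simp add: cstar_limit_def psi.smult that)
  moreover have "?f (x \<otimes>\<^bsub>B\<^esub> y) = ?f x \<otimes>\<^bsub>cstar_limit A \<rho>\<^esub> ?f y"
    if "x \<in> carrier B" "y \<in> carrier B" for x y
    unfolding f[OF that(1)] f[OF that(2)] f[OF B.mult_closed[OF that]]
    by (simp add: cstar_limit_def limit_product_psi that)
  moreover have "?f (star B x) = star (cstar_limit A \<rho>) (?f x)" if "x \<in> carrier B" for x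
    unfolding f[OF that] f[OF B.star_closed[OF that]]
    by (simp add: cstar_limit_def psi.star that)
  ultimately show ?thesis
    unfolding star_isomorphism_def by (intro conjI ballI allI)
qed

end
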